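(* Let $d\ge 4$ and, for $0\le i\le d-1$, let $J_i=\sqrt{\operatorname{ann}_S H^i_{S_+}(S)}$. Then $(\mathbf d_{d,0},\mathbf d_{d,1},\mathbf d_{d,2})\subseteq J_i$ for $0\le i\le d-1$.
   Context: Let $q=p^s$ be a power of a prime $p$, $\mathbb F_q$ the field with $q$ elements, $V$ a $d$-dimensional $\mathbb F_q$-vector space, and $G$ a subgroup of $GL(V)$. Let $R=\mathbb F_q[V]=\operatorname{Sym}_{\mathbb F_q}(V^* )$, graded with $V^*$ in degree $1$, with the natural action of $G$, and let $S=R^G$; $S_+$ is the ideal of $S$ generated by homogeneous elements of positive degree, and $H^i_{S_+}(S)$ is the $i$-th local cohomology module. $S$ contains the Dickson algebra $D^*(d)=R^{GL(V)}$, which is the polynomial ring $\mathbb F_q[\mathbf d_{d,0},\ldots,\mathbf d_{d,d-1}]$, where $\mathbf d_{d,i}$ ($0\le i\le d-1$) is the Dickson polynomial of degree $q^d-q^i$, given by $\prod_{v\in V^*}(X+v)=X^{q^d}+\sum_{i=0}^{d-1}(-1)^{d-i}\mathbf d_{d,i}X^{q^i}$. *)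

theory Defs
  imports
    "HOL-Analysis.Finite_Cartesian_Product"
    "HOL-Library.Poly_Mapping"
    "HOL-Computational_Algebra.Polynomial"
    "HOL-Algebra.Algebra"
begin

section \<open>Radicals and annihilators\<close>

definition radical :: "('a, 'm) ring_scheme \<Rightarrow> 'a set \<Rightarrow> 'a set" where
  "radical R I = {r \<in> carrier R. \<exists>n::nat. r [^]\<^bsub>R\<^esub> n \<in> I}"

definition annihilator :: "('a, 'm) ring_scheme \<Rightarrow> ('a, 'b) module \<Rightarrow> 'a set" where
  "annihilator R M = {r \<in> carrier R. \<forall>x\<in>carrier M. r \<odot>\<^bsub>M\<^esub> x = \<zero>\<^bsub>M\<^esub>}"


section \<open>Modules\<close>

text \<open>The name \<open>module\<close> also belongs to a locale of HOL, hence the qualified \<open>Module.module\<close>.\<close>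

definition regular_module :: "('a, 'm) ring_scheme \<Rightarrow> ('a, 'a) module" where
  "regular_module R =
    \<lparr>carrier = carrier R, mult = mult R, one = one R,
     ring.zero = ring.zero R, ring.add = ring.add R, smult = mult R\<rparr>"

definition mod_hom ::
  "('a, 'm) ring_scheme \<Rightarrow> ('a, 'b) module \<Rightarrow> ('a, 'c) module \<Rightarrow> ('b \<Rightarrow> 'c) set" where
  "mod_hom R M N = {h. h \<in> carrier M \<rightarrow> carrier N \<and>
     (\<forall>x\<in>carrier M. \<forall>y\<in>carrier M. h (x \<oplus>\<^bsub>M\<^esub> y) = h x \<oplus>\<^bsub>N\<^esub> h y) \<and>
     (\<forall>r\<in>carrier R. \<forall>x\<in>carrier M. h (r \<odot>\<^bsub>M\<^esub> x) = r \<odot>\<^bsub>N\<^esub> h x)}"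

definition mod_kernel ::
  "('a, 'b) module \<Rightarrow> ('a, 'c) module \<Rightarrow> ('b \<Rightarrow> 'c) \<Rightarrow> 'b set" where
  "mod_kernel M N h = {x \<in> carrier M. h x = \<zero>\<^bsub>N\<^esub>}"

text \<open>Only the additive structure and the scalar multiplication of a module record matter;
  the fields \<open>mult\<close> and \<open>one\<close> are filled arbitrarily.\<close>

definition quotient_module :: "('a, 'b) module \<Rightarrow> 'b set \<Rightarrow> ('a, 'b set) module" where
  "quotient_module M N =
    \<lparr>carrier = a_rcosets\<^bsub>M\<^esub> N, mult = undefined, one = undefined,
     ring.zero = N, ring.add = set_add M, smult = (\<lambda>r C. \<Union>x\<in>C. a_r_coset M N (r \<odot>\<^bsub>M\<^esub> x))\<rparr>"

text \<open>HOL cannot quantify over types inside a definition, so the test modules \<open>B\<close> have elements in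
  the type of the ring. Nothing is lost: the regular module and its ideals are among them, so by
  Baer's criterion this gives the extension property for modules over every type.\<close>

definition injective_module :: "('a, 'm) ring_scheme \<Rightarrow> ('a, 'e) module \<Rightarrow> bool" where
  "injective_module R E \<longleftrightarrow> Module.module R E \<and>
    (\<forall>(B :: ('a, 'a) module) A. \<forall>h \<in> mod_hom R (B\<lparr>carrier := A\<rparr>) E.
       Module.module R B \<and> submodule A R B \<longrightarrow>
       (\<exists>h' \<in> mod_hom R B E. \<forall>x\<in>A. h' x = h x))"

text \<open>Exactness of \<open>0 \<rightarrow> M \<rightarrow> E 0 \<rightarrow> E 1 \<rightarrow> \<dots>\<close> with augmentation \<open>\<epsilon>\<close> and differentials \<open>\<delta>\<close>.\<close>

definition injective_resolution ::
  "('a, 'm) ring_scheme \<Rightarrow> ('a, 'b) module \<Rightarrow> (nat \<Rightarrow> ('a, 'e) module) \<Rightarrow>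
   (nat \<Rightarrow> 'e \<Rightarrow> 'e) \<Rightarrow> ('b \<Rightarrow> 'e) \<Rightarrow> bool" where
  "injective_resolution R M E \<delta> \<epsilon> \<longleftrightarrow>
    (\<forall>i. injective_module R (E i)) \<and>
    (\<forall>i. \<delta> i \<in> mod_hom R (E i) (E (Suc i))) \<and>
    \<epsilon> \<in> mod_hom R M (E 0) \<and>
    inj_on \<epsilon> (carrier M) \<and>
    mod_kernel (E 0) (E 1) (\<delta> 0) = \<epsilon> ` carrier M \<and>
    (\<forall>i. mod_kernel (E (Suc i)) (E (Suc (Suc i))) (\<delta> (Suc i)) = \<delta> i ` carrier (E i))"


section \<open>Local cohomology\<close>

definition torsion :: "('a, 'm) ring_scheme \<Rightarrow> 'a set \<Rightarrow> ('a, 'b) module \<Rightarrow> 'b set" where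
  "torsion R I M =
    {x \<in> carrier M. \<exists>n::nat. \<forall>r \<in> I [^]\<^bsub>ideals_set R\<^esub> n. r \<odot>\<^bsub>M\<^esub> x = \<zero>\<^bsub>M\<^esub>}"

definition torsion_cocycles ::
  "('a, 'm) ring_scheme \<Rightarrow> 'a set \<Rightarrow> (nat \<Rightarrow> ('a, 'e) module) \<Rightarrow> (nat \<Rightarrow> 'e \<Rightarrow> 'e) \<Rightarrow> nat \<Rightarrow> 'e set" where
  "torsion_cocycles R I E \<delta> i = {x \<in> torsion R I (E i). \<delta> i x = \<zero>\<^bsub>E (Suc i)\<^esub>}"

definition torsion_coboundaries ::
  "('a, 'm) ring_scheme \<Rightarrow> 'a set \<Rightarrow> (nat \<Rightarrow> ('a, 'e) module) \<Rightarrow> (nat \<Rightarrow> 'e \<Rightarrow> 'e) \<Rightarrow> nat \<Rightarrow> 'e set" where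
  "torsion_coboundaries R I E \<delta> i =
    (case i of 0 \<Rightarrow> {\<zero>\<^bsub>E 0\<^esub>} | Suc j \<Rightarrow> \<delta> j ` torsion R I (E j))"

text \<open>The right derived functors of \<open>I\<close>-torsion: if \<open>E\<close>, \<open>\<delta>\<close> is an injective resolution of \<open>M\<close>, this is
  the \<open>i\<close>-th local cohomology module of \<open>M\<close> with support in \<open>I\<close>, computed from that resolution.\<close>

definition local_cohomology ::
  "('a, 'm) ring_scheme \<Rightarrow> 'a set \<Rightarrow> (nat \<Rightarrow> ('a, 'e) module) \<Rightarrow> (nat \<Rightarrow> 'e \<Rightarrow> 'e) \<Rightarrow> nat \<Rightarrow>
   ('a, 'e set) module" where
  "local_cohomology R I E \<delta> i =
    quotient_module ((E i)\<lparr>carrier := torsion_cocycles R I E \<delta> i\<rparr>) (torsion_coboundaries R I E \<delta> i)"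


section \<open>Polynomial invariants\<close>

text \<open>\<open>V\<close> is \<open>'k ^ 'n\<close>, and the symmetric algebra of its dual is the ring of polynomials over \<open>'k\<close> in
  the coordinate functions, which are indexed by \<open>'n\<close>.\<close>

type_synonym ('k, 'n) mpoly = "('n \<Rightarrow>\<^sub>0 nat) \<Rightarrow>\<^sub>0 'k"

definition const_poly :: "'k \<Rightarrow> ('k::field, 'n) mpoly" where
  "const_poly c = Poly_Mapping.single 0 c"

definition var :: "'n \<Rightarrow> ('k::field, 'n) mpoly" where
  "var i = Poly_Mapping.single (Poly_Mapping.single i 1) 1"

text \<open>The element of the dual of \<open>V\<close> with coefficients \<open>a\<close>.\<close>

definition linear_form :: "'k ^ 'n \<Rightarrow> ('k::field, 'n::finite) mpoly" where
  "linear_form a = (\<Sum>i\<in>UNIV. const_poly (a $ i) * var i)"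

definition homogeneous :: "nat \<Rightarrow> ('k::field, 'n::finite) mpoly \<Rightarrow> bool" where
  "homogeneous m f \<longleftrightarrow> (\<forall>u \<in> Poly_Mapping.keys f. (\<Sum>i\<in>UNIV. Poly_Mapping.lookup u i) = m)"

definition general_linear_group :: "('k::field ^ 'n ^ 'n) monoid" where
  "general_linear_group = \<lparr>carrier = {A. invertible A}, mult = (**), one = mat 1\<rparr>"

definition substitute ::
  "('n \<Rightarrow> ('k, 'n) mpoly) \<Rightarrow> ('k, 'n) mpoly \<Rightarrow> ('k::field, 'n::finite) mpoly" where
  "substitute \<sigma> f =
    (\<Sum>u\<in>Poly_Mapping.keys f.
       const_poly (Poly_Mapping.lookup f u) * (\<Prod>i\<in>UNIV. \<sigma> i ^ Poly_Mapping.lookup u i))"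

text \<open>\<open>(g \<cdot> f)(v) = f(g\<^sup>-\<^sup>1 v)\<close>: the \<open>i\<close>-th coordinate goes to the linear form given by the \<open>i\<close>-th row
  of the inverse matrix.\<close>

definition gl_action :: "'k ^ 'n ^ 'n \<Rightarrow> ('k, 'n) mpoly \<Rightarrow> ('k::field, 'n::finite) mpoly" where
  "gl_action g = substitute (\<lambda>i. linear_form (matrix_inv g $ i))"

definition invariant_ring :: "('k ^ 'n ^ 'n) set \<Rightarrow> ('k::field, 'n::finite) mpoly ring" where
  "invariant_ring G =
    \<lparr>carrier = {f. \<forall>g\<in>G. gl_action g f = f}, mult = (*), one = 1, ring.zero = 0, ring.add = (+)\<rparr>"

definition positive_ideal :: "('k::field, 'n::finite) mpoly ring \<Rightarrow> ('k, 'n) mpoly set" where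
  "positive_ideal S = Idl\<^bsub>S\<^esub> {f \<in> carrier S. \<exists>m>0. homogeneous m f}"


section \<open>Dickson polynomials\<close>

definition dickson_product :: "('k::{field,finite}, 'n::finite) mpoly poly" where
  "dickson_product = (\<Prod>a\<in>UNIV. [:linear_form a, 1:])"

text \<open>With \<open>q = CARD('k)\<close> and \<open>d = CARD('n)\<close>, the coefficient of \<open>X^(q^i)\<close> in the product over all
  linear forms is \<open>(-1)\<close> to the power \<open>d - i\<close> times the \<open>i\<close>-th Dickson polynomial.\<close>

definition dickson :: "nat \<Rightarrow> ('k::{field,finite}, 'n::finite) mpoly" where
  "dickson i = (- 1) ^ (CARD('n) - i) * Polynomial.coeff dickson_product (CARD('k) ^ i)"

end

theory Submission
  imports Defs "HOL-Analysis.Cartesian_Space"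
begin

text \<open>Let \<open>L\<close> be the space of linear forms, \<open>R\<close> the polynomial ring and \<open>S\<close> the ring of invariants of
  \<open>G\<close>. Local cohomology of \<open>S\<close> is the direct limit of the modules \<open>Ext(S / I^n, S)\<close>, where \<open>I\<close> is the
  ideal generated by the invariants of positive degree. It is therefore enough to find elements of
  \<open>S\<close> whose product with every cocycle of \<open>Hom(P, S)\<close> in degrees below the dimension \<open>d\<close> is a
  coboundary, where \<open>P\<close> is a free resolution of \<open>S / I^n\<close>. The direct limit is never formed: a cocycle
  of torsion elements in the injective resolution is killed by some \<open>I^n\<close>, and a staircase argument
  between the two resolutions carries the annihilation over (\<open>torsion_cocycle_killed\<close>).

  The annihilating elements are transfers. By \<open>dickson_coeff_power_eq_sum\<close>, a power with exponent
  \<open>q^t\<close> of the \<open>i\<close>-th Dickson polynomial is, up to sign, a sum of terms \<open>c x\<close>, where \<open>x\<close> runs over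
  a finite set on which the linear group acts, and \<open>c\<close> is equivariant. Here \<open>x\<close> consists of a chain of
  \<open>i\<close> successive quotients of \<open>L\<close> by lines, together with a list of vectors in the last quotient;
  and \<open>c x\<close> vanishes unless the list is a basis of it. A group element fixing such an \<open>x\<close> acts
  trivially on that basis, hence on \<open>L / W\<close> for a subspace \<open>W\<close> of dimension \<open>i\<close>. The formula
  rests on two facts about a finite space of cardinality \<open>q^m\<close> in a ring without zero divisors: its
  power sums vanish in degrees below \<open>q^m - 1\<close>, and its Dickson coefficients are sums of those of its
  quotients by lines.

  When \<open>i \<le> 2\<close>, enlarge \<open>W\<close> to a plane. A group \<open>H\<close> acting trivially on \<open>L / W\<close> has an invariant ring
  with a regular sequence of length \<open>d\<close> (\<open>stabilizer_regular_sequence\<close>): the norms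
  \<open>\<Prod>w\<in>W. x + w\<close> of the \<open>d - 2\<close> coordinates outside \<open>W\<close>, followed by two coprime invariants of \<open>W\<close>.
  Taking remainders modulo the norms commutes with \<open>H\<close>, and reduces the regularity to the coprimality
  of the last two elements. All of them are homogeneous of positive degree, so by integrality
  powers of them lie in the ideal generated by \<open>I\<close>, and every cocycle with values in \<open>R^H\<close> is a
  coboundary in degrees below \<open>d\<close> (\<open>cocycle_imp_coboundary\<close>). This is where the bound \<open>2\<close>
  on the index comes from.

  Finally a cocycle with values in \<open>S\<close> is split over each of the rings \<open>R^H\<close>, \<open>H\<close> the stabilizer of
  \<open>x\<close>, in a way that is compatible along the orbits; the sum of the splittings weighted with \<open>c x\<close> takes
  values in \<open>S\<close> and splits the cocycle multiplied by the sum of all \<open>c x\<close> (\<open>orbit_transfer\<close>). The elements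
  that have a power with a fixed exponent \<open>q^t\<close> of this kind form an ideal, because that power map is
  additive, so the whole ideal generated by the three Dickson polynomials is reached.\<close>

section \<open>Finite fields and the Frobenius map\<close>

text \<open>Multiplication by a nonzero \<open>c\<close> permutes the nonzero elements, so it does not change their product.\<close>

lemma finite_field_power_card:
  fixes c :: "'k::{field,finite}"
  shows "c ^ CARD('k) = c"
proof (cases "c = 0")
  case False
  have "(\<Prod>y\<in>UNIV-{0}. c * y) = (\<Prod>y\<in>UNIV-{0}. y)"
    by (rule prod.reindex_bij_witness[of _ "\<lambda>y. y / c" "\<lambda>y. c * y"]) (use False in auto)
  then have "c ^ (CARD('k) - 1) * \<Prod>(UNIV-{0::'k}) = \<Prod>(UNIV-{0::'k})"
    by (simp add: prod.distrib)
  moreover have "\<Prod>(UNIV-{0::'k}) \<noteq> 0"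
    by simp
  ultimately have "c ^ (CARD('k) - 1) = 1"
    by simp
  then have "c ^ Suc (CARD('k) - 1) = c"
    by (subst power_Suc) simp
  moreover have "Suc (CARD('k) - 1) = CARD('k)"
    using zero_less_card_finite[where 'a='k] by simp
  ultimately show ?thesis
    by metis
qed (simp add: zero_less_card_finite)

lemma finite_field_card_ge_2: "CARD('k::{field,finite}) \<ge> 2"
proof -
  have "card {0, 1 :: 'k} \<le> CARD('k)"
    by (intro card_mono) auto
  then show ?thesis by simp
qed

text \<open>Translation by \<open>1\<close> permutes the field and adds \<open>q\<close> to the sum of its elements.\<close>

lemma finite_field_of_nat_card: "of_nat CARD('k) = (0 :: 'k::{field,finite})"
proof -
  have "(\<Sum>c\<in>UNIV. c + 1 :: 'k) = (\<Sum>c\<in>UNIV. c)"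
    by (rule sum.reindex_bij_witness[of _ "\<lambda>y. y - 1" "\<lambda>y. y + 1"]) auto
  then show ?thesis by (simp add: sum.distrib)
qed

text \<open>Both sides are monic of degree \<open>q\<close> and agree at all \<open>q\<close> elements of the field.\<close>

lemma finite_field_prod_linear:
  "(\<Prod>c\<in>UNIV. [:c, 1:]) = Polynomial.monom 1 CARD('k) - Polynomial.monom (1 :: 'k::{field,finite}) 1"
proof (rule poly_eqI_degree_lead_coeff[where A = UNIV and n = "CARD('k)"])
  have *: "Polynomial.degree (\<Prod>c\<in>(UNIV::'k set). [:c, 1:]) = CARD('k)"
    by (subst degree_prod_eq_sum_degree) auto
  have "Polynomial.lead_coeff (\<Prod>c\<in>(UNIV::'k set). [:c, 1:]) = 1"
    by (simp add: lead_coeff_prod)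
  then show "Polynomial.coeff (\<Prod>c\<in>UNIV. [:c, 1:]) CARD('k) =
      Polynomial.coeff (Polynomial.monom 1 CARD('k) - Polynomial.monom (1 :: 'k) 1) CARD('k)"
    using * finite_field_card_ge_2[where 'k='k] by simp
  show "Polynomial.degree (\<Prod>c\<in>(UNIV::'k set). [:c, 1:]) \<le> CARD('k)"
    using * by simp
  show "Polynomial.degree (Polynomial.monom 1 CARD('k) - Polynomial.monom (1::'k) 1) \<le> CARD('k)"
    using finite_field_card_ge_2[where 'k='k] by (intro degree_diff_le) (auto simp: degree_monom_eq)
  fix z :: 'k
  have "poly (\<Prod>c\<in>UNIV. [:c, 1:]) z = (\<Prod>c\<in>UNIV. c + z)"
    by (simp add: poly_prod)
  also have "\<dots> = 0"
    by (rule prod_zero) (auto intro!: exI[of _ "- z"])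
  finally show "poly (\<Prod>c\<in>UNIV. [:c, 1:]) z
      = poly (Polynomial.monom 1 CARD('k) - Polynomial.monom 1 1) z"
    by (simp add: poly_monom finite_field_power_card)
qed simp

text \<open>\<open>(X + 1)^q\<close> and \<open>X^q + 1\<close> are monic of degree \<open>q\<close> and take the same values on the field, so they are
  equal. This gives the additivity of the \<open>q\<close>-th power in every algebra over the field, for \<open>q\<close> a
  prime power, without reference to the characteristic.\<close>

lemma finite_field_binomial_zero:
  assumes "0 < i" "i < CARD('k)"
  shows "of_nat (CARD('k) choose i) = (0 :: 'k::{field,finite})"
proof -
  have "[:1, 1:] ^ CARD('k) = Polynomial.monom (1::'k) CARD('k) + 1"
  proof (rule poly_eqI_degree_lead_coeff[where A = UNIV and n = "CARD('k)"])
    show "Polynomial.coeff ([:1, 1:] ^ CARD('k)) CARD('k) = Polynomial.coeff (Polynomial.monom (1::'k) CARD('k) + 1) CARD('k)"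
      using finite_field_card_ge_2[where 'k='k] by (simp add: coeff_linear_power)
    show "Polynomial.degree (Polynomial.monom (1::'k) CARD('k) + 1) \<le> CARD('k)"
      by (intro degree_add_le) (auto simp: degree_monom_eq)
    show "Polynomial.degree ([:1::'k, 1:] ^ CARD('k)) \<le> CARD('k)"
      by (simp add: degree_linear_power)
    show "poly ([:1, 1:] ^ CARD('k)) z = poly (Polynomial.monom 1 CARD('k) + 1) z" for z :: 'k
      by (simp add: poly_monom finite_field_power_card)
  qed simp
  then have "Polynomial.coeff ([:1::'k, 1:] ^ CARD('k)) i = 0"
    using assms by (simp add: coeff_1)
  then show ?thesis
    using assms by (simp add: coeff_linear_poly_power)
qed

text \<open>The algebra structure is given by a map rather than by a type class, so that it can be used at once
  for a ring and for the polynomials over it.\<close>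

locale field_hom =
  fixes \<kappa> :: "'k::{field,finite} \<Rightarrow> 'a::comm_ring_1" and q :: nat
  assumes q_eq: "q = CARD('k)"
    and hom_add: "\<kappa> (a + b) = \<kappa> a + \<kappa> b"
    and hom_mult: "\<kappa> (a * b) = \<kappa> a * \<kappa> b"
    and hom_one: "\<kappa> 1 = 1"
begin

lemma q_ge_2: "q \<ge> 2"
  by (simp add: q_eq finite_field_card_ge_2)

lemma hom_zero: "\<kappa> 0 = 0"
  using hom_add[of 0 0] by simp

lemma hom_uminus: "\<kappa> (- a) = - \<kappa> a"
  using hom_add[of a "- a"] by (simp add: hom_zero eq_neg_iff_add_eq_0 add.commute)

lemma hom_power: "\<kappa> (a ^ n) = \<kappa> a ^ n"
  by (induction n) (auto simp: hom_mult hom_one)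

lemma hom_of_nat: "\<kappa> (of_nat n) = of_nat n"
  by (induction n) (auto simp: hom_add hom_one hom_zero)

lemma of_nat_card_power_eq_0: "m \<ge> 1 \<Longrightarrow> of_nat (q ^ m) = (0 :: 'a)"
  using hom_of_nat[of "CARD('k)"]
  by (simp add: q_eq finite_field_of_nat_card hom_zero zero_power)

lemma hom_power_card: "\<kappa> c ^ q = \<kappa> c"
  by (simp add: q_eq finite_field_power_card flip: hom_power)

lemma frobenius_add: "(x + y :: 'a) ^ q = x ^ q + y ^ q"
proof -
  have "of_nat (q choose i) * x ^ i * y ^ (q - i) = 0" if "i \<in> {..q} - {0, q}" for i
  proof -
    have "\<kappa> (of_nat (q choose i)) = 0"
      using that by (auto simp: q_eq finite_field_binomial_zero hom_zero)
    then show ?thesis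
      by (simp add: hom_of_nat)
  qed
  then have "(\<Sum>i\<in>{..q}. of_nat (q choose i) * x ^ i * y ^ (q - i)) =
      (\<Sum>i\<in>{0, q}. of_nat (q choose i) * x ^ i * y ^ (q - i))"
    by (intro sum.mono_neutral_right) auto
  then show ?thesis
    using q_ge_2 by (simp add: binomial_ring add.commute flip: q_eq)
qed

lemma frobenius_power_add: "(x + y :: 'a) ^ (q ^ t) = x ^ (q ^ t) + y ^ (q ^ t)"
proof (induction t)
  case (Suc t)
  then show ?case
    by (simp add: frobenius_add power_mult power_Suc2 del: power_Suc)
qed simp

lemma zero_power_q: "(0 :: 'a) ^ (q ^ t) = 0"
  using q_ge_2 by (simp add: zero_power)

lemma frobenius_power_sum: "(\<Sum>i\<in>A. f i :: 'a) ^ (q ^ t) = (\<Sum>i\<in>A. f i ^ (q ^ t))"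
  by (induction A rule: infinite_finite_induct) (auto simp: frobenius_power_add zero_power_q)

lemma frobenius_power_uminus: "(- x :: 'a) ^ (q ^ t) = - (x ^ (q ^ t))"
  using frobenius_power_add[of x "- x" t] by (simp add: zero_power_q eq_neg_iff_add_eq_0 add.commute)

lemma frobenius_power_diff: "(x - y :: 'a) ^ (q ^ t) = x ^ (q ^ t) - y ^ (q ^ t)"
  using frobenius_power_add[of x "- y" t] by (simp add: frobenius_power_uminus)

text \<open>Both sides are the homogenization of \<open>\<Prod>c\<in>A. X + c\<close>, evaluated at \<open>x\<close> and \<open>y\<close>; this transports
  identities between polynomials over the field to the algebra.\<close>

lemma prod_translates_homogenized:
  assumes "finite A"
  shows "(\<Prod>c\<in>A. x + \<kappa> c * y) =
    (\<Sum>i\<le>card A. \<kappa> (Polynomial.coeff (\<Prod>c\<in>A. [:c, 1:]) i) * x ^ i * y ^ (card A - i))"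
  using assms
proof (induction A rule: finite_induct)
  case (insert c A)
  let ?P = "\<Prod>c\<in>A. [:c, 1:]" and ?n = "card A"
  let ?e = "\<lambda>i. \<kappa> (Polynomial.coeff ?P i)"
  have deg: "Polynomial.coeff ?P (Suc ?n) = 0"
  proof (rule coeff_eq_0)
    have "Polynomial.degree ?P = ?n" by (subst degree_prod_eq_sum_degree) auto
    then show "Polynomial.degree ?P < Suc ?n" by simp
  qed
  have "(\<Sum>i\<le>Suc ?n. \<kappa> (Polynomial.coeff ([:c, 1:] * ?P) i) * x ^ i * y ^ (Suc ?n - i)) =
     (\<Sum>i\<le>Suc ?n. \<kappa> c * ?e i * x ^ i * y ^ (Suc ?n - i)) +
     (\<Sum>i\<le>Suc ?n. (case i of 0 \<Rightarrow> 0 | Suc j \<Rightarrow> ?e j) * x ^ i * y ^ (Suc ?n - i))"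
    unfolding sum.distrib[symmetric]
    by (intro sum.cong refl) (auto simp: hom_add hom_mult hom_zero coeff_pCons algebra_simps split: nat.split)
  also have "(\<Sum>i\<le>Suc ?n. \<kappa> c * ?e i * x ^ i * y ^ (Suc ?n - i)) =
      \<kappa> c * y * (\<Sum>i\<le>?n. ?e i * x ^ i * y ^ (?n - i))"
    unfolding sum.atMost_Suc deg hom_zero sum_distrib_left
    by (auto intro!: sum.cong simp: Suc_diff_le algebra_simps)
  also have "(\<Sum>i\<le>Suc ?n. (case i of 0 \<Rightarrow> 0 | Suc j \<Rightarrow> ?e j) * x ^ i * y ^ (Suc ?n - i)) =
      x * (\<Sum>i\<le>?n. ?e i * x ^ i * y ^ (?n - i))"
    by (subst sum.atMost_Suc_shift) (simp add: sum_distrib_left algebra_simps)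
  finally show ?case
    using insert by (simp add: algebra_simps)
qed (simp add: hom_one)

text \<open>The homogeneous form of \<open>\<Prod>c. (X + c) = X^q - X\<close>.\<close>

lemma prod_line:
  "(\<Prod>c\<in>UNIV. x + \<kappa> c * y) = x ^ q - y ^ (q - 1) * x"
proof -
  let ?e = "\<lambda>i. Polynomial.coeff (Polynomial.monom 1 q - Polynomial.monom (1 :: 'k) 1) i"
  have "(\<Prod>c\<in>UNIV. x + \<kappa> c * y) = (\<Sum>i\<le>q. \<kappa> (?e i) * x ^ i * y ^ (q - i))"
    by (simp add: prod_translates_homogenized finite_field_prod_linear q_eq)
  also have "\<dots> = (\<Sum>i\<in>{1, q}. \<kappa> (?e i) * x ^ i * y ^ (q - i))"
    using q_ge_2 by (intro sum.mono_neutral_right) (auto simp: hom_zero)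
  also have "\<dots> = x ^ q - y ^ (q - 1) * x"
    using q_ge_2 by (simp add: hom_one hom_uminus algebra_simps)
  finally show ?thesis .
qed

end

section \<open>Monic polynomials with given roots\<close>

text \<open>The roots are the negatives of the elements of \<open>A\<close>; for a space \<open>A\<close> the sign is immaterial.\<close>

definition root_poly :: "'a::comm_ring_1 set \<Rightarrow> 'a poly" where
  "root_poly A = (\<Prod>a\<in>A. [:a, 1:])"

lemma coeff_linear_mult:
  fixes a :: "'a::comm_ring_1"
  shows "Polynomial.coeff ([:a, 1:] * P) n =
    a * Polynomial.coeff P n + (case n of 0 \<Rightarrow> 0 | Suc k \<Rightarrow> Polynomial.coeff P k)"
  by (auto simp: coeff_pCons split: nat.split)

lemma root_poly_insert: "finite A \<Longrightarrow> a \<notin> A \<Longrightarrow> root_poly (insert a A) = [:a, 1:] * root_poly A"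
  by (simp add: root_poly_def del: mult_pCons_left)

lemma coeff_root_poly_gt: "finite A \<Longrightarrow> n > card A \<Longrightarrow> Polynomial.coeff (root_poly A) n = 0"
proof (induction A arbitrary: n rule: finite_induct)
  case (insert a A)
  then show ?case
    by (auto simp: root_poly_insert coeff_linear_mult simp del: mult_pCons_left split: nat.split)
qed (simp add: root_poly_def coeff_1)

lemma coeff_root_poly_card: "finite A \<Longrightarrow> Polynomial.coeff (root_poly A) (card A) = 1"
  by (induction A rule: finite_induct)
    (auto simp: root_poly_insert coeff_linear_mult coeff_root_poly_gt simp del: mult_pCons_left, simp add: root_poly_def)

lemma degree_root_poly: "finite A \<Longrightarrow> Polynomial.degree (root_poly A) = card A"
  by (metis coeff_root_poly_card coeff_root_poly_gt degree_le le_degree order_antisym zero_neq_one)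

lemma poly_root_poly: "poly (root_poly A) x = (\<Prod>a\<in>A. x + a)"
  by (simp add: root_poly_def poly_prod add.commute)

lemma root_poly_remove: "finite A \<Longrightarrow> a \<in> A \<Longrightarrow> root_poly A = [:a, 1:] * root_poly (A - {a})"
  by (metis insert_Diff root_poly_insert finite_Diff Diff_iff singletonI)

text \<open>The product rule for the derivative, coefficient by coefficient.\<close>

lemma coeff_root_poly_derivative:
  "finite A \<Longrightarrow> of_nat (Suc n) * Polynomial.coeff (root_poly A) (Suc n) =
    (\<Sum>l\<in>A. Polynomial.coeff (root_poly (A - {l})) n)"
proof (induction A arbitrary: n rule: finite_induct)
  case (insert b A)
  let ?c = "Polynomial.coeff (root_poly A)"
  have rem: "root_poly (insert b A - {l}) = [:b, 1:] * root_poly (A - {l})" if "l \<in> A" for l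
  proof -
    have "insert b A - {l} = insert b (A - {l})"
      using that insert.hyps by auto
    then show ?thesis
      using insert.hyps by (simp add: root_poly_insert del: mult_pCons_left)
  qed
  have "(\<Sum>l\<in>insert b A. Polynomial.coeff (root_poly (insert b A - {l})) n) =
      ?c n + (\<Sum>l\<in>A. Polynomial.coeff ([:b, 1:] * root_poly (A - {l})) n)"
    using insert.hyps by (simp add: rem del: mult_pCons_left)
  also have "(\<Sum>l\<in>A. Polynomial.coeff ([:b, 1:] * root_poly (A - {l})) n) =
      b * (of_nat (Suc n) * ?c (Suc n)) + of_nat n * ?c n"
    unfolding insert.IH
    by (cases n) (simp_all add: coeff_linear_mult sum.distrib insert.IH flip: sum_distrib_left del: mult_pCons_left of_nat_Suc)
  finally show ?case
    using insert.hyps by (simp add: root_poly_insert coeff_linear_mult algebra_simps del: mult_pCons_left)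
qed (simp add: root_poly_def coeff_1)

text \<open>Division of \<open>root_poly A\<close> by the factor \<open>X + l\<close>, by Horner's scheme from the leading coefficient down.\<close>

lemma coeff_root_poly_quotient:
  assumes "finite A" "l \<in> A" "e < card A"
  shows "Polynomial.coeff (root_poly (A - {l})) (card A - 1 - e) =
    (\<Sum>k\<le>e. (- l) ^ k * Polynomial.coeff (root_poly A) (card A - e + k))"
  using \<open>e < card A\<close>
proof (induction e)
  case 0
  then show ?case
    using assms coeff_root_poly_card[of A] coeff_root_poly_card[of "A - {l}"] by simp
next
  case (Suc e)
  let ?P = "root_poly (A - {l})" and ?n = "card A - 1 - Suc e"
  have n: "Suc ?n = card A - 1 - e" "card A - Suc e = Suc ?n"
    using Suc.prems by auto
  have "Polynomial.coeff (root_poly A) (Suc ?n) = l * Polynomial.coeff ?P (Suc ?n) + Polynomial.coeff ?P ?n"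
    using assms by (simp add: root_poly_remove coeff_linear_mult del: mult_pCons_left)
  then have "Polynomial.coeff ?P ?n =
      Polynomial.coeff (root_poly A) (Suc ?n) + (- l) * Polynomial.coeff ?P (card A - 1 - e)"
    by (simp add: n)
  also have "(- l) * Polynomial.coeff ?P (card A - 1 - e) =
      (\<Sum>k\<le>e. (- l) ^ Suc k * Polynomial.coeff (root_poly A) (card A - e + k))"
    using Suc by (simp add: sum_distrib_left mult.assoc del: mult_minus_left)
  also have "\<dots> = (\<Sum>k\<le>e. (- l) ^ Suc k * Polynomial.coeff (root_poly A) (card A - Suc e + Suc k))"
    using Suc.prems by (intro sum.cong refl) (simp add: Suc_diff_Suc)
  finally show ?case
    by (subst sum.atMost_Suc_shift) (simp add: n)
qed

text \<open>The coefficients of the derivative, computed once directly and once by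
  \<open>coeff_root_poly_derivative\<close> and \<open>coeff_root_poly_quotient\<close>.\<close>

lemma newton_identity:
  assumes "finite A" "e < card A"
  shows "of_nat (card A - e) * Polynomial.coeff (root_poly A) (card A - e) =
    (\<Sum>k\<le>e. (- 1) ^ k * (\<Sum>l\<in>A. l ^ k) * Polynomial.coeff (root_poly A) (card A - e + k))"
proof -
  have *: "Suc (card A - 1 - e) = card A - e"
    using assms by simp
  have "of_nat (card A - e) * Polynomial.coeff (root_poly A) (card A - e) =
      (\<Sum>l\<in>A. Polynomial.coeff (root_poly (A - {l})) (card A - 1 - e))"
    using coeff_root_poly_derivative[OF assms(1), of "card A - 1 - e"] unfolding * .
  also have "\<dots> = (\<Sum>l\<in>A. \<Sum>k\<le>e. (- l) ^ k * Polynomial.coeff (root_poly A) (card A - e + k))"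
    using assms by (intro sum.cong refl coeff_root_poly_quotient)
  also have "\<dots> = (\<Sum>l\<in>A. \<Sum>k\<le>e. (- 1) ^ k * l ^ k * Polynomial.coeff (root_poly A) (card A - e + k))"
    by (intro sum.cong refl) (subst power_minus, rule refl)
  also have "\<dots> = (\<Sum>k\<le>e. (- 1) ^ k * (\<Sum>l\<in>A. l ^ k) * Polynomial.coeff (root_poly A) (card A - e + k))"
    by (subst sum.swap) (simp add: sum_distrib_left sum_distrib_right mult.assoc)
  finally show ?thesis .
qed

lemma (in field_hom) field_hom_poly: "field_hom (\<lambda>c. [:\<kappa> c:]) q"
  by standard (auto simp: q_eq hom_add hom_mult hom_one pCons_one)

text \<open>The absence of zero divisors is an assumption, and not the class of integral domains, because the
  variables of the polynomial ring to which this applies are indexed by a type without an order.\<close>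

locale field_domain = field_hom \<kappa> q
  for \<kappa> :: "'k::{field,finite} \<Rightarrow> 'a::comm_ring_1" and q :: nat +
  assumes no_zero_div: "x * y = (0 :: 'a) \<Longrightarrow> x = 0 \<or> y = 0"
begin

lemma power_nonzero: "(x :: 'a) \<noteq> 0 \<Longrightarrow> x ^ n \<noteq> 0"
  by (induction n) (auto dest: no_zero_div)

lemma prod_nonzero: "finite A \<Longrightarrow> (\<Prod>i\<in>A. f i :: 'a) = 0 \<Longrightarrow> \<exists>i\<in>A. f i = 0"
  by (induction A rule: finite_induct) (auto dest: no_zero_div)

lemma cancel_left: "(x :: 'a) * y = x * z \<Longrightarrow> x \<noteq> 0 \<Longrightarrow> y = z"
  using no_zero_div[of x "y - z"] by (simp add: algebra_simps)

lemma hom_nonzero: "c \<noteq> 0 \<Longrightarrow> \<kappa> c \<noteq> 0"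
  by (metis hom_mult hom_one mult_zero_left right_inverse zero_neq_one)

lemma hom_mult_inject: "l \<noteq> 0 \<Longrightarrow> \<kappa> a * l = \<kappa> b * l \<Longrightarrow> a = b"
proof (rule ccontr)
  assume "l \<noteq> 0" "\<kappa> a * l = \<kappa> b * l" "a \<noteq> b"
  moreover have "\<kappa> (a - b) = \<kappa> a - \<kappa> b"
    using hom_add[of "a - b" b] by simp
  ultimately have "\<kappa> (a - b) * l = 0"
    by (simp add: left_diff_distrib)
  with \<open>l \<noteq> 0\<close> \<open>a \<noteq> b\<close> show False
    using no_zero_div hom_nonzero[of "a - b"] by auto
qed

definition kspace :: "'a set \<Rightarrow> bool" where
  "kspace L \<longleftrightarrow> finite L \<and> 0 \<in> L \<and> (\<forall>x\<in>L. \<forall>y\<in>L. x + y \<in> L) \<and> (\<forall>c. \<forall>x\<in>L. \<kappa> c * x \<in> L)"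

lemma kspaceD:
  assumes "kspace L"
  shows "finite L" "0 \<in> L" "x \<in> L \<Longrightarrow> y \<in> L \<Longrightarrow> x + y \<in> L" "x \<in> L \<Longrightarrow> \<kappa> c * x \<in> L"
  using assms by (auto simp: kspace_def)

lemma kspace_uminus: "kspace L \<Longrightarrow> x \<in> L \<Longrightarrow> - x \<in> L"
  using kspaceD(4)[of L x "- 1"] by (simp add: hom_uminus hom_one)

lemma kspace_diff: "kspace L \<Longrightarrow> x \<in> L \<Longrightarrow> y \<in> L \<Longrightarrow> x - y \<in> L"
  using kspaceD(3)[of L x "- y"] kspace_uminus by simp

text \<open>The \<open>k\<close>-linear map with kernel the line spanned by \<open>l\<close>; its image on \<open>L\<close> realizes the
  quotient of \<open>L\<close> by that line inside the same ring.\<close>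

definition quot :: "'a \<Rightarrow> 'a \<Rightarrow> 'a" where
  "quot l x = (\<Prod>c\<in>UNIV. x + \<kappa> c * l)"

lemma quot_eq: "quot l x = x ^ q - l ^ (q - 1) * x"
  by (simp add: quot_def prod_line)

lemma quot_add: "quot l (x + y) = quot l x + quot l y"
  by (simp add: quot_eq frobenius_add algebra_simps)

lemma quot_scale: "quot l (\<kappa> c * x) = \<kappa> c * quot l x"
  by (simp add: quot_eq power_mult_distrib hom_power_card algebra_simps)

lemma quot_zero: "quot l 0 = 0"
  using quot_scale[of l 0 0] by (simp add: hom_zero)

lemma quot_diff: "quot l (x - y) = quot l x - quot l y"
  using quot_add[of l "x - y" y] by simp

lemma quot_self: "quot l (\<kappa> c * l) = 0"
  unfolding quot_def
  by (rule prod_zero) (auto intro!: exI[of _ "- c"] simp: hom_uminus)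

lemma quot_eq_0: "quot l x = 0 \<Longrightarrow> \<exists>c. x = \<kappa> c * l"
proof -
  assume "quot l x = 0"
  then obtain c where "x + \<kappa> c * l = 0"
    using prod_nonzero[of UNIV "\<lambda>c. x + \<kappa> c * l"] by (auto simp: quot_def)
  then have "x = \<kappa> (- c) * l"
    by (simp add: hom_uminus add_eq_0_iff)
  then show ?thesis ..
qed

lemma kspace_quot: "kspace L \<Longrightarrow> kspace (quot l ` L)"
  unfolding kspace_def by (auto simp flip: quot_add quot_scale) (metis quot_zero image_eqI)

lemma quot_fibre:
  assumes "kspace L" "l \<in> L" "x0 \<in> L"
  shows "{x \<in> L. quot l x = quot l x0} = (\<lambda>c. x0 + \<kappa> c * l) ` UNIV"
proof (intro equalityI subsetI)
  fix x assume "x \<in> {x \<in> L. quot l x = quot l x0}"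
  then have "quot l (x - x0) = 0" by (simp add: quot_diff)
  then obtain c where "x - x0 = \<kappa> c * l" using quot_eq_0 by blast
  then have "x = x0 + \<kappa> c * l" by (simp add: algebra_simps)
  then show "x \<in> (\<lambda>c. x0 + \<kappa> c * l) ` UNIV" by blast
qed (use assms in \<open>auto simp: kspaceD quot_add quot_self\<close>)

lemma inj_line: "l \<noteq> 0 \<Longrightarrow> inj (\<lambda>c. x0 + \<kappa> c * l)"
  by (auto intro!: injI dest: hom_mult_inject)

lemma card_quot:
  assumes "kspace L" "l \<in> L" "l \<noteq> 0"
  shows "card L = q * card (quot l ` L)"
proof -
  have "card L = (\<Sum>x\<in>L. 1)" by simp
  also have "\<dots> = (\<Sum>y\<in>quot l ` L. \<Sum>x\<in>{x \<in> L. quot l x = y}. 1)"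
    by (rule sum.image_gen) (use assms kspaceD in auto)
  also have "\<dots> = (\<Sum>y\<in>quot l ` L. q)"
  proof (intro sum.cong refl)
    fix y assume "y \<in> quot l ` L"
    then obtain x0 where "x0 \<in> L" "y = quot l x0" by auto
    then show "(\<Sum>x\<in>{x \<in> L. quot l x = y}. 1) = q"
      using assms by (simp add: quot_fibre card_image inj_line q_eq)
  qed
  finally show ?thesis by simp
qed

definition quot_poly :: "'a \<Rightarrow> 'a poly" where
  "quot_poly l = Polynomial.monom 1 q - Polynomial.monom (l ^ (q - 1)) 1"

text \<open>The factors \<open>X + x\<close> of \<open>root_poly L\<close> whose \<open>x\<close> lie in one fibre of \<open>quot l\<close>, that is on one translate
  of the line spanned by \<open>l\<close>, multiply to \<open>quot_poly l + quot l x\<close>.\<close>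

lemma root_poly_quot:
  assumes "kspace L" "l \<in> L" "l \<noteq> 0"
  shows "root_poly L = pcompose (root_poly (quot l ` L)) (quot_poly l)"
proof -
  interpret P: field_hom "\<lambda>c. [:\<kappa> c:]" q
    by (rule field_hom_poly)
  have "root_poly L = (\<Prod>y\<in>quot l ` L. \<Prod>x\<in>{x \<in> L. quot l x = y}. [:x, 1:])"
    unfolding root_poly_def by (rule prod.image_gen) (use assms kspaceD in auto)
  also have "\<dots> = (\<Prod>y\<in>quot l ` L. pcompose [:y, 1:] (quot_poly l))"
  proof (intro prod.cong refl)
    fix y assume "y \<in> quot l ` L"
    then obtain x0 where x0: "x0 \<in> L" "y = quot l x0" by auto
    have "(\<Prod>x\<in>{x \<in> L. quot l x = y}. [:x, 1:]) = (\<Prod>c\<in>UNIV. [:x0, 1:] + [:\<kappa> c:] * [:l:])"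
      unfolding x0(2) quot_fibre[OF assms(1,2) x0(1)]
      by (subst prod.reindex[OF inj_line[OF assms(3)]]) (simp add: mult.commute)
    also have "\<dots> = [:x0, 1:] ^ q - [:l:] ^ (q - 1) * [:x0, 1:]"
      by (rule P.prod_line)
    also have "\<dots> = [:y:] + quot_poly l"
    proof -
      have X: "[:x0, 1:] = [:x0:] + Polynomial.monom 1 1"
        by (simp add: monom_Suc monom_0)
      have "[:l:] ^ (q - 1) * ([:x0:] + Polynomial.monom 1 1) =
          [:l ^ (q - 1) * x0:] + Polynomial.monom (l ^ (q - 1)) 1"
        by (simp add: poly_const_pow smult_add_right smult_monom)
      moreover have "([:x0:] + Polynomial.monom 1 1) ^ q = [:x0 ^ q:] + Polynomial.monom 1 q"
        by (simp add: P.frobenius_add poly_const_pow monom_power)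
      moreover have "[:y:] = [:x0 ^ q:] - [:l ^ (q - 1) * x0:]"
        by (simp add: x0 quot_eq)
      ultimately show ?thesis
        unfolding X by (simp only: quot_poly_def) (simp add: algebra_simps)
    qed
    also have "\<dots> = pcompose [:y, 1:] (quot_poly l)"
      by (simp add: pcompose_pCons)
    finally show "(\<Prod>x\<in>{x \<in> L. quot l x = y}. [:x, 1:]) = pcompose [:y, 1:] (quot_poly l)" .
  qed
  finally show ?thesis
    by (simp add: root_poly_def pcompose_prod)
qed

end

section \<open>Dickson coefficients of a finite space\<close>

lemma pcompose_monom: "pcompose (Polynomial.monom (c::'a::comm_ring_1) n) p = Polynomial.smult c (p ^ n)"
  by (induction n) (auto simp: monom_0 monom_Suc pcompose_pCons)

context field_domain
begin

lemma q_power_inject: "q ^ i = q ^ j \<longleftrightarrow> i = j"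
  using q_ge_2 by (auto intro: power_inject_exp[THEN iffD1])

definition linearized :: "'a poly \<Rightarrow> bool" where
  "linearized P \<longleftrightarrow> (\<forall>n. Polynomial.coeff P n \<noteq> 0 \<longrightarrow> (\<exists>i. n = q ^ i))"

text \<open>For the space of all linear forms these are the Dickson polynomials up to sign; there are no other
  coefficients, by \<open>kspace_structure\<close>.\<close>

definition dickson_coeff :: "'a set \<Rightarrow> nat \<Rightarrow> 'a" where
  "dickson_coeff L i = Polynomial.coeff (root_poly L) (q ^ i)"

lemma dickson_coeff_gt: "kspace L \<Longrightarrow> card L = q ^ m \<Longrightarrow> j > m \<Longrightarrow> dickson_coeff L j = 0"
  unfolding dickson_coeff_def using q_ge_2
  by (intro coeff_root_poly_gt) (auto simp: kspaceD)

lemma linearized_expand: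
  assumes "linearized (root_poly L)" "kspace L" "card L = q ^ m"
  shows "root_poly L = (\<Sum>j\<le>m. Polynomial.monom (dickson_coeff L j) (q ^ j))"
proof (rule poly_eqI)
  fix n
  show "Polynomial.coeff (root_poly L) n =
      Polynomial.coeff (\<Sum>j\<le>m. Polynomial.monom (dickson_coeff L j) (q ^ j)) n"
  proof (cases "\<exists>i. n = q ^ i")
    case True
    then obtain i where i: "n = q ^ i" by auto
    have "dickson_coeff L i = 0" if "\<not> i \<le> m"
      using dickson_coeff_gt[OF assms(2,3)] that by simp
    then show ?thesis
      by (auto simp: Polynomial.coeff_sum i q_power_inject dickson_coeff_def[symmetric] sum.delta)
  next
    case False
    then have "Polynomial.coeff (root_poly L) n = 0"
      using assms(1) by (auto simp: linearized_def)
    moreover have "q ^ j \<noteq> n" for j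
      using False by auto
    ultimately show ?thesis
      by (simp add: Polynomial.coeff_sum)
  qed
qed

lemma quot_poly_power: "quot_poly l ^ (q ^ j) =
    Polynomial.monom 1 (q ^ Suc j) - Polynomial.monom (l ^ ((q - 1) * q ^ j)) (q ^ j)"
proof -
  interpret P: field_hom "\<lambda>c. [:\<kappa> c:]" q
    by (rule field_hom_poly)
  show ?thesis
    by (simp add: quot_poly_def P.frobenius_power_diff monom_power power_mult)
qed

lemma root_poly_quot_expand:
  assumes "kspace L" "l \<in> L" "l \<noteq> 0" "card (quot l ` L) = q ^ m" "linearized (root_poly (quot l ` L))"
  shows "root_poly L = (\<Sum>j\<le>m. Polynomial.monom (dickson_coeff (quot l ` L) j) (q ^ Suc j) -
    Polynomial.monom (dickson_coeff (quot l ` L) j * l ^ ((q - 1) * q ^ j)) (q ^ j))"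
proof -
  have "root_poly L = pcompose (\<Sum>j\<le>m. Polynomial.monom (dickson_coeff (quot l ` L) j) (q ^ j)) (quot_poly l)"
    using assms by (simp add: root_poly_quot kspace_quot flip: linearized_expand)
  then show ?thesis
    by (simp add: pcompose_sum pcompose_monom quot_poly_power smult_diff_right smult_monom)
qed

text \<open>Both properties pass from the quotient by a line to the space itself: the cardinality is multiplied by
  \<open>q\<close>, and the polynomial is composed with a linearized one.\<close>

lemma kspace_structure: "kspace L \<Longrightarrow> (\<exists>m. card L = q ^ m) \<and> linearized (root_poly L)"
proof (induction "card L" arbitrary: L rule: less_induct)
  case less
  show ?case
  proof (cases "L = {0}")
    case True
    have "linearized [:0, 1:]"
      by (auto simp: linearized_def coeff_pCons split: nat.splits intro!: exI[of _ 0])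
    then show ?thesis
      using True by (auto simp: root_poly_def intro!: exI[of _ 0])
  next
    case False
    then obtain l where l: "l \<in> L" "l \<noteq> 0"
      using less.prems kspaceD by blast
    let ?M = "quot l ` L"
    have c: "card L = q * card ?M"
      using less.prems l by (rule card_quot)
    have "card L > 0"
      using less.prems l by (auto simp: card_gt_0_iff kspaceD)
    then have "card ?M < card L"
      using c q_ge_2 by auto
    then obtain m where m: "card ?M = q ^ m" and lin: "linearized (root_poly ?M)"
      using less.hyps[of ?M] less.prems kspace_quot by blast
    have "\<exists>i. n = q ^ i" if "Polynomial.coeff (root_poly L) n \<noteq> 0" for n
    proof (rule ccontr)
      assume *: "\<nexists>i. n = q ^ i"
      then have "q ^ j \<noteq> n" for j
        by auto
      then have "Polynomial.coeff (root_poly L) n = 0"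
        unfolding root_poly_quot_expand[OF less.prems l m lin]
        by (simp add: Polynomial.coeff_sum del: power_Suc)
      with that show False by simp
    qed
    then have "linearized (root_poly L)"
      by (auto simp: linearized_def)
    moreover have "card L = q ^ Suc m"
      using c m by simp
    ultimately show ?thesis by blast
  qed
qed

lemma dickson_coeff_quot:
  assumes "kspace L" "l \<in> L" "l \<noteq> 0"
  shows "dickson_coeff L 0 = - dickson_coeff (quot l ` L) 0 * l ^ (q - 1)"
    and "dickson_coeff L (Suc i) =
      dickson_coeff (quot l ` L) i - dickson_coeff (quot l ` L) (Suc i) * l ^ ((q - 1) * q ^ Suc i)"
proof -
  let ?A = "dickson_coeff (quot l ` L)"
  have k: "kspace (quot l ` L)"
    using assms kspace_quot by blast
  then obtain m where m: "card (quot l ` L) = q ^ m" and lin: "linearized (root_poly (quot l ` L))"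
    using kspace_structure by blast
  have A0: "?A j = 0" if "\<not> j \<le> m" for j
    using dickson_coeff_gt[OF k m] that by simp
  have *: "dickson_coeff L i = (\<Sum>j\<le>m. if Suc j = i then ?A j else 0) -
      (\<Sum>j\<le>m. if j = i then ?A j * l ^ ((q - 1) * q ^ j) else 0)" for i
    unfolding dickson_coeff_def[of L] root_poly_quot_expand[OF assms m lin]
    by (simp add: Polynomial.coeff_sum sum_subtractf q_power_inject del: power_Suc cong: if_cong)
  show "dickson_coeff L 0 = - ?A 0 * l ^ (q - 1)"
    unfolding * by simp
  show "dickson_coeff L (Suc i) = ?A i - ?A (Suc i) * l ^ ((q - 1) * q ^ Suc i)"
    unfolding * using A0[of i] A0[of "Suc i"] by (auto simp: sum.delta simp del: power_Suc)
qed

lemma linearized_root: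
  assumes "kspace L" "card L = q ^ m" "l \<in> L"
  shows "(\<Sum>j\<le>m. dickson_coeff L j * l ^ (q ^ j)) = 0"
proof -
  have "poly (root_poly L) l = 0"
    unfolding poly_root_poly
    by (rule prod_zero) (use assms in \<open>auto simp: kspaceD intro!: bexI[of _ "- l"] kspace_uminus\<close>)
  moreover have "root_poly L = (\<Sum>j\<le>m. Polynomial.monom (dickson_coeff L j) (q ^ j))"
    using kspace_structure[OF assms(1)] assms by (blast intro: linearized_expand)
  ultimately show ?thesis
    by (simp add: poly_sum poly_monom)
qed

text \<open>Multiplied by suitable powers of \<open>l\<close>, the recursion of \<open>dickson_coeff_quot\<close> telescopes.\<close>

lemma quot_coeff_telescope:
  assumes "kspace L" "l \<in> L" "l \<noteq> 0"
  shows "dickson_coeff (quot l ` L) i * l ^ (q ^ Suc i) = - (\<Sum>j\<le>i. dickson_coeff L j * l ^ (q ^ j))"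
proof -
  have e: "l ^ ((q - 1) * n) * l ^ n = l ^ (q * n)" for n
    using q_ge_2 by (cases q) (auto simp: algebra_simps simp flip: power_add)
  show ?thesis
  proof (induction i)
    case 0
    show ?case
      using dickson_coeff_quot(1)[OF assms] e[of 1] by (simp add: mult.assoc)
  next
    case (Suc i)
    let ?A = "dickson_coeff (quot l ` L)"
    have "?A (Suc i) * l ^ (q ^ Suc (Suc i)) = (?A (Suc i) * l ^ ((q - 1) * q ^ Suc i)) * l ^ (q ^ Suc i)"
      unfolding mult.assoc e by simp
    also have "?A (Suc i) * l ^ ((q - 1) * q ^ Suc i) = ?A i - dickson_coeff L (Suc i)"
      using dickson_coeff_quot(2)[OF assms, of i] by (simp del: power_Suc)
    finally show ?case
      using Suc.IH by (simp add: left_diff_distrib del: power_Suc)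
  qed
qed

text \<open>In Newton's identity of degree \<open>e\<close> the power sums of lower degree vanish by induction. The remaining
  coefficient of \<open>root_poly L\<close> is zero unless its index \<open>q^m - e\<close> is a power \<open>q^i\<close>, and then \<open>i > 0\<close> and
  the integer factor \<open>q^i\<close> is zero in the ring.\<close>

lemma power_sum_eq_0:
  assumes "kspace L" "card L = q ^ m"
  shows "e < q ^ m - 1 \<Longrightarrow> (\<Sum>l\<in>L. l ^ e) = 0"
proof (induction e rule: less_induct)
  case (less e)
  let ?N = "q ^ m" and ?f = "Polynomial.coeff (root_poly L)"
  have fin: "finite L" using assms by (simp add: kspaceD)
  have "m \<ge> 1"
    using less.prems by (cases m) auto
  have "of_nat (?N - e) * ?f (?N - e) = 0"
  proof (cases "?f (?N - e) = 0")
    case False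
    then obtain i where i: "?N - e = q ^ i"
      using kspace_structure[OF assms(1)] by (auto simp: linearized_def)
    moreover have "i \<ge> 1"
      using less.prems i by (cases i) auto
    ultimately show ?thesis
      using of_nat_card_power_eq_0[of i] by simp
  qed simp
  then have "0 = (\<Sum>k\<le>e. (- 1) ^ k * (\<Sum>l\<in>L. l ^ k) * ?f (?N - e + k))"
    using newton_identity[OF fin, of e] less.prems by (simp add: assms(2))
  also have "\<dots> = (\<Sum>k\<in>{e}. (- 1) ^ k * (\<Sum>l\<in>L. l ^ k) * ?f (?N - e + k))"
    using less by (intro sum.mono_neutral_right) auto
  also have "\<dots> = (- 1) ^ e * (\<Sum>l\<in>L. l ^ e)"
    using less.prems coeff_root_poly_card[OF fin] by (simp add: assms(2))
  finally have "(- 1) ^ e * ((- 1) ^ e * (\<Sum>l\<in>L. l ^ e)) = 0"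
    by simp
  then show ?case
    by (simp flip: mult.assoc power_add add: mult_2[symmetric])
qed

lemma power_sum_top:
  assumes "kspace L" "card L = q ^ m"
  shows "(\<Sum>l\<in>L. l ^ (q ^ m - 1)) = dickson_coeff L 0"
proof -
  let ?N = "q ^ m" and ?f = "Polynomial.coeff (root_poly L)" and ?e = "q ^ m - 1"
  have fin: "finite L" using assms by (simp add: kspaceD)
  have N: "?N \<ge> 1" using q_ge_2 by simp
  then have "?f 1 = (\<Sum>k\<le>?e. (- 1) ^ k * (\<Sum>l\<in>L. l ^ k) * ?f (?N - ?e + k))"
    using newton_identity[OF fin, of ?e] by (simp add: assms(2))
  also have "\<dots> = (\<Sum>k\<in>{?e}. (- 1) ^ k * (\<Sum>l\<in>L. l ^ k) * ?f (?N - ?e + k))"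
    using power_sum_eq_0[OF assms] by (intro sum.mono_neutral_right) auto
  also have "\<dots> = (- 1) ^ ?e * (\<Sum>l\<in>L. l ^ ?e)"
  proof -
    have "?N - ?e + ?e = card L" using N by (simp add: assms(2))
    then show ?thesis
      using coeff_root_poly_card[OF fin] by simp
  qed
  also have "(- 1 :: 'a) ^ ?e = 1"
  proof -
    obtain e where e: "?N = Suc e"
      using N by (cases ?N) auto
    have "(- 1 :: 'a) ^ Suc e = - 1"
      using frobenius_power_uminus[of 1 m] by (simp only: e power_one)
    then show ?thesis by (simp add: e)
  qed
  finally show ?thesis
    by (simp add: dickson_coeff_def)
qed

text \<open>Since the elements of \<open>L\<close> are roots of its linearized polynomial, the telescoped sum for the
  coefficient of the quotient by \<open>l\<close> equals the negative of its complementary part, in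
  which only powers of \<open>l\<close> with exponent at least \<open>q^(i+1)\<close> occur. After division by \<open>l^(q^(i+1))\<close> and
  summation over \<open>l\<close>, all power sums are zero but the one of exponent zero, which is \<open>q^m - 1 = -1\<close>.\<close>

lemma dickson_coeff_Suc_sum:
  assumes "kspace L" "card L = q ^ m" "i < m"
  shows "(\<Sum>l\<in>L - {0}. dickson_coeff (quot l ` L) i) = - dickson_coeff L (Suc i)"
proof -
  let ?a = "dickson_coeff L"
  have fin: "finite L" "0 \<in> L" using assms by (auto simp: kspaceD)
  have qmono: "q ^ a \<le> q ^ b" if "a \<le> b" for a b
    using that q_ge_2 by (intro power_increasing) auto
  have A: "dickson_coeff (quot l ` L) i = (\<Sum>j\<in>{Suc i..m}. ?a j * l ^ (q ^ j - q ^ Suc i))"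
    if l: "l \<in> L - {0}" for l
  proof -
    have "l ^ (q ^ Suc i) * (\<Sum>j\<in>{Suc i..m}. ?a j * l ^ (q ^ j - q ^ Suc i)) =
        (\<Sum>j\<in>{Suc i..m}. ?a j * l ^ (q ^ j))"
      unfolding sum_distrib_left
    proof (intro sum.cong refl)
      fix j assume "j \<in> {Suc i..m}"
      then have "q ^ Suc i + (q ^ j - q ^ Suc i) = q ^ j"
        using qmono[of "Suc i" j] by simp
      then show "l ^ q ^ Suc i * (?a j * l ^ (q ^ j - q ^ Suc i)) = ?a j * l ^ q ^ j"
        by (simp only: mult.left_commute[of "l ^ q ^ Suc i"] power_add[symmetric])
    qed
    moreover have "(\<Sum>j\<in>{Suc i..m}. ?a j * l ^ (q ^ j)) = - (\<Sum>j\<le>i. ?a j * l ^ (q ^ j))"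
    proof -
      have "{..m} = {..i} \<union> {Suc i..m}" using assms(3) by auto
      then have "(\<Sum>j\<le>m. ?a j * l ^ (q ^ j)) = (\<Sum>j\<le>i. ?a j * l ^ (q ^ j)) + (\<Sum>j\<in>{Suc i..m}. ?a j * l ^ (q ^ j))"
        by (simp only:) (subst sum.union_disjoint, auto)
      then show ?thesis
        using linearized_root[OF assms(1,2)] l by (simp add: eq_neg_iff_add_eq_0 add.commute)
    qed
    ultimately have "l ^ (q ^ Suc i) * dickson_coeff (quot l ` L) i =
        l ^ (q ^ Suc i) * (\<Sum>j\<in>{Suc i..m}. ?a j * l ^ (q ^ j - q ^ Suc i))"
      using quot_coeff_telescope[OF assms(1), of l i] l
      by (simp add: mult.commute del: power_Suc)
    then show ?thesis
      by (rule cancel_left) (use l power_nonzero in auto)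
  qed
  have S: "(\<Sum>l\<in>L - {0}. l ^ (q ^ j - q ^ Suc i)) = (if j = Suc i then - 1 else 0)"
    if "j \<in> {Suc i..m}" for j
  proof (cases "j = Suc i")
    case True
    have "of_nat (card L) = (0 :: 'a)"
      using of_nat_card_power_eq_0[of m] assms by simp
    moreover obtain c where "card L = Suc c"
      using fin by (cases "card L") auto
    ultimately show ?thesis
      using True fin by (simp add: eq_neg_iff_add_eq_0 add.commute)
  next
    case False
    then have "q ^ Suc i < q ^ j" "q ^ j \<le> q ^ m" "q ^ Suc i > 1"
      using that q_ge_2 qmono[of 1 "Suc i"] by (auto intro: qmono intro!: power_strict_increasing simp del: power_Suc)
    then have "q ^ j - q ^ Suc i < q ^ m - 1" "q ^ j - q ^ Suc i > 0"
      by linarith+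
    then show ?thesis
      using False fin power_sum_eq_0[OF assms(1,2)] by (simp add: sum_diff1 zero_power del: power_Suc)
  qed
  have "(\<Sum>l\<in>L - {0}. dickson_coeff (quot l ` L) i) =
      (\<Sum>l\<in>L - {0}. \<Sum>j\<in>{Suc i..m}. ?a j * l ^ (q ^ j - q ^ Suc i))"
    by (intro sum.cong refl A)
  also have "\<dots> = (\<Sum>j\<in>{Suc i..m}. ?a j * (\<Sum>l\<in>L - {0}. l ^ (q ^ j - q ^ Suc i)))"
    by (subst sum.swap) (simp add: sum_distrib_left)
  also have "\<dots> = (\<Sum>j\<in>{Suc i..m}. if j = Suc i then - ?a j else 0)"
    by (intro sum.cong refl) (simp add: S del: power_Suc)
  also have "\<dots> = - ?a (Suc i)"
    using assms(3) by (simp add: sum.delta)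
  finally show ?thesis .
qed

end

section \<open>A power of a Dickson coefficient as a sum over flags and bases\<close>

context field_domain
begin

primrec span_list :: "'a list \<Rightarrow> 'a set" where
  "span_list [] = {0}"
| "span_list (b # bs) = (\<lambda>(c, s). \<kappa> c * b + s) ` (UNIV \<times> span_list bs)"

text \<open>The weight is zero on dependent lists, because then the product for some \<open>b\<close> contains the factor \<open>0\<close>.
  The exponent of \<open>b\<close> gives every step the degree \<open>N - 1\<close> in \<open>b\<close>. For \<open>N\<close> the cardinality of
  the space this is the first degree in which the power sum does not vanish, so that the sum over all
  \<open>b\<close> sees only the leading term of the product.\<close>

primrec weight :: "nat \<Rightarrow> 'a list \<Rightarrow> 'a" where
  "weight N [] = 1"
| "weight N (b # bs) =
    weight N bs * (b ^ (N - 1 - card (span_list bs)) * (\<Prod>s\<in>span_list bs. b + s))"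

lemma finite_span_list: "finite (span_list bs)"
  by (induction bs) auto

lemma card_span_list_le: "card (span_list bs) \<le> q ^ length bs"
proof (induction bs)
  case (Cons b bs)
  have "card (span_list (b # bs)) \<le> card ((UNIV :: 'k set) \<times> span_list bs)"
    unfolding span_list.simps by (rule card_image_le) (simp add: finite_span_list)
  also have "\<dots> \<le> q * q ^ length bs"
    using Cons by (simp add: card_cartesian_product q_eq)
  finally show ?case by simp
qed simp

lemma kspace_span_list: "kspace (span_list bs)"
proof (induction bs)
  case Nil
  then show ?case by (simp add: kspace_def)
next
  case (Cons b bs)
  note k = kspaceD[OF Cons]
  show ?case
    unfolding kspace_def
  proof (intro conjI ballI allI)
    show "0 \<in> span_list (b # bs)"
      using k(2) by (auto intro!: image_eqI[of _ _ "(0, 0)"] simp: hom_zero)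
  next
    fix x y assume "x \<in> span_list (b # bs)" "y \<in> span_list (b # bs)"
    then obtain c s c' s' where "x = \<kappa> c * b + s" "y = \<kappa> c' * b + s'" "s \<in> span_list bs" "s' \<in> span_list bs"
      by auto
    then show "x + y \<in> span_list (b # bs)"
      using k(3) by (auto intro!: image_eqI[of _ _ "(c + c', s + s')"] simp: hom_add algebra_simps)
  next
    fix a x assume "x \<in> span_list (b # bs)"
    then obtain c s where "x = \<kappa> c * b + s" "s \<in> span_list bs"
      by auto
    then show "\<kappa> a * x \<in> span_list (b # bs)"
      using k(4) by (auto intro!: image_eqI[of _ _ "(a * c, \<kappa> a * s)"] simp: hom_mult algebra_simps)
  qed (rule finite_span_list)
qed

lemma span_list_subset: "kspace L \<Longrightarrow> set bs \<subseteq> L \<Longrightarrow> span_list bs \<subseteq> L"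
  by (induction bs) (auto simp: kspaceD)

lemma card_span_list_Cons:
  assumes "b \<notin> span_list bs"
  shows "card (span_list (b # bs)) = q * card (span_list bs)"
proof -
  note k = kspace_span_list[of bs]
  have "inj_on (\<lambda>(c, s). \<kappa> c * b + s) (UNIV \<times> span_list bs)"
  proof (rule inj_onI, clarsimp)
    fix c s c' s'
    assume s: "s \<in> span_list bs" "s' \<in> span_list bs" and eq: "\<kappa> c * b + s = \<kappa> c' * b + s'"
    have "\<kappa> (c - c') * b = s' - s"
      using eq hom_add[of "c - c'" c'] by (simp add: algebra_simps)
    then have mem: "\<kappa> (c - c') * b \<in> span_list bs"
      using k s by (simp add: kspace_diff)
    have "c = c'"
    proof (rule ccontr)
      assume "c \<noteq> c'"
      then have "\<kappa> (inverse (c - c')) * (\<kappa> (c - c') * b) = b"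
        by (simp add: hom_one flip: mult.assoc hom_mult)
      then show False
        using kspaceD(4)[OF k mem, of "inverse (c - c')"] assms by simp
    qed
    then show "c = c' \<and> s = s'" using eq by simp
  qed
  then show ?thesis
    by (simp add: card_image card_cartesian_product q_eq)
qed

lemma weight_nonzero_card: "weight N bs \<noteq> 0 \<Longrightarrow> card (span_list bs) = q ^ length bs"
proof (induction bs)
  case (Cons b bs)
  have "b \<notin> span_list bs"
  proof
    assume "b \<in> span_list bs"
    then have "(\<Prod>s\<in>span_list bs. b + s) = 0"
      by (intro prod_zero) (auto simp: finite_span_list intro!: bexI[of _ "- b"] kspace_uminus kspace_span_list)
    with Cons.prems show False by simp
  qed
  moreover have "weight N bs \<noteq> 0"
    using Cons.prems by auto
  ultimately show ?case
    using Cons.IH by (simp add: card_span_list_Cons del: span_list.simps)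
qed simp

lemma weight_nonzero_span:
  assumes "kspace L" "card L = q ^ m" "set bs \<subseteq> L" "length bs = m" "weight N bs \<noteq> 0"
  shows "span_list bs = L"
  using assms weight_nonzero_card[of N bs] span_list_subset[of L bs]
  by (intro card_subset_eq) (auto simp: kspaceD)

text \<open>Expand the product in powers of \<open>b\<close>: only the leading term reaches the degree \<open>q^m - 1\<close>.\<close>

lemma sum_weight_step:
  assumes L: "kspace L" "card L = q ^ m" and S: "finite S" "card S \<le> q ^ m - 1"
  shows "(\<Sum>b\<in>L. b ^ (q ^ m - 1 - card S) * (\<Prod>s\<in>S. b + s)) = dickson_coeff L 0"
proof -
  let ?f = "Polynomial.coeff (root_poly S)" and ?e = "q ^ m - 1 - card S"
  have "(\<Prod>s\<in>S. b + s) = (\<Sum>i\<le>card S. ?f i * b ^ i)" for b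
    using S by (simp add: poly_altdef degree_root_poly flip: poly_root_poly)
  then have "(\<Sum>b\<in>L. b ^ ?e * (\<Prod>s\<in>S. b + s)) = (\<Sum>b\<in>L. \<Sum>i\<le>card S. ?f i * b ^ (?e + i))"
    by (simp add: sum_distrib_left power_add mult_ac)
  also have "\<dots> = (\<Sum>i\<le>card S. ?f i * (\<Sum>b\<in>L. b ^ (?e + i)))"
    by (subst sum.swap) (simp add: sum_distrib_left)
  also have "\<dots> = (\<Sum>i\<in>{card S}. ?f i * (\<Sum>b\<in>L. b ^ (?e + i)))"
  proof (intro sum.mono_neutral_right ballI)
    fix i assume "i \<in> {..card S} - {card S}"
    then have "?e + i < q ^ m - 1" using S by auto
    then show "?f i * (\<Sum>b\<in>L. b ^ (?e + i)) = 0"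
      by (simp only: power_sum_eq_0[OF L] mult_zero_right)
  qed auto
  also have "\<dots> = dickson_coeff L 0"
  proof -
    have "?e + card S = q ^ m - 1" using S by simp
    then show ?thesis
      using power_sum_top[OF L] coeff_root_poly_card[OF S(1)] by simp
  qed
  finally show ?thesis .
qed

lemma sum_weight:
  assumes L: "kspace L" "card L = q ^ m"
  shows "n \<le> m \<Longrightarrow> (\<Sum>bs\<in>{bs. set bs \<subseteq> L \<and> length bs = n}. weight (q ^ m) bs) = dickson_coeff L 0 ^ n"
proof (induction n)
  case 0
  have "{bs. set bs \<subseteq> L \<and> length bs = 0} = {[]}" by auto
  then show ?case by simp
next
  case (Suc n)
  let ?T = "{bs. set bs \<subseteq> L \<and> length bs = n}"
  have step: "(\<Sum>b\<in>L. weight (q ^ m) (b # bs)) = weight (q ^ m) bs * dickson_coeff L 0" if "bs \<in> ?T" for bs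
  proof -
    have "card (span_list bs) \<le> q ^ n"
      using card_span_list_le[of bs] that by simp
    also have "q ^ n < q ^ m"
      using Suc.prems q_ge_2 by (intro power_strict_increasing) auto
    finally have "card (span_list bs) \<le> q ^ m - 1" by simp
    then show ?thesis
      using sum_weight_step[OF L finite_span_list] by (simp flip: sum_distrib_left)
  qed
  have "(\<Sum>bs\<in>{bs. set bs \<subseteq> L \<and> length bs = Suc n}. weight (q ^ m) bs) =
      (\<Sum>(bs, b)\<in>?T \<times> L. weight (q ^ m) (b # bs))"
    by (subst lists_length_Suc_eq, subst sum.reindex) (auto simp: inj_on_def case_prod_unfold)
  also have "\<dots> = (\<Sum>bs\<in>?T. \<Sum>b\<in>L. weight (q ^ m) (b # bs))"
    by (rule sum.cartesian_product[symmetric])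
  also have "\<dots> = (\<Sum>bs\<in>?T. weight (q ^ m) bs * dickson_coeff L 0)"
    by (intro sum.cong refl step)
  also have "\<dots> = dickson_coeff L 0 ^ Suc n"
    using Suc by (simp add: power_Suc2 flip: sum_distrib_right del: power_Suc)
  finally show ?case .
qed

primrec quots :: "'a list \<Rightarrow> 'a \<Rightarrow> 'a" where
  "quots [] x = x"
| "quots (l # ys) x = quots ys (quot l x)"

text \<open>A flag is recorded by generators of the successive lines, each taken in the quotient by
  the preceding ones. As \<open>quot\<close> maps the ring to itself, all these quotients are subspaces of the same
  ring, and a ring automorphism acts on flags elementwise.\<close>

primrec flags :: "nat \<Rightarrow> 'a set \<Rightarrow> 'a list set" where
  "flags 0 L = {[]}"
| "flags (Suc i) L = (\<lambda>(l, ys). l # ys) ` (SIGMA l:L - {0}. flags i (quot l ` L))"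

lemma quots_diff: "quots ys (x - y) = quots ys x - quots ys y"
  by (induction ys arbitrary: x y) (auto simp: quot_diff)

lemma quots_zero: "quots ys 0 = 0"
  using quots_diff[of ys 0 0] by simp

lemma quots_scale: "quots ys (\<kappa> c * x) = \<kappa> c * quots ys x"
  by (induction ys arbitrary: x) (auto simp: quot_scale)

lemma image_quots_Cons: "quots (l # ys) ` L = quots ys ` quot l ` L"
  by auto

lemma kspace_quots: "kspace L \<Longrightarrow> kspace (quots ys ` L)"
proof (induction ys arbitrary: L)
  case (Cons l ys)
  then show ?case
    unfolding image_quots_Cons by (blast intro: kspace_quot)
qed simp

lemma finite_flags: "kspace L \<Longrightarrow> finite (flags i L)"
  by (induction i arbitrary: L) (auto intro!: finite_imageI finite_SigmaI kspace_quot simp: kspaceD)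

lemma card_quot_power:
  assumes "kspace L" "card L = q ^ Suc m" "l \<in> L" "l \<noteq> 0"
  shows "card (quot l ` L) = q ^ m"
  using card_quot[OF assms(1,3,4)] assms(2) q_ge_2 by simp

lemma card_quots:
  "kspace L \<Longrightarrow> card L = q ^ m \<Longrightarrow> i \<le> m \<Longrightarrow> ys \<in> flags i L \<Longrightarrow> card (quots ys ` L) = q ^ (m - i)"
proof (induction i arbitrary: L m ys)
  case (Suc i)
  then obtain l zs where ys: "ys = l # zs" "l \<in> L" "l \<noteq> 0" "zs \<in> flags i (quot l ` L)"
    by auto
  obtain m' where m: "m = Suc m'" using Suc.prems(3) by (cases m) auto
  have "card (quots zs ` quot l ` L) = q ^ (m' - i)"
    using Suc.prems(1-3) ys(2-4) m by (intro Suc.IH) (auto intro: kspace_quot card_quot_power)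
  then show ?case
    unfolding ys(1) image_quots_Cons m by simp
qed simp

lemma sum_flags:
  "kspace L \<Longrightarrow> card L = q ^ m \<Longrightarrow> i + k \<le> m \<Longrightarrow>
    (\<Sum>ys\<in>flags i L. dickson_coeff (quots ys ` L) k) = (- 1) ^ i * dickson_coeff L (i + k)"
proof (induction i arbitrary: L m)
  case (Suc i)
  obtain m' where m: "m = Suc m'" using Suc.prems(3) by (cases m) auto
  have "(\<Sum>ys\<in>flags (Suc i) L. dickson_coeff (quots ys ` L) k) =
      (\<Sum>(l, ys)\<in>(SIGMA l:L - {0}. flags i (quot l ` L)). dickson_coeff (quots ys ` quot l ` L) k)"
    by (simp only: flags.simps, subst sum.reindex) (auto simp: inj_on_def case_prod_unfold image_image)
  also have "\<dots> = (\<Sum>l\<in>L - {0}. \<Sum>ys\<in>flags i (quot l ` L). dickson_coeff (quots ys ` quot l ` L) k)"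
    using Suc.prems by (intro sum.Sigma[symmetric]) (auto simp: kspaceD finite_flags kspace_quot)
  also have "\<dots> = (\<Sum>l\<in>L - {0}. (- 1) ^ i * dickson_coeff (quot l ` L) (i + k))"
    using Suc.prems m by (intro sum.cong refl Suc.IH[of _ m']) (auto simp: kspace_quot card_quot_power)
  also have "\<dots> = (- 1) ^ i * (- dickson_coeff L (Suc (i + k)))"
    using dickson_coeff_Suc_sum[of L m "i + k"] Suc.prems by (simp flip: sum_distrib_left)
  finally show ?case by simp
qed simp

lemma card_kernel_quots:
  assumes "kspace L" "card L = q ^ m" "i \<le> m" "ys \<in> flags i L"
  shows "card {v \<in> L. quots ys v = 0} = q ^ i"
proof -
  let ?K = "{v \<in> L. quots ys v = 0}"
  have fib: "card {v \<in> L. quots ys v = y} = card ?K" if y: "y \<in> quots ys ` L" for y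
  proof -
    obtain v0 where v0: "v0 \<in> L" "y = quots ys v0" using y by auto
    have "bij_betw (\<lambda>v. v - v0) {v \<in> L. quots ys v = y} ?K"
      using assms(1) v0 quots_diff[of ys _ "- v0"] quots_diff[of ys 0 v0]
      by (intro bij_betwI[where g = "\<lambda>v. v + v0"]) (auto simp: quots_diff kspace_diff kspaceD quots_zero)
    then show ?thesis by (rule bij_betw_same_card)
  qed
  have "card L = (\<Sum>v\<in>L. 1)" by simp
  also have "\<dots> = (\<Sum>y\<in>quots ys ` L. \<Sum>v\<in>{v \<in> L. quots ys v = y}. 1)"
    by (rule sum.image_gen) (use assms kspaceD in auto)
  also have "\<dots> = card (quots ys ` L) * card ?K"
    by (simp add: fib)
  finally have "q ^ (m - i) * q ^ i = q ^ (m - i) * card ?K"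
    using assms by (simp add: card_quots flip: power_add)
  then show ?thesis
    using q_ge_2 by simp
qed

text \<open>By \<open>sum_flags\<close>, the \<open>i\<close>-th Dickson coefficient of \<open>L\<close> is up to sign the sum of the lowest
  coefficients of the quotients by all flags of length \<open>i\<close>. The power map with exponent \<open>q^t\<close> is
  additive, and \<open>sum_weight\<close> writes a power of each lowest coefficient as a sum over lists of vectors.\<close>

theorem dickson_coeff_power_eq_sum:
  assumes L: "kspace L" "card L = q ^ m" and i: "i \<le> m" and t: "m - i \<le> q ^ t"
  shows "(\<Sum>ys\<in>flags i L. \<Sum>bs\<in>{bs. set bs \<subseteq> quots ys ` L \<and> length bs = m - i}.
      dickson_coeff (quots ys ` L) 0 ^ (q ^ t - (m - i)) * weight (q ^ (m - i)) bs) =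
    ((- 1) ^ i * dickson_coeff L i) ^ (q ^ t)"
proof -
  have "(\<Sum>bs\<in>{bs. set bs \<subseteq> quots ys ` L \<and> length bs = m - i}.
      dickson_coeff (quots ys ` L) 0 ^ (q ^ t - (m - i)) * weight (q ^ (m - i)) bs) =
      dickson_coeff (quots ys ` L) 0 ^ (q ^ t)" if "ys \<in> flags i L" for ys
    using sum_weight[OF kspace_quots[OF L(1)] card_quots[OF L i that], of "m - i"] t
    by (simp flip: sum_distrib_left power_add)
  then have "(\<Sum>ys\<in>flags i L. \<Sum>bs\<in>{bs. set bs \<subseteq> quots ys ` L \<and> length bs = m - i}.
      dickson_coeff (quots ys ` L) 0 ^ (q ^ t - (m - i)) * weight (q ^ (m - i)) bs) =
      (\<Sum>ys\<in>flags i L. dickson_coeff (quots ys ` L) 0 ^ (q ^ t))"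
    by simp
  also have "\<dots> = (\<Sum>ys\<in>flags i L. dickson_coeff (quots ys ` L) 0) ^ (q ^ t)"
    by (simp add: frobenius_power_sum)
  finally show ?thesis
    using sum_flags[OF L, of i 0] i by simp
qed

end

section \<open>Modules over subrings\<close>

lemma mod_homI:
  assumes "\<And>x. x \<in> carrier M \<Longrightarrow> h x \<in> carrier N"
    and "\<And>x y. x \<in> carrier M \<Longrightarrow> y \<in> carrier M \<Longrightarrow> h (x \<oplus>\<^bsub>M\<^esub> y) = h x \<oplus>\<^bsub>N\<^esub> h y"
    and "\<And>r x. r \<in> carrier R \<Longrightarrow> x \<in> carrier M \<Longrightarrow> h (r \<odot>\<^bsub>M\<^esub> x) = r \<odot>\<^bsub>N\<^esub> h x"
  shows "h \<in> mod_hom R M N"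
  using assms by (auto simp: mod_hom_def)

lemma mod_homD:
  assumes "h \<in> mod_hom R M N"
  shows "x \<in> carrier M \<Longrightarrow> h x \<in> carrier N"
    and "x \<in> carrier M \<Longrightarrow> y \<in> carrier M \<Longrightarrow> h (x \<oplus>\<^bsub>M\<^esub> y) = h x \<oplus>\<^bsub>N\<^esub> h y"
    and "r \<in> carrier R \<Longrightarrow> x \<in> carrier M \<Longrightarrow> h (r \<odot>\<^bsub>M\<^esub> x) = r \<odot>\<^bsub>N\<^esub> h x"
  using assms by (auto simp: mod_hom_def)

lemma mod_hom_zero:
  assumes "h \<in> mod_hom R M N" "Module.module R M" "Module.module R N"
  shows "h \<zero>\<^bsub>M\<^esub> = \<zero>\<^bsub>N\<^esub>"
proof -
  interpret M: Module.module R M by fact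
  interpret N: Module.module R N by fact
  show ?thesis
    using mod_homD(3)[OF assms(1), of "\<zero>\<^bsub>R\<^esub>" "\<zero>\<^bsub>M\<^esub>"] mod_homD(1)[OF assms(1), of "\<zero>\<^bsub>M\<^esub>"]
    by simp
qed

lemma mod_hom_comp:
  assumes "h \<in> mod_hom R M N" "k \<in> mod_hom R N P"
  shows "(\<lambda>x. k (h x)) \<in> mod_hom R M P"
  by (intro mod_homI) (simp_all add: mod_homD[OF assms(1)] mod_homD[OF assms(2)])

lemma mod_hom_smult:
  assumes h: "h \<in> mod_hom R M N" and N: "Module.module R N" and s: "s \<in> carrier R"
  shows "(\<lambda>x. s \<odot>\<^bsub>N\<^esub> h x) \<in> mod_hom R M N"
proof -
  interpret N: Module.module R N by fact
  show ?thesis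
    using mod_homD[OF h] s
    by (intro mod_homI) (auto simp: N.smult_r_distr N.R.m_comm simp flip: N.smult_assoc1)
qed

lemma mod_hom_diff:
  assumes h: "h \<in> mod_hom R M N" and k: "k \<in> mod_hom R M N" and N: "Module.module R N"
  shows "(\<lambda>x. h x \<ominus>\<^bsub>N\<^esub> k x) \<in> mod_hom R M N"
proof -
  interpret N: Module.module R N by fact
  show ?thesis
    using mod_homD[OF h] mod_homD[OF k]
    by (intro mod_homI)
      (auto simp: a_minus_def N.smult_r_distr N.smult_r_minus N.minus_add N.M.a_ac)
qed

lemma mod_hom_minus:
  assumes h: "h \<in> mod_hom R M N" and MN: "Module.module R M" "Module.module R N"
    and "x \<in> carrier M" "y \<in> carrier M"
  shows "h (x \<ominus>\<^bsub>M\<^esub> y) = h x \<ominus>\<^bsub>N\<^esub> h y"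
proof -
  interpret M: Module.module R M by fact
  interpret N: Module.module R N by fact
  have "h (x \<ominus>\<^bsub>M\<^esub> y) \<oplus>\<^bsub>N\<^esub> h y = h x"
    using assms(4,5) by (simp add: M.M.minus_eq M.M.a_assoc M.M.l_neg flip: mod_homD(2)[OF h])
  then show ?thesis
    using assms(4,5) mod_homD(1)[OF h]
    by (metis M.M.minus_closed N.M.add.inv_solve_right N.M.minus_eq)
qed

lemma submodule_criterion:
  assumes "Module.module R M" "H \<subseteq> carrier M" "\<zero>\<^bsub>M\<^esub> \<in> H"
    and "\<And>x y. x \<in> H \<Longrightarrow> y \<in> H \<Longrightarrow> x \<oplus>\<^bsub>M\<^esub> y \<in> H"
    and "\<And>r x. r \<in> carrier R \<Longrightarrow> x \<in> H \<Longrightarrow> r \<odot>\<^bsub>M\<^esub> x \<in> H"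
  shows "submodule H R M"
proof -
  interpret M: Module.module R M by fact
  have "\<ominus>\<^bsub>M\<^esub> x \<in> H" if "x \<in> H" for x
    using assms(5)[of "\<ominus>\<^bsub>R\<^esub> \<one>\<^bsub>R\<^esub>" x] that assms(2) by (auto simp: M.smult_l_minus subset_iff)
  then show ?thesis
    using assms by (intro M.submoduleI) auto
qed

text \<open>Invariant rings, their ideals and the modules between them are all given by subsets of one ambient
  ring; the records below turn such subsets into rings and modules. The free modules have a basis
  indexed by the natural numbers.\<close>

definition subring_of :: "'a::comm_ring_1 set \<Rightarrow> 'a ring" where
  "subring_of C = \<lparr>carrier = C, mult = (*), one = 1, ring.zero = 0, ring.add = (+)\<rparr>"

definition set_module :: "'a::comm_ring_1 set \<Rightarrow> ('a, 'a) module" where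
  "set_module N = \<lparr>carrier = N, mult = (*), one = 1, ring.zero = 0, ring.add = (+), smult = (*)\<rparr>"

definition free_module :: "'a::comm_ring_1 set \<Rightarrow> ('a, nat \<Rightarrow>\<^sub>0 'a) module" where
  "free_module C = \<lparr>carrier = {p. \<forall>a. Poly_Mapping.lookup p a \<in> C}, mult = undefined, one = undefined,
     ring.zero = 0, ring.add = (+), smult = (\<lambda>s. Poly_Mapping.map ((*) s))\<rparr>"

lemma subring_of_simps [simp]:
  "carrier (subring_of C) = C" "x \<otimes>\<^bsub>subring_of C\<^esub> y = x * y" "\<one>\<^bsub>subring_of C\<^esub> = 1"
  "\<zero>\<^bsub>subring_of C\<^esub> = 0" "x \<oplus>\<^bsub>subring_of C\<^esub> y = x + y"
  by (simp_all add: subring_of_def)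

lemma set_module_simps [simp]:
  "carrier (set_module N) = N" "\<zero>\<^bsub>set_module N\<^esub> = 0" "x \<oplus>\<^bsub>set_module N\<^esub> y = x + y"
  "x \<odot>\<^bsub>set_module N\<^esub> y = x * y"
  by (simp_all add: set_module_def)

lemma regular_module_subring_of: "regular_module (subring_of C) = set_module C"
  by (simp add: regular_module_def subring_of_def set_module_def)

definition scale :: "'a::comm_ring_1 \<Rightarrow> (nat \<Rightarrow>\<^sub>0 'a) \<Rightarrow> (nat \<Rightarrow>\<^sub>0 'a)" where
  "scale s = Poly_Mapping.map ((*) s)"

lemma lookup_scale: "Poly_Mapping.lookup (scale s p) a = s * Poly_Mapping.lookup p a"
  by (simp add: scale_def Poly_Mapping.map.rep_eq when_def)

lemma free_module_simps [simp]:
  "carrier (free_module C) = {p. \<forall>a. Poly_Mapping.lookup p a \<in> C}"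
  "\<zero>\<^bsub>free_module C\<^esub> = 0" "p \<oplus>\<^bsub>free_module C\<^esub> p' = p + p'"
  "s \<odot>\<^bsub>free_module C\<^esub> p = scale s p"
  by (simp_all add: free_module_def scale_def)

definition is_subring :: "'a::comm_ring_1 set \<Rightarrow> bool" where
  "is_subring C \<longleftrightarrow> 1 \<in> C \<and> (\<forall>x\<in>C. \<forall>y\<in>C. x - y \<in> C \<and> x * y \<in> C)"

lemma is_subringD:
  assumes "is_subring C"
  shows "1 \<in> C" "0 \<in> C" "x \<in> C \<Longrightarrow> y \<in> C \<Longrightarrow> x + y \<in> C" "x \<in> C \<Longrightarrow> y \<in> C \<Longrightarrow> x - y \<in> C"
    "x \<in> C \<Longrightarrow> y \<in> C \<Longrightarrow> x * y \<in> C" "x \<in> C \<Longrightarrow> - x \<in> C"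
proof -
  show 0: "1 \<in> C" "0 \<in> C"
    using assms by (auto simp: is_subring_def) (metis diff_self)
  show neg: "x \<in> C \<Longrightarrow> - x \<in> C" for x
    using assms 0(2) by (metis diff_0 is_subring_def)
  show "x \<in> C \<Longrightarrow> y \<in> C \<Longrightarrow> x + y \<in> C" "x \<in> C \<Longrightarrow> y \<in> C \<Longrightarrow> x - y \<in> C"
    "x \<in> C \<Longrightarrow> y \<in> C \<Longrightarrow> x * y \<in> C"
    using assms neg[of y] by (auto simp: is_subring_def) (metis diff_minus_eq_add)
qed

lemma is_subring_power: "is_subring C \<Longrightarrow> x \<in> C \<Longrightarrow> x ^ n \<in> C"
  by (induction n) (auto simp: is_subringD)

lemma cring_subring_of: "is_subring C \<Longrightarrow> cring (subring_of C)"
  by (intro cringI abelian_groupI comm_monoidI)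
    (auto simp: is_subringD algebra_simps intro!: bexI[of _ "- x" for x])

lemma module_set_module:
  assumes C: "is_subring C" and N: "0 \<in> N" "\<And>x y. x \<in> N \<Longrightarrow> y \<in> N \<Longrightarrow> x + y \<in> N"
    "\<And>s x. s \<in> C \<Longrightarrow> x \<in> N \<Longrightarrow> s * x \<in> N"
  shows "Module.module (subring_of C) (set_module N)"
proof (rule Module.moduleI)
  have "- x \<in> N" if "x \<in> N" for x
    using N(3)[of "- 1" x] that C by (simp add: is_subringD)
  then show "abelian_group (set_module N)"
    using N by (intro abelian_groupI) (auto simp: algebra_simps intro!: bexI[of _ "- x" for x])
qed (use assms in \<open>auto simp: cring_subring_of algebra_simps\<close>)

lemma module_free_module:
  assumes C: "is_subring C"
  shows "Module.module (subring_of C) (free_module C)"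
proof (rule Module.moduleI)
  show "abelian_group (free_module C)"
  proof (rule abelian_groupI)
    fix p assume "p \<in> carrier (free_module C)"
    then show "\<exists>p'\<in>carrier (free_module C). p' \<oplus>\<^bsub>free_module C\<^esub> p = \<zero>\<^bsub>free_module C\<^esub>"
      using C by (intro bexI[of _ "- p"]) (auto simp: is_subringD)
  qed (use C in \<open>auto simp: is_subringD lookup_add algebra_simps\<close>)
qed (use assms in \<open>auto simp: cring_subring_of is_subringD lookup_add lookup_scale algebra_simps intro!: poly_mapping_eqI\<close>)

lemma update_eq_add_single:
  assumes "a \<notin> Poly_Mapping.keys f"
  shows "Poly_Mapping.update a b f = f + Poly_Mapping.single a b"
  using assms by (intro poly_mapping_eqI)
    (auto simp: lookup_update lookup_add lookup_single in_keys_iff)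

text \<open>A finitely supported function is determined by its graph over the support, a finite set of pairs.\<close>

lemma countable_poly_mapping:
  assumes "countable (UNIV :: 'x set)" "countable (UNIV :: 'y::zero set)"
  shows "countable (UNIV :: ('x \<Rightarrow>\<^sub>0 'y) set)"
proof -
  let ?g = "\<lambda>f :: 'x \<Rightarrow>\<^sub>0 'y. (\<lambda>a. (a, Poly_Mapping.lookup f a)) ` Poly_Mapping.keys f"
  have "countable {A :: ('x \<times> 'y) set. finite A}"
  proof -
    have "countable (UNIV :: ('x \<times> 'y) set)"
      using assms by (simp add: countable_SIGMA flip: UNIV_Times_UNIV)
    then show ?thesis
      using countable_Collect_finite_subset[of "UNIV :: ('x \<times> 'y) set"] by simp
  qed
  then have "countable (range ?g)"
    by (rule countable_subset[rotated]) auto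
  moreover have "inj ?g"
  proof (rule injI, rule poly_mapping_eqI)
    fix f f' a assume eq: "?g f = ?g f'"
    have iff: "(a, b) \<in> ?g h \<longleftrightarrow> b = Poly_Mapping.lookup h a \<and> b \<noteq> 0" for h b
      by (auto simp: in_keys_iff)
    show "Poly_Mapping.lookup f a = Poly_Mapping.lookup f' a"
      using iff[of _ f] iff[of _ f'] eq by (metis (no_types, lifting))
  qed
  ultimately show ?thesis
    by (rule countable_image_inj_on)
qed

text \<open>Injectivity, tested on modules over the type of the ring, extends to all modules with
  countably many elements: such a module can be transported to that type.\<close>

lemma injective_module_extend:
  fixes R :: "('a, 'm) ring_scheme" and B :: "('a, 'c) module"
  assumes E: "injective_module R E" and B: "Module.module R B" and A: "submodule A R B"
    and cnt: "countable (carrier B)" and inf: "infinite (UNIV :: 'a set)"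
    and h: "h \<in> mod_hom R (B\<lparr>carrier := A\<rparr>) E"
  shows "\<exists>h' \<in> mod_hom R B E. \<forall>x\<in>A. h' x = h x"
proof -
  interpret B: Module.module R B by fact
  obtain g :: "nat \<Rightarrow> 'a" where g: "inj g"
    using infinite_countable_subset[OF inf] by auto
  define f where "f x = g (to_nat_on (carrier B) x)" for x
  have inj: "inj_on f (carrier B)"
    using inj_on_to_nat_on[OF cnt] g by (auto simp: f_def inj_on_def)
  define v where "v = the_inv_into (carrier B) f"
  have v [simp]: "x \<in> carrier B \<Longrightarrow> v (f x) = x" for x
    unfolding v_def by (rule the_inv_into_f_f[OF inj])
  define B' :: "('a, 'a) module" where
    "B' = \<lparr>carrier = f ` carrier B, mult = undefined, one = undefined,
       ring.zero = f \<zero>\<^bsub>B\<^esub>, ring.add = (\<lambda>x y. f (v x \<oplus>\<^bsub>B\<^esub> v y)), smult = (\<lambda>r x. f (r \<odot>\<^bsub>B\<^esub> v x))\<rparr>"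
  have B'_simps [simp]: "carrier B' = f ` carrier B" "\<zero>\<^bsub>B'\<^esub> = f \<zero>\<^bsub>B\<^esub>"
    "x \<oplus>\<^bsub>B'\<^esub> y = f (v x \<oplus>\<^bsub>B\<^esub> v y)" "r \<odot>\<^bsub>B'\<^esub> x = f (r \<odot>\<^bsub>B\<^esub> v x)" for x y r
    by (simp_all add: B'_def)
  have A_sub: "A \<subseteq> carrier B"
    using B.submoduleE(1)[OF A] .
  then have sub: "b \<in> A \<Longrightarrow> b \<in> carrier B" for b
    by auto
  have B': "Module.module R B'"
  proof (rule Module.moduleI)
    show "abelian_group B'"
    proof (rule abelian_groupI)
      fix x assume "x \<in> carrier B'"
      then obtain b where "b \<in> carrier B" "x = f b" by auto
      then show "\<exists>y\<in>carrier B'. y \<oplus>\<^bsub>B'\<^esub> x = \<zero>\<^bsub>B'\<^esub>"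
        by (intro bexI[of _ "f (\<ominus>\<^bsub>B\<^esub> b)"]) (auto simp: B.M.l_neg)
    qed (auto simp: B.M.a_ac)
  qed (auto simp: B.smult_l_distr B.smult_r_distr B.smult_assoc1 B.R.is_cring)
  have A': "submodule (f ` A) R B'"
  proof (rule submodule_criterion[OF B'])
    show "\<zero>\<^bsub>B'\<^esub> \<in> f ` A"
      using subgroup.one_closed[OF submodule.axioms(1)[OF A]] by simp
  qed (use A_sub B.submoduleE(4,5)[OF A] in \<open>auto simp: subset_iff\<close>)
  have h': "(\<lambda>x. h (v x)) \<in> mod_hom R (B'\<lparr>carrier := f ` A\<rparr>) E"
  proof (rule mod_homI)
    fix x assume "x \<in> carrier (B'\<lparr>carrier := f ` A\<rparr>)"
    then obtain b where b: "b \<in> A" "x = f b" by auto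
    show "h (v x) \<in> carrier E"
      using mod_homD(1)[OF h, of b] b sub by simp
    show "h (v (r \<odot>\<^bsub>B'\<lparr>carrier := f ` A\<rparr>\<^esub> x)) = r \<odot>\<^bsub>E\<^esub> h (v x)" if "r \<in> carrier R" for r
      using mod_homD(3)[OF h, of r b] b sub that by simp
    fix y assume "y \<in> carrier (B'\<lparr>carrier := f ` A\<rparr>)"
    then obtain c where c: "c \<in> A" "y = f c" by auto
    show "h (v (x \<oplus>\<^bsub>B'\<lparr>carrier := f ` A\<rparr>\<^esub> y)) = h (v x) \<oplus>\<^bsub>E\<^esub> h (v y)"
      using mod_homD(2)[OF h, of b c] b c sub by simp
  qed
  obtain k where k: "k \<in> mod_hom R B' E" "\<And>x. x \<in> f ` A \<Longrightarrow> k x = h (v x)"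
    using E[unfolded injective_module_def, THEN conjunct2, rule_format, OF h' conjI[OF B' A']] by blast
  have "(\<lambda>x. k (f x)) \<in> mod_hom R B E"
  proof (rule mod_homI)
    show "k (f (x \<oplus>\<^bsub>B\<^esub> y)) = k (f x) \<oplus>\<^bsub>E\<^esub> k (f y)" if "x \<in> carrier B" "y \<in> carrier B" for x y
      using mod_homD(2)[OF k(1), of "f x" "f y"] that by simp
    show "k (f (r \<odot>\<^bsub>B\<^esub> x)) = r \<odot>\<^bsub>E\<^esub> k (f x)" if "r \<in> carrier R" "x \<in> carrier B" for r x
      using mod_homD(3)[OF k(1), of r "f x"] that by simp
  qed (use mod_homD(1)[OF k(1)] in simp)
  moreover have "k (f x) = h x" if "x \<in> A" for x
    using k(2)[of "f x"] that v[OF sub[OF that]] by simp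
  ultimately show ?thesis
    by (intro bexI[where x = "\<lambda>x. k (f x)"] ballI)
qed

section \<open>A free resolution of a cyclic module\<close>

text \<open>The resolution of \<open>C / J\<close> consists of copies of one free module with a countable basis. This
  is large enough because the ring is countable, so that every submodule of the free module is
  countable and hence an image of it. Both cardinality assumptions are also needed to test
  injective modules on the free module, by \<open>injective_module_extend\<close>.\<close>

locale free_resolution =
  fixes C :: "'a::comm_ring_1 set" and J :: "'a set"
  assumes C: "is_subring C"
    and J_subset: "J \<subseteq> C" and J_zero: "0 \<in> J"
    and J_add: "x \<in> J \<Longrightarrow> y \<in> J \<Longrightarrow> x + y \<in> J"
    and J_mult: "s \<in> C \<Longrightarrow> x \<in> J \<Longrightarrow> s * x \<in> J"
    and countable_ring: "countable (UNIV :: 'a set)"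
    and infinite_ring: "infinite (UNIV :: 'a set)"
begin

abbreviation "S \<equiv> subring_of C"
abbreviation "F \<equiv> free_module C"

lemmas C_closed = is_subringD[OF C]

lemma F_module: "Module.module S F"
  by (rule module_free_module[OF C])

lemma F_closed:
  "0 \<in> carrier F" "p \<in> carrier F \<Longrightarrow> p' \<in> carrier F \<Longrightarrow> p + p' \<in> carrier F"
  "s \<in> C \<Longrightarrow> p \<in> carrier F \<Longrightarrow> scale s p \<in> carrier F"
  "s \<in> C \<Longrightarrow> Poly_Mapping.single a s \<in> carrier F"
  "p \<in> carrier F \<Longrightarrow> p' \<in> carrier F \<Longrightarrow> p - p' \<in> carrier F"
  using C_closed by (auto simp: lookup_add lookup_scale lookup_single lookup_minus when_def)

lemma F_minus: "p \<in> carrier F \<Longrightarrow> p' \<in> carrier F \<Longrightarrow> p \<ominus>\<^bsub>F\<^esub> p' = p - p'"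
proof -
  assume p: "p \<in> carrier F" "p' \<in> carrier F"
  interpret F: Module.module S F by (rule F_module)
  have "p \<ominus>\<^bsub>F\<^esub> p' \<oplus>\<^bsub>F\<^esub> p' = p"
    using p by (metis F.M.add.inv_closed F.M.add.m_assoc F.M.l_neg F.M.minus_eq F.M.r_zero)
  then have "p \<ominus>\<^bsub>F\<^esub> p' + p' = p"
    by simp
  then show ?thesis by (metis add_diff_cancel_right')
qed

lemma free_induct [consumes 1, case_names zero add single]:
  assumes "p \<in> carrier F" and "P 0"
    and "\<And>p p'. p \<in> carrier F \<Longrightarrow> p' \<in> carrier F \<Longrightarrow> P p \<Longrightarrow> P p' \<Longrightarrow> P (p + p')"
    and "\<And>s a. s \<in> C \<Longrightarrow> P (scale s (Poly_Mapping.single a 1))"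
  shows "P p"
  using assms(1)
proof (induction p rule: update_induct)
  case const
  show ?case by (rule assms(2))
next
  case (update f a b)
  have sc: "scale b (Poly_Mapping.single a 1) = Poly_Mapping.single a b"
    by (intro poly_mapping_eqI) (simp add: lookup_scale lookup_single when_def)
  have b: "b \<in> C"
  proof -
    have "Poly_Mapping.lookup (Poly_Mapping.update a b f) a \<in> C"
      using update.prems by simp
    then show ?thesis by (simp add: lookup_update)
  qed
  have f: "f \<in> carrier F"
  proof -
    have "Poly_Mapping.lookup f a' \<in> C" for a'
    proof (cases "a' = a")
      case True
      then show ?thesis
        using update.hyps(1) C_closed(2) by (simp add: in_keys_iff)
    next
      case False
      have "Poly_Mapping.lookup (Poly_Mapping.update a b f) a' \<in> C"
        using update.prems by simp
      with False show ?thesis by (simp add: lookup_update)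
    qed
    then show ?thesis by simp
  qed
  show ?case
    unfolding update_eq_add_single[OF update.hyps(1)]
    using assms(3)[OF f _ update.IH[OF f], of "Poly_Mapping.single a b"] assms(4)[OF b, of a] F_closed(4)[OF b] sc
    by simp
qed

lemma free_hom_eq:
  assumes h: "h \<in> mod_hom S F N" and k: "k \<in> mod_hom S F N" and N: "Module.module S N"
    and eq: "\<And>a. h (Poly_Mapping.single a 1) = k (Poly_Mapping.single a 1)" and p: "p \<in> carrier F"
  shows "h p = k p"
  using p
proof (induction p rule: free_induct)
  case zero
  show ?case
    using mod_hom_zero[OF h F_module N] mod_hom_zero[OF k F_module N] by simp
next
  case (add p p')
  then show ?case
    using mod_homD(2)[OF h, of p p'] mod_homD(2)[OF k, of p p'] by simp
next
  case (single s a)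
  have "Poly_Mapping.single a 1 \<in> carrier F" by (rule F_closed(4)[OF C_closed(1)])
  then show ?case
    using mod_homD(3)[OF h, of s "Poly_Mapping.single a 1"] mod_homD(3)[OF k, of s "Poly_Mapping.single a 1"] single eq
    by simp
qed

lemma free_lift:
  assumes N: "Module.module S N" and u: "\<And>a. u a \<in> carrier N"
  shows "\<exists>h\<in>mod_hom S F N. \<forall>a. h (Poly_Mapping.single a 1) = u a"
proof -
  interpret N: Module.module S N by fact
  let ?t = "\<lambda>p a. Poly_Mapping.lookup p a \<odot>\<^bsub>N\<^esub> u a"
  define h where "h p = finsum N (?t p) (Poly_Mapping.keys p)" for p
  have t: "?t p a \<in> carrier N" if "p \<in> carrier F" for p a
    using that u by (intro N.smult_closed) auto
  have h_eq: "h p = finsum N (?t p) A" if "p \<in> carrier F" "finite A" "Poly_Mapping.keys p \<subseteq> A" for p A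
    unfolding h_def using that t[OF that(1)] u
    by (intro N.M.add.finprod_mono_neutral_cong_left) (auto simp: in_keys_iff N.smult_l_null[of "u i" for i, simplified])
  have "h \<in> mod_hom S F N"
  proof (rule mod_homI)
    fix p assume p: "p \<in> carrier F"
    show "h p \<in> carrier N"
      unfolding h_def using t[OF p] by (intro N.M.finsum_closed) auto
    show "h (r \<odot>\<^bsub>F\<^esub> p) = r \<odot>\<^bsub>N\<^esub> h p" if r: "r \<in> carrier S" for r
    proof -
      have "Poly_Mapping.keys (scale r p) \<subseteq> Poly_Mapping.keys p"
        by (auto simp: in_keys_iff lookup_scale)
      moreover have "scale r p \<in> carrier F"
        using r p F_closed(3) by simp
      ultimately have "h (scale r p) = finsum N (?t (scale r p)) (Poly_Mapping.keys p)"
        by (intro h_eq) auto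
      also have "\<dots> = finsum N (\<lambda>a. r \<odot>\<^bsub>N\<^esub> ?t p a) (Poly_Mapping.keys p)"
        using r p u t[OF p] by (intro N.M.finsum_cong') (auto simp: lookup_scale N.smult_assoc1[of _ _ "u i" for i, simplified])
      also have "\<dots> = r \<odot>\<^bsub>N\<^esub> h p"
        unfolding h_def using r t[OF p] by (intro N.finsum_smult_ldistr[symmetric]) auto
      finally show ?thesis by simp
    qed
    fix p' assume p': "p' \<in> carrier F"
    let ?A = "Poly_Mapping.keys p \<union> Poly_Mapping.keys p'"
    have "h (p + p') = finsum N (?t (p + p')) ?A"
      using p p' F_closed(2) by (intro h_eq) (auto simp: in_keys_iff lookup_add)
    also have "\<dots> = finsum N (\<lambda>a. ?t p a \<oplus>\<^bsub>N\<^esub> ?t p' a) ?A"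
      using p p' u t by (intro N.M.finsum_cong') (auto simp: lookup_add N.smult_l_distr[of _ _ "u i" for i, simplified])
    also have "\<dots> = h p \<oplus>\<^bsub>N\<^esub> h p'"
      using p p' t h_eq[OF p, of ?A] h_eq[OF p', of ?A] by (subst N.M.finsum_addf) auto
    finally show "h (p \<oplus>\<^bsub>F\<^esub> p') = h p \<oplus>\<^bsub>N\<^esub> h p'" by simp
  qed
  moreover have "h (Poly_Mapping.single a 1) = u a" for a
  proof -
    have "h (Poly_Mapping.single a 1) = finsum N (?t (Poly_Mapping.single a 1)) {a}"
      using F_closed(4)[OF C_closed(1)] by (intro h_eq) auto
    also have "\<dots> = u a"
      using N.smult_one[OF u] u by (subst N.M.finsum_insert) auto
    finally show ?thesis .
  qed
  ultimately show ?thesis by blast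
qed

lemma free_projective:
  assumes h: "h \<in> mod_hom S F Y" and \<pi>: "\<pi> \<in> mod_hom S N Y"
    and N: "Module.module S N" and Y: "Module.module S Y"
    and sub: "\<And>p. p \<in> carrier F \<Longrightarrow> h p \<in> \<pi> ` carrier N"
  shows "\<exists>h'\<in>mod_hom S F N. \<forall>p\<in>carrier F. \<pi> (h' p) = h p"
proof -
  have "\<forall>a. \<exists>x\<in>carrier N. \<pi> x = h (Poly_Mapping.single a 1)"
    using sub[OF F_closed(4)[OF C_closed(1)]] by (metis image_iff)
  then obtain u where u: "\<And>a. u a \<in> carrier N" "\<And>a. \<pi> (u a) = h (Poly_Mapping.single a 1)"
    by metis
  obtain h' where h': "h' \<in> mod_hom S F N" "\<And>a. h' (Poly_Mapping.single a 1) = u a"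
    using free_lift[of N u] N u(1) by blast
  have "\<pi> (h' p) = h p" if "p \<in> carrier F" for p
    by (rule free_hom_eq[OF mod_hom_comp[OF h'(1) \<pi>] h Y _ that]) (simp add: h'(2) u(2))
  then show ?thesis using h'(1) by blast
qed

lemma countable_F: "countable (carrier F)"
  by (rule countable_subset[OF subset_UNIV countable_poly_mapping]) (auto simp: countable_ring)

text \<open>Send the basis to an enumeration of the submodule.\<close>

lemma free_cover:
  assumes K: "submodule K S F"
  shows "\<exists>h\<in>mod_hom S F F. h ` carrier F = K"
proof -
  interpret F: Module.module S F by (rule F_module)
  note K' = F.submoduleE[OF K]
  have cnt: "countable K"
    using countable_subset[OF K'(1) countable_F] .
  have ne: "K \<noteq> {}" by (rule K'(2))
  obtain h where h: "h \<in> mod_hom S F F" "\<And>a. h (Poly_Mapping.single a 1) = from_nat_into K a"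
    using free_lift[OF F_module, of "from_nat_into K"] from_nat_into[OF ne] K'(1) by blast
  have "h p \<in> K" if "p \<in> carrier F" for p
    using that
  proof (induction p rule: free_induct)
    case zero
    have "\<zero>\<^bsub>F\<^esub> \<in> K"
      using subgroup.one_closed[OF submodule.axioms(1)[OF K]] by simp
    then show ?case using mod_hom_zero[OF h(1) F_module F_module] by simp
  next
    case (add p p')
    then show ?case using mod_homD(2)[OF h(1), of p p'] K'(5)[of "h p" "h p'"] by simp
  next
    case (single s a)
    then show ?case
      using mod_homD(3)[OF h(1), of s "Poly_Mapping.single a 1"] K'(4)[of s "from_nat_into K a"] from_nat_into[OF ne, of a]
        F_closed(4)[OF C_closed(1), of a] h(2)[of a] by simp
  qed
  moreover have "x \<in> h ` carrier F" if "x \<in> K" for x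
  proof -
    obtain a where "x = from_nat_into K a"
      using range_from_nat_into[OF ne cnt] \<open>x \<in> K\<close> by (metis imageE)
    then show ?thesis
      using h(2)[of a] F_closed(4)[OF C_closed(1), of a] by (metis image_eqI)
  qed
  ultimately show ?thesis using h(1) by blast
qed

text \<open>The kernel of the map to \<open>C / J\<close> that reads the coordinate of index \<open>0\<close>, the other basis elements going
  to zero.\<close>

definition base :: "(nat \<Rightarrow>\<^sub>0 'a) set" where
  "base = {p \<in> carrier F. Poly_Mapping.lookup p 0 \<in> J}"

definition cover :: "(nat \<Rightarrow>\<^sub>0 'a) set \<Rightarrow> (nat \<Rightarrow>\<^sub>0 'a) \<Rightarrow> (nat \<Rightarrow>\<^sub>0 'a)" where
  "cover K = (SOME h. h \<in> mod_hom S F F \<and> h ` carrier F = K)"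

text \<open>Stage \<open>k + 1\<close> covers the kernel of stage \<open>k\<close>, where the kernel of the augmentation to \<open>C / J\<close> serves for
  \<open>k = 0\<close>. The map \<open>diff 0\<close> is zero, so that cohomology in degree \<open>0\<close> needs no separate treatment: a
  coboundary in degree \<open>0\<close> is zero.\<close>

primrec diff :: "nat \<Rightarrow> (nat \<Rightarrow>\<^sub>0 'a) \<Rightarrow> (nat \<Rightarrow>\<^sub>0 'a)" where
  "diff 0 = (\<lambda>_. 0)"
| "diff (Suc k) = cover (if k = 0 then base else {p \<in> carrier F. diff k p = 0})"

definition cyc :: "nat \<Rightarrow> (nat \<Rightarrow>\<^sub>0 'a) set" where
  "cyc k = (if k = 0 then base else {p \<in> carrier F. diff k p = 0})"

lemma submodule_kernel:
  assumes "h \<in> mod_hom S F N" "Module.module S N"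
  shows "submodule {p \<in> carrier F. h p = \<zero>\<^bsub>N\<^esub>} S F"
proof -
  interpret N: Module.module S N by fact
  show ?thesis
    by (rule submodule_criterion[OF F_module])
      (use mod_hom_zero[OF assms(1) F_module assms(2)] mod_homD[OF assms(1)] F_closed in auto)
qed

lemma submodule_base: "submodule base S F"
  by (rule submodule_criterion[OF F_module])
    (auto simp: base_def J_zero J_add J_mult lookup_add lookup_scale C_closed)

lemma diff_props: "diff k \<in> mod_hom S F F \<and> submodule (cyc k) S F"
proof (induction k)
  case 0
  show ?case
    by (auto simp: cyc_def submodule_base intro!: mod_homI poly_mapping_eqI simp: lookup_scale C_closed)
next
  case (Suc k)
  have "\<exists>h. h \<in> mod_hom S F F \<and> h ` carrier F = cyc k"
    using free_cover Suc by blast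
  then have "cover (cyc k) \<in> mod_hom S F F"
    unfolding cover_def by (rule someI2_ex) blast
  then have d: "diff (Suc k) \<in> mod_hom S F F"
    by (simp add: cyc_def)
  then show ?case
    using submodule_kernel[OF d F_module] by (simp add: cyc_def)
qed

lemma diff_hom: "diff k \<in> mod_hom S F F"
  and submodule_cyc: "submodule (cyc k) S F"
  using diff_props by blast+

lemma image_diff_Suc: "diff (Suc k) ` carrier F = cyc k"
proof -
  have "\<exists>h. h \<in> mod_hom S F F \<and> h ` carrier F = cyc k"
    using free_cover submodule_cyc by blast
  then have "cover (cyc k) ` carrier F = cyc k"
    unfolding cover_def by (rule someI2_ex) blast
  then show ?thesis by (simp add: cyc_def)
qed

declare diff.simps(2) [simp del]

lemma diff_closed: "p \<in> carrier F \<Longrightarrow> diff k p \<in> carrier F"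
  using mod_homD(1)[OF diff_hom] .

lemma diff_zero: "diff k 0 = 0"
  using mod_hom_zero[OF diff_hom F_module F_module, of k] by simp

lemma diff_diff: "p \<in> carrier F \<Longrightarrow> diff k (diff (Suc k) p) = 0"
proof -
  assume "p \<in> carrier F"
  then have "diff (Suc k) p \<in> cyc k"
    using image_diff_Suc[of k] by blast
  then show ?thesis
    by (cases k) (auto simp: cyc_def)
qed

lemma cyc_iff: "p \<in> cyc (Suc k) \<longleftrightarrow> p \<in> carrier F \<and> diff (Suc k) p = 0"
  by (simp add: cyc_def)

text \<open>Multiplication by an element of \<open>J\<close> is zero on \<open>C / J\<close>, hence null-homotopic on the resolution; the
  homotopy is lifted degree by degree because free modules are projective.\<close>

lemma scale_null_homotopic:
  assumes r: "r \<in> J"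
  shows "\<exists>h\<in>mod_hom S F F. \<exists>h'\<in>mod_hom S F F.
    \<forall>p\<in>carrier F. scale r p = diff (Suc k) (h p) + h' (diff k p)"
proof -
  have rC: "r \<in> C" using r J_subset by blast
  have scale_hom: "scale r \<in> mod_hom S F F"
    using rC by (intro mod_homI) (auto simp: lookup_scale lookup_add algebra_simps C_closed intro!: poly_mapping_eqI)
  have zero_hom: "(\<lambda>_. 0) \<in> mod_hom S F F"
    using diff_hom[of 0] by simp
  show ?thesis
  proof (induction k)
    case 0
    have "scale r p \<in> diff (Suc 0) ` carrier F" if "p \<in> carrier F" for p
      unfolding image_diff_Suc
      using that rC J_mult[OF _ r, of "Poly_Mapping.lookup p 0"]
      by (auto simp: cyc_def base_def lookup_scale C_closed mult.commute)
    then obtain h where h: "h \<in> mod_hom S F F" "\<forall>p\<in>carrier F. diff (Suc 0) (h p) = scale r p"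
      using free_projective[OF scale_hom diff_hom F_module F_module] by blast
    show ?case
      using h by (intro bexI[OF _ h(1)] bexI[OF _ zero_hom]) simp
  next
    case (Suc k)
    then obtain h h' where h: "h \<in> mod_hom S F F" and h': "h' \<in> mod_hom S F F"
      and eq: "\<And>p. p \<in> carrier F \<Longrightarrow> scale r p = diff (Suc k) (h p) + h' (diff k p)"
      by blast
    define g where "g p = scale r p - h (diff (Suc k) p)" for p
    have hd: "(\<lambda>p. h (diff (Suc k) p)) \<in> mod_hom S F F"
      by (rule mod_hom_comp[OF diff_hom h])
    have gF: "g p = scale r p \<ominus>\<^bsub>F\<^esub> h (diff (Suc k) p)" if "p \<in> carrier F" for p
      unfolding g_def using that mod_homD(1)[OF scale_hom] mod_homD(1)[OF hd] by (simp only: F_minus)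
    have g: "g \<in> mod_hom S F F"
      using mod_hom_diff[OF scale_hom hd F_module] gF
      unfolding mod_hom_def using F_closed by (auto simp: Pi_def)
    have "g p \<in> diff (Suc (Suc k)) ` carrier F" if p: "p \<in> carrier F" for p
    proof -
      let ?w = "diff (Suc k) p"
      have w: "?w \<in> carrier F" by (rule diff_closed[OF p])
      have "diff (Suc k) (g p) = diff (Suc k) (scale r p) \<ominus>\<^bsub>F\<^esub> diff (Suc k) (h ?w)"
        unfolding gF[OF p]
        by (rule mod_hom_minus[OF diff_hom F_module F_module mod_homD(1)[OF scale_hom p] mod_homD(1)[OF h w]])
      also have "\<dots> = diff (Suc k) (scale r p) - diff (Suc k) (h ?w)"
        by (intro F_minus diff_closed mod_homD(1)[OF scale_hom p] mod_homD(1)[OF h w])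
      also have "diff (Suc k) (scale r p) = scale r ?w"
        using mod_homD(3)[OF diff_hom, of r p "Suc k"] p rC by simp
      also have "\<dots> = diff (Suc k) (h ?w) + h' 0"
        using eq[OF w] diff_diff[OF p, of k] by simp
      also have "h' 0 = 0"
        using mod_hom_zero[OF h' F_module F_module] by simp
      finally have "diff (Suc k) (g p) = 0" by simp
      then show ?thesis
        unfolding image_diff_Suc cyc_iff using mod_homD(1)[OF g p] by simp
    qed
    then obtain h2 where h2: "h2 \<in> mod_hom S F F" "\<forall>p\<in>carrier F. diff (Suc (Suc k)) (h2 p) = g p"
      using free_projective[OF g diff_hom F_module F_module] by blast
    show ?case
      using h2 by (intro bexI[OF _ h2(1)] bexI[OF _ h]) (simp add: g_def)
  qed
qed

end

section \<open>Regular sequences and the vanishing of cohomology\<close>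

lemma abelian_minus_eq_zero:
  assumes "abelian_group A" "x \<in> carrier A" "y \<in> carrier A" "x \<ominus>\<^bsub>A\<^esub> y = \<zero>\<^bsub>A\<^esub>"
  shows "x = y"
proof -
  interpret abelian_group A by fact
  have "x = (x \<ominus>\<^bsub>A\<^esub> y) \<oplus>\<^bsub>A\<^esub> y"
    using assms(2,3) by (simp add: minus_eq a_assoc l_neg)
  then show ?thesis
    using assms(3,4) by simp
qed

lemma (in free_resolution) submodule_image_diff: "submodule (diff k ` carrier F) S F"
proof (cases k)
  case 0
  have "submodule {0} S F"
    by (rule submodule_criterion[OF F_module]) (auto simp: C_closed intro!: poly_mapping_eqI simp: lookup_scale)
  moreover have "diff k ` carrier F = {0}"
    using 0 F_closed(1) by (auto simp del: free_module_simps(1))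
  ultimately show ?thesis by simp
next
  case (Suc k')
  then show ?thesis using submodule_cyc[of k'] by (simp only: image_diff_Suc)
qed

text \<open>A homomorphism that vanishes on the kernel of \<open>diff k\<close> is defined on the image, a submodule of the free
  module, from which it extends because \<open>E\<close> is injective.\<close>

lemma (in free_resolution) injective_factor:
  assumes E: "injective_module S E" and t: "t \<in> mod_hom S F E"
    and van: "\<And>p. p \<in> carrier F \<Longrightarrow> diff k p = 0 \<Longrightarrow> t p = \<zero>\<^bsub>E\<^esub>"
  shows "\<exists>w\<in>mod_hom S F E. \<forall>p\<in>carrier F. t p = w (diff k p)"
proof -
  have Em: "Module.module S E" using E by (simp add: injective_module_def)
  interpret E: Module.module S E by (rule Em)
  let ?A = "diff k ` carrier F"
  define h where "h y = t (SOME p. p \<in> carrier F \<and> diff k p = y)" for y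
  have h: "h (diff k p) = t p" if p: "p \<in> carrier F" for p
  proof -
    obtain p' where p': "p' \<in> carrier F" "diff k p' = diff k p" and hp: "h (diff k p) = t p'"
      using someI[of "\<lambda>p'. p' \<in> carrier F \<and> diff k p' = diff k p" p] p unfolding h_def by blast
    have "diff k (p' \<ominus>\<^bsub>F\<^esub> p) = diff k p' \<ominus>\<^bsub>F\<^esub> diff k p"
      by (rule mod_hom_minus[OF diff_hom F_module F_module p'(1) p])
    also have "\<dots> = diff k p' - diff k p"
      by (intro F_minus diff_closed p p'(1))
    finally have "t (p' \<ominus>\<^bsub>F\<^esub> p) = \<zero>\<^bsub>E\<^esub>"
      using van[OF F_closed(5)[OF p'(1) p]] F_minus[OF p'(1) p] p'(2) by simp
    then have tt: "t p' \<ominus>\<^bsub>E\<^esub> t p = \<zero>\<^bsub>E\<^esub>"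
      using mod_hom_minus[OF t F_module Em p'(1) p] by simp
    show ?thesis
      unfolding hp
      by (rule abelian_minus_eq_zero[OF E.M.abelian_group_axioms mod_homD(1)[OF t p'(1)] mod_homD(1)[OF t p] tt])
  qed
  have "h \<in> mod_hom S (F\<lparr>carrier := ?A\<rparr>) E"
  proof (rule mod_homI)
    fix y assume "y \<in> carrier (F\<lparr>carrier := ?A\<rparr>)"
    then obtain p where p: "p \<in> carrier F" "y = diff k p" by (simp del: free_module_simps(1)) blast
    show "h y \<in> carrier E" using h p mod_homD(1)[OF t] by metis
    show "h (r \<odot>\<^bsub>F\<lparr>carrier := ?A\<rparr>\<^esub> y) = r \<odot>\<^bsub>E\<^esub> h y" if "r \<in> carrier S" for r
    proof -
      have "scale r p \<in> carrier F" using F_closed(3) that p by simp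
      then show ?thesis
        using h[of "scale r p"] h[of p] p that mod_homD(3)[OF t, of r p] mod_homD(3)[OF diff_hom, of r p k] by simp
    qed
    fix y' assume "y' \<in> carrier (F\<lparr>carrier := ?A\<rparr>)"
    then obtain p' where p': "p' \<in> carrier F" "y' = diff k p'" by (simp del: free_module_simps(1)) blast
    show "h (y \<oplus>\<^bsub>F\<lparr>carrier := ?A\<rparr>\<^esub> y') = h y \<oplus>\<^bsub>E\<^esub> h y'"
    proof -
      have "p + p' \<in> carrier F" using F_closed(2) p p' by simp
      then show ?thesis
        using h[of "p + p'"] h[of p] h[of p'] p p' mod_homD(2)[OF t, of p p'] mod_homD(2)[OF diff_hom, of p p' k] by simp
    qed
  qed
  then obtain w where w: "w \<in> mod_hom S F E" "\<forall>y\<in>?A. w y = h y"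
    using injective_module_extend[OF E F_module submodule_image_diff countable_F infinite_ring] by blast
  then show ?thesis using h by (intro bexI[OF _ w(1)]) auto
qed

text \<open>The ideal of \<open>M\<close> generated by \<open>J\<close>.\<close>

inductive_set add_span :: "'a::comm_ring_1 set \<Rightarrow> 'a set \<Rightarrow> 'a set" for J M where
  prod: "s \<in> J \<Longrightarrow> t \<in> M \<Longrightarrow> s * t \<in> add_span J M"
| sum: "x \<in> add_span J M \<Longrightarrow> y \<in> add_span J M \<Longrightarrow> x + y \<in> add_span J M"

primrec seq_ideal :: "'a::comm_ring_1 set \<Rightarrow> (nat \<Rightarrow> 'a) \<Rightarrow> nat \<Rightarrow> 'a set" where
  "seq_ideal M z 0 = {0}"
| "seq_ideal M z (Suc j) = {a + z j * b | a b. a \<in> seq_ideal M z j \<and> b \<in> M}"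

definition regular_seq :: "'a::comm_ring_1 set \<Rightarrow> nat \<Rightarrow> (nat \<Rightarrow> 'a) \<Rightarrow> bool" where
  "regular_seq M d z \<longleftrightarrow> (\<forall>j<d. z j \<in> M \<and> (\<forall>a\<in>M. z j * a \<in> seq_ideal M z j \<longrightarrow> a \<in> seq_ideal M z j))"

lemma seq_ideal_closed:
  assumes M: "is_subring M"
  shows "0 \<in> seq_ideal M z j"
    and "x \<in> seq_ideal M z j \<Longrightarrow> y \<in> seq_ideal M z j \<Longrightarrow> x + y \<in> seq_ideal M z j"
    and "t \<in> M \<Longrightarrow> x \<in> seq_ideal M z j \<Longrightarrow> t * x \<in> seq_ideal M z j"
proof -
  show "0 \<in> seq_ideal M z j"
    by (induction j) (auto simp: is_subringD[OF M] intro!: exI[of _ 0])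
  show "x \<in> seq_ideal M z j \<Longrightarrow> y \<in> seq_ideal M z j \<Longrightarrow> x + y \<in> seq_ideal M z j"
  proof (induction j arbitrary: x y)
    case (Suc j)
    then obtain a b a' b' where "x = a + z j * b" "y = a' + z j * b'" "a \<in> seq_ideal M z j" "a' \<in> seq_ideal M z j" "b \<in> M" "b' \<in> M"
      by auto
    then have "x + y = (a + a') + z j * (b + b')" "a + a' \<in> seq_ideal M z j" "b + b' \<in> M"
      using Suc.IH by (auto simp: is_subringD[OF M] algebra_simps)
    then show ?case by auto
  qed simp
  show "t \<in> M \<Longrightarrow> x \<in> seq_ideal M z j \<Longrightarrow> t * x \<in> seq_ideal M z j"
  proof (induction j arbitrary: x)
    case (Suc j)
    then obtain a b where "x = a + z j * b" "a \<in> seq_ideal M z j" "b \<in> M"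
      by auto
    then have "t * x = t * a + z j * (t * b)" "t * a \<in> seq_ideal M z j" "t * b \<in> M"
      using Suc by (auto simp: is_subringD[OF M] algebra_simps)
    then show ?case by auto
  qed simp
qed

lemma seq_ideal_diff:
  assumes M: "is_subring M" and "x \<in> seq_ideal M z j" "y \<in> seq_ideal M z j"
  shows "x - y \<in> seq_ideal M z j"
  using seq_ideal_closed(2)[OF M assms(2) seq_ideal_closed(3)[OF M _ assms(3), of "- 1"]] is_subringD[OF M]
  by simp

locale free_resolution_over = free_resolution C J for C J :: "'a::comm_ring_1 set" +
  fixes M :: "'a set"
  assumes M: "is_subring M" and C_M: "C \<subseteq> M"
begin

lemmas M_closed = is_subringD[OF M]

lemma M_module: "Module.module S (set_module M)"
  using C_M by (intro module_set_module[OF C]) (auto simp: M_closed)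

lemma hom_M_closed: "\<phi> \<in> mod_hom S F (set_module M) \<Longrightarrow> p \<in> carrier F \<Longrightarrow> \<phi> p \<in> M"
  using mod_homD(1)[of \<phi> S F "set_module M" p] by simp

lemma hom_M_add: "\<phi> \<in> mod_hom S F (set_module M) \<Longrightarrow> p \<in> carrier F \<Longrightarrow> p' \<in> carrier F \<Longrightarrow>
    \<phi> (p + p') = \<phi> p + \<phi> p'"
  using mod_homD(2)[of \<phi> S F "set_module M" p p'] by simp

lemma hom_M_scale: "\<phi> \<in> mod_hom S F (set_module M) \<Longrightarrow> p \<in> carrier F \<Longrightarrow> s \<in> C \<Longrightarrow>
    \<phi> (scale s p) = s * \<phi> p"
  using mod_homD(3)[of \<phi> S F "set_module M" s p] by simp

lemma hom_M_zero: "\<phi> \<in> mod_hom S F (set_module M) \<Longrightarrow> \<phi> 0 = 0"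
  using mod_hom_zero[of \<phi> S F "set_module M"] F_module M_module by simp

lemma hom_M_mult: "\<phi> \<in> mod_hom S F (set_module M) \<Longrightarrow> t \<in> M \<Longrightarrow> (\<lambda>p. t * \<phi> p) \<in> mod_hom S F (set_module M)"
  by (intro mod_homI) (auto simp: hom_M_closed hom_M_add hom_M_scale M_closed algebra_simps simp del: free_module_simps(1))

lemma hom_M_plus: "\<phi> \<in> mod_hom S F (set_module M) \<Longrightarrow> \<psi> \<in> mod_hom S F (set_module M) \<Longrightarrow>
    (\<lambda>p. \<phi> p + \<psi> p) \<in> mod_hom S F (set_module M)"
  by (intro mod_homI) (auto simp: hom_M_closed hom_M_add hom_M_scale M_closed algebra_simps simp del: free_module_simps(1))

context
  fixes z :: "nat \<Rightarrow> 'a" and d :: nat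
  assumes reg: "regular_seq M d z"
    and nilp: "\<And>j. j < d \<Longrightarrow> \<exists>e. z j ^ e \<in> add_span J M"
begin

abbreviation "N \<equiv> seq_ideal M z"

text \<open>Cohomology with values in the quotient of \<open>M\<close> by the first \<open>j\<close> elements of the sequence, without
  forming the quotient: cocycles and coboundaries are taken modulo \<open>seq_ideal M z j\<close>.\<close>

definition cocycle :: "nat \<Rightarrow> nat \<Rightarrow> ((nat \<Rightarrow>\<^sub>0 'a) \<Rightarrow> 'a) \<Rightarrow> bool" where
  "cocycle i j \<phi> \<longleftrightarrow> \<phi> \<in> mod_hom S F (set_module M) \<and> (\<forall>p\<in>carrier F. \<phi> (diff (Suc i) p) \<in> N j)"

definition coboundary :: "nat \<Rightarrow> nat \<Rightarrow> ((nat \<Rightarrow>\<^sub>0 'a) \<Rightarrow> 'a) \<Rightarrow> bool" where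
  "coboundary i j \<phi> \<longleftrightarrow> (\<exists>\<psi>\<in>mod_hom S F (set_module M). \<forall>p\<in>carrier F. \<phi> p - \<psi> (diff i p) \<in> N j)"

lemmas N_closed = seq_ideal_closed[OF M, where z = z]
lemmas N_diff = seq_ideal_diff[OF M, where z = z]

lemma cocycle_mult: "cocycle i j \<phi> \<Longrightarrow> t \<in> M \<Longrightarrow> cocycle i j (\<lambda>p. t * \<phi> p)"
  by (auto simp: cocycle_def hom_M_mult N_closed simp del: free_module_simps(1))

lemma coboundary_plus:
  assumes "coboundary i j \<phi>" "coboundary i j \<phi>'"
  shows "coboundary i j (\<lambda>p. \<phi> p + \<phi>' p)"
proof -
  obtain \<psi> \<psi>' where \<psi>: "\<psi> \<in> mod_hom S F (set_module M)" "\<And>p. p \<in> carrier F \<Longrightarrow> \<phi> p - \<psi> (diff i p) \<in> N j"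
    "\<psi>' \<in> mod_hom S F (set_module M)" "\<And>p. p \<in> carrier F \<Longrightarrow> \<phi>' p - \<psi>' (diff i p) \<in> N j"
    using assms unfolding coboundary_def by blast
  have "\<phi> p + \<phi>' p - (\<psi> (diff i p) + \<psi>' (diff i p)) \<in> N j" if "p \<in> carrier F" for p
    using N_closed(2)[OF \<psi>(2)[OF that] \<psi>(4)[OF that]] by (simp add: algebra_simps)
  then show ?thesis
    unfolding coboundary_def by (intro bexI[OF _ hom_M_plus[OF \<psi>(1,3)]] ballI)
qed

text \<open>The value at a cocycle of the homotopy for multiplication by \<open>r\<close>.\<close>

lemma coboundary_J:
  assumes \<phi>: "cocycle i j \<phi>" and r: "r \<in> J"
  shows "coboundary i j (\<lambda>p. r * \<phi> p)"
proof -
  have hom: "\<phi> \<in> mod_hom S F (set_module M)" using \<phi> by (simp add: cocycle_def)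
  obtain h h' where h: "h \<in> mod_hom S F F" "h' \<in> mod_hom S F F"
    "\<And>p. p \<in> carrier F \<Longrightarrow> scale r p = diff (Suc i) (h p) + h' (diff i p)"
    using scale_null_homotopic[OF r, of i] by blast
  have "r * \<phi> p - \<phi> (h' (diff i p)) \<in> N j" if p: "p \<in> carrier F" for p
  proof -
    have "r * \<phi> p = \<phi> (scale r p)"
      using hom_M_scale[OF hom p, of r] r J_subset by auto
    also have "\<dots> = \<phi> (diff (Suc i) (h p)) + \<phi> (h' (diff i p))"
      unfolding h(3)[OF p]
      by (intro hom_M_add[OF hom] diff_closed mod_homD(1)[OF h(1)] mod_homD(1)[OF h(2)] p)
    finally have "r * \<phi> p - \<phi> (h' (diff i p)) = \<phi> (diff (Suc i) (h p))"
      by simp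
    then show ?thesis
      using \<phi> mod_homD(1)[OF h(1) p] unfolding cocycle_def by simp
  qed
  then show ?thesis
    unfolding coboundary_def by (intro bexI[OF _ mod_hom_comp[OF h(2) hom]] ballI)
qed

lemma coboundary_add_span:
  assumes \<phi>: "cocycle i j \<phi>" and a: "a \<in> add_span J M"
  shows "coboundary i j (\<lambda>p. a * \<phi> p)"
  using a
proof (induction a rule: add_span.induct)
  case (prod s t)
  then show ?case
    using coboundary_J[OF cocycle_mult[OF \<phi>, of t], of s] by (simp add: mult.assoc)
next
  case (sum x y)
  then show ?case
    using coboundary_plus by (simp add: distrib_right)
qed

text \<open>If \<open>x\<close> acts injectively on cohomology, then so do its powers.\<close>

lemma coboundary_cancel_power:
  assumes step: "\<And>\<phi>. cocycle i j \<phi> \<Longrightarrow> coboundary i j (\<lambda>p. x * \<phi> p) \<Longrightarrow> coboundary i j \<phi>"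
    and x: "x \<in> M"
  shows "cocycle i j \<phi> \<Longrightarrow> coboundary i j (\<lambda>p. x ^ e * \<phi> p) \<Longrightarrow> coboundary i j \<phi>"
proof (induction e)
  case (Suc e)
  have "cocycle i j (\<lambda>p. x ^ e * \<phi> p)"
    using Suc.prems(1) x by (intro cocycle_mult is_subring_power[OF M])
  then have "coboundary i j (\<lambda>p. x ^ e * \<phi> p)"
    by (rule step) (use Suc.prems(2) in \<open>simp add: mult.assoc\<close>)
  then show ?case using Suc by blast
qed simp

text \<open>The depth argument: \<open>Ext\<close> from \<open>C / J\<close> to \<open>M / (z 0, \<dots>, z (j - 1))\<close> vanishes in degrees below \<open>d - j\<close>.
  If it vanishes in degree \<open>i - 1\<close> for \<open>j + 1\<close> elements, then by the long exact sequence \<open>z j\<close> acts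
  injectively on it in degree \<open>i\<close> for \<open>j\<close> elements. As some power of \<open>z j\<close> lies in the ideal generated by
  \<open>J\<close>, which annihilates cohomology, it must be zero. In degree \<open>0\<close> the injectivity is that of
  \<open>z j\<close> on the quotient itself.\<close>

theorem cocycle_imp_coboundary:
  "i + j < d \<Longrightarrow> cocycle i j \<phi> \<Longrightarrow> coboundary i j \<phi>"
proof (induction i arbitrary: j \<phi>)
  case 0
  have j: "j < d" using 0 by simp
  have z: "z j \<in> M" using reg j by (auto simp: regular_seq_def)
  have z0: "(\<lambda>_. 0) \<in> mod_hom S F (set_module M)"
    using M_closed(2) by (intro mod_homI) auto
  have step: "coboundary 0 j \<phi>" if \<phi>: "cocycle 0 j \<phi>" and cb: "coboundary 0 j (\<lambda>p. z j * \<phi> p)" for \<phi>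
  proof -
    obtain \<psi> where \<psi>: "\<psi> \<in> mod_hom S F (set_module M)" "\<And>p. p \<in> carrier F \<Longrightarrow> z j * \<phi> p - \<psi> (diff 0 p) \<in> N j"
      using cb unfolding coboundary_def by blast
    have "\<phi> p \<in> N j" if "p \<in> carrier F" for p
    proof -
      have "\<phi> p \<in> M" using \<phi> that hom_M_closed by (simp add: cocycle_def)
      moreover have "z j * \<phi> p \<in> N j"
        using \<psi>(2)[OF that] hom_M_zero[OF \<psi>(1)] by simp
      ultimately show ?thesis
        using reg j by (simp add: regular_seq_def)
    qed
    then show ?thesis
      unfolding coboundary_def using z0 by (intro bexI[OF _ z0]) simp
  qed
  show ?case
    using nilp[OF j] coboundary_cancel_power[OF step z 0(2)] coboundary_add_span[OF 0(2)] by blast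
next
  case (Suc i)
  have j: "j < d" using Suc.prems by simp
  have z: "z j \<in> M" using reg j by (auto simp: regular_seq_def)
  have step: "coboundary (Suc i) j \<phi>"
    if \<phi>: "cocycle (Suc i) j \<phi>" and cb: "coboundary (Suc i) j (\<lambda>p. z j * \<phi> p)" for \<phi>
  proof -
    have hom: "\<phi> \<in> mod_hom S F (set_module M)" using \<phi> by (simp add: cocycle_def)
    obtain \<psi> where \<psi>: "\<psi> \<in> mod_hom S F (set_module M)"
      "\<And>p. p \<in> carrier F \<Longrightarrow> z j * \<phi> p - \<psi> (diff (Suc i) p) \<in> N j"
      using cb unfolding coboundary_def by blast
    \<comment> \<open>The connecting homomorphism: \<open>z j \<phi>\<close> bounds \<open>\<psi>\<close>, which is a cocycle modulo one more element.\<close>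
    have "\<psi> (diff (Suc i) p) \<in> N (Suc j)" if p: "p \<in> carrier F" for p
    proof -
      have "- (z j * \<phi> p - \<psi> (diff (Suc i) p)) \<in> N j"
        using N_diff[OF N_closed(1) \<psi>(2)[OF p]] by simp
      moreover have "\<psi> (diff (Suc i) p) = - (z j * \<phi> p - \<psi> (diff (Suc i) p)) + z j * \<phi> p"
        by simp
      ultimately show ?thesis
        unfolding seq_ideal.simps using hom_M_closed[OF hom p] by blast
    qed
    then have "cocycle i (Suc j) \<psi>"
      using \<psi>(1) by (simp add: cocycle_def)
    then have "coboundary i (Suc j) \<psi>"
      using Suc.prems(1) by (intro Suc.IH) auto
    then obtain \<xi> where \<xi>: "\<xi> \<in> mod_hom S F (set_module M)"
      "\<And>p. p \<in> carrier F \<Longrightarrow> \<psi> p - \<xi> (diff i p) \<in> N (Suc j)"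
      unfolding coboundary_def by blast
    let ?e = "\<lambda>a. Poly_Mapping.single a 1 :: nat \<Rightarrow>\<^sub>0 'a"
    have e: "?e a \<in> carrier F" for a
      by (rule F_closed(4)[OF C_closed(1)])
    have "\<forall>a. \<exists>b\<in>M. \<psi> (?e a) - \<xi> (diff i (?e a)) - z j * b \<in> N j"
    proof
      fix a
      obtain c b where "\<psi> (?e a) - \<xi> (diff i (?e a)) = c + z j * b" "c \<in> N j" "b \<in> M"
        using \<xi>(2)[OF e[of a]] by auto
      then show "\<exists>b\<in>M. \<psi> (?e a) - \<xi> (diff i (?e a)) - z j * b \<in> N j"
        by (intro bexI[of _ b]) auto
    qed
    then obtain b where b: "\<And>a. b a \<in> M" "\<And>a. \<psi> (?e a) - \<xi> (diff i (?e a)) - z j * b a \<in> N j"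
      by metis
    \<comment> \<open>The difference of \<open>\<psi>\<close> and the coboundary of \<open>\<xi>\<close> is divisible by \<open>z j\<close> modulo the first \<open>j\<close>
      elements; the quotient is chosen on the basis and extended linearly.\<close>
    obtain \<eta> where \<eta>: "\<eta> \<in> mod_hom S F (set_module M)" "\<And>a. \<eta> (?e a) = b a"
      using free_lift[OF M_module, of b] b(1) by auto
    have key: "\<psi> p - \<xi> (diff i p) - z j * \<eta> p \<in> N j" if "p \<in> carrier F" for p
      using that
    proof (induction p rule: free_induct)
      case zero
      show ?case
        using hom_M_zero[OF \<psi>(1)] hom_M_zero[OF \<xi>(1)] hom_M_zero[OF \<eta>(1)] diff_zero N_closed(1) by simp
    next
      case (add p p')
      have "diff i (p + p') = diff i p + diff i p'"
        using mod_homD(2)[OF diff_hom add(1,2), of i] by simp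
      then have "\<psi> (p + p') - \<xi> (diff i (p + p')) - z j * \<eta> (p + p') =
          (\<psi> p - \<xi> (diff i p) - z j * \<eta> p) + (\<psi> p' - \<xi> (diff i p') - z j * \<eta> p')"
        by (simp only: hom_M_add[OF \<psi>(1) add(1,2)] hom_M_add[OF \<eta>(1) add(1,2)]
            hom_M_add[OF \<xi>(1) diff_closed[OF add(1)] diff_closed[OF add(2)]])
          (simp add: algebra_simps)
      then show ?case using N_closed(2)[OF add(3,4)] by simp
    next
      case (single s a)
      have "diff i (scale s (?e a)) = scale s (diff i (?e a))"
        using mod_homD(3)[OF diff_hom _ e[of a], of s i] single by simp
      then have "\<psi> (scale s (?e a)) - \<xi> (diff i (scale s (?e a))) - z j * \<eta> (scale s (?e a)) =
          s * (\<psi> (?e a) - \<xi> (diff i (?e a)) - z j * b a)"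
        using hom_M_scale[OF \<psi>(1) e single] hom_M_scale[OF \<eta>(1) e single]
          hom_M_scale[OF \<xi>(1) diff_closed[OF e] single, of i a]
        by (simp add: \<eta>(2) algebra_simps)
      then show ?case using N_closed(3)[OF _ b(2), of s] single C_M by auto
    qed
    have "\<phi> p - \<eta> (diff (Suc i) p) \<in> N j" if p: "p \<in> carrier F" for p
    proof -
      let ?w = "diff (Suc i) p"
      have w: "?w \<in> carrier F" by (rule diff_closed[OF p])
      have w2: "\<psi> ?w - z j * \<eta> ?w \<in> N j"
        using key[OF w] diff_diff[OF p, of i] hom_M_zero[OF \<xi>(1)] by simp
      have "z j * (\<phi> p - \<eta> ?w) \<in> N j"
        using N_closed(2)[OF \<psi>(2)[OF p] w2] by (simp add: algebra_simps)
      moreover have "\<phi> p - \<eta> ?w \<in> M"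
        using hom_M_closed[OF hom p] hom_M_closed[OF \<eta>(1) w] by (simp add: M_closed)
      ultimately show ?thesis
        using reg j by (simp add: regular_seq_def)
    qed
    then show ?thesis
      unfolding coboundary_def using \<eta>(1) by blast
  qed
  show ?case
    using nilp[OF j] coboundary_cancel_power[OF step z Suc.prems(2)] coboundary_add_span[OF Suc.prems(2)] by blast
qed

corollary cocycle_eq_coboundary:
  assumes "i < d" "\<phi> \<in> mod_hom S F (set_module M)" "\<And>p. p \<in> carrier F \<Longrightarrow> \<phi> (diff (Suc i) p) = 0"
  shows "\<exists>\<psi>\<in>mod_hom S F (set_module M). \<forall>p\<in>carrier F. \<phi> p = \<psi> (diff i p)"
proof -
  have "coboundary i 0 \<phi>"
    using assms by (intro cocycle_imp_coboundary) (auto simp: cocycle_def)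
  then show ?thesis
    unfolding coboundary_def by simp
qed

end
end

section \<open>Comparison with an injective resolution\<close>

context free_resolution
begin

lemma injective_resolutionD:
  assumes "injective_resolution S B E \<delta> \<epsilon>"
  shows "injective_module S (E i)" "Module.module S (E i)" "\<delta> i \<in> mod_hom S (E i) (E (Suc i))"
    "\<epsilon> \<in> mod_hom S B (E 0)" "inj_on \<epsilon> (carrier B)"
    "x \<in> carrier (E 0) \<Longrightarrow> \<delta> 0 x = \<zero>\<^bsub>E 1\<^esub> \<Longrightarrow> x \<in> \<epsilon> ` carrier B"
    "b \<in> carrier B \<Longrightarrow> \<delta> 0 (\<epsilon> b) = \<zero>\<^bsub>E 1\<^esub>"
    "x \<in> carrier (E (Suc i)) \<Longrightarrow> \<delta> (Suc i) x = \<zero>\<^bsub>E (Suc (Suc i))\<^esub> \<Longrightarrow> x \<in> \<delta> i ` carrier (E i)"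
    "y \<in> carrier (E i) \<Longrightarrow> \<delta> (Suc i) (\<delta> i y) = \<zero>\<^bsub>E (Suc (Suc i))\<^esub>"
proof -
  have inj: "\<forall>i. injective_module S (E i)" and hom: "\<forall>i. \<delta> i \<in> mod_hom S (E i) (E (Suc i))"
    and \<epsilon>: "\<epsilon> \<in> mod_hom S B (E 0)" "inj_on \<epsilon> (carrier B)"
    and k0: "mod_kernel (E 0) (E 1) (\<delta> 0) = \<epsilon> ` carrier B"
    and k: "\<forall>i. mod_kernel (E (Suc i)) (E (Suc (Suc i))) (\<delta> (Suc i)) = \<delta> i ` carrier (E i)"
    using assms by (simp_all add: injective_resolution_def)
  show "injective_module S (E i)" "\<delta> i \<in> mod_hom S (E i) (E (Suc i))"
    "\<epsilon> \<in> mod_hom S B (E 0)" "inj_on \<epsilon> (carrier B)"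
    using inj hom \<epsilon> by simp_all
  then show "Module.module S (E i)"
    by (simp add: injective_module_def)
  show "x \<in> carrier (E 0) \<Longrightarrow> \<delta> 0 x = \<zero>\<^bsub>E 1\<^esub> \<Longrightarrow> x \<in> \<epsilon> ` carrier B"
    unfolding k0[symmetric] by (simp add: mod_kernel_def)
  show "\<delta> 0 (\<epsilon> b) = \<zero>\<^bsub>E 1\<^esub>" if "b \<in> carrier B"
  proof -
    have "\<epsilon> b \<in> mod_kernel (E 0) (E 1) (\<delta> 0)"
      unfolding k0 using that by (rule imageI)
    then show ?thesis by (simp add: mod_kernel_def)
  qed
  show "x \<in> carrier (E (Suc i)) \<Longrightarrow> \<delta> (Suc i) x = \<zero>\<^bsub>E (Suc (Suc i))\<^esub> \<Longrightarrow> x \<in> \<delta> i ` carrier (E i)"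
    unfolding k[rule_format, symmetric] by (simp add: mod_kernel_def)
  show "\<delta> (Suc i) (\<delta> i y) = \<zero>\<^bsub>E (Suc (Suc i))\<^esub>" if "y \<in> carrier (E i)"
  proof -
    have "\<delta> i y \<in> mod_kernel (E (Suc i)) (E (Suc (Suc i))) (\<delta> (Suc i))"
      unfolding k[rule_format] using that by (rule imageI)
    then show ?thesis by (simp add: mod_kernel_def)
  qed
qed

context
  fixes E :: "nat \<Rightarrow> ('a, 'e) module" and \<delta> :: "nat \<Rightarrow> 'e \<Rightarrow> 'e" and \<epsilon> :: "'a \<Rightarrow> 'e" and s :: 'a and d :: nat
  assumes res: "injective_resolution S (set_module C) E \<delta> \<epsilon>"
    and s: "s \<in> C"
    and kill: "\<And>k \<phi>. k < d \<Longrightarrow> \<phi> \<in> mod_hom S F (set_module C) \<Longrightarrow>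
      (\<And>p. p \<in> carrier F \<Longrightarrow> \<phi> (diff (Suc k) p) = 0) \<Longrightarrow>
      \<exists>\<psi>\<in>mod_hom S F (set_module C). \<forall>p\<in>carrier F. s * \<phi> p = \<psi> (diff k p)"
begin

lemmas res' = injective_resolutionD[OF res]

lemma C_module: "Module.module S (set_module C)"
  using C_closed by (intro module_set_module[OF C]) auto

lemma vanish_on_cyc:
  assumes "u \<in> mod_hom S F N" "\<And>p. p \<in> cyc k \<Longrightarrow> u p = \<zero>\<^bsub>N\<^esub>" "p \<in> carrier F"
  shows "u (diff (Suc k) p) = \<zero>\<^bsub>N\<^esub>"
  using assms(2,3) image_diff_Suc[of k] by blast

text \<open>A staircase argument in the double complex \<open>Hom(F, E)\<close>. A homomorphism \<open>u\<close> to \<open>E l\<close> that is a cocycle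
  for \<open>\<delta>\<close> and vanishes on \<open>cyc k\<close> is lifted to \<open>E (l - 1)\<close> by exactness, and the composite of the
  lift with the next differential is again of this kind, with \<open>k\<close> larger and \<open>l\<close> smaller by one. At the
  bottom one arrives at a cocycle with values in \<open>C\<close>, whose multiple by \<open>s\<close> is a coboundary by
  assumption. On the way back up, the lift of \<open>s u\<close> is corrected at each stage so
  that it vanishes on \<open>cyc k\<close>.\<close>

lemma cocycle_descent:
  assumes "k + l < d" "u \<in> mod_hom S F (E l)"
    and "\<And>p. p \<in> carrier F \<Longrightarrow> \<delta> l (u p) = \<zero>\<^bsub>E (Suc l)\<^esub>"
    and "\<And>p. p \<in> cyc k \<Longrightarrow> u p = \<zero>\<^bsub>E l\<^esub>"
  shows "case l of
      0 \<Rightarrow> \<exists>\<psi>\<in>mod_hom S F (set_module C). \<forall>p\<in>carrier F. s \<odot>\<^bsub>E 0\<^esub> u p = \<epsilon> (\<psi> (diff k p))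
    | Suc l' \<Rightarrow> \<exists>t\<in>mod_hom S F (E l'). (\<forall>p\<in>carrier F. \<delta> l' (t p) = s \<odot>\<^bsub>E l\<^esub> u p) \<and>
        (\<forall>p\<in>cyc k. t p = \<zero>\<^bsub>E l'\<^esub>)"
  using assms
proof (induction l arbitrary: k u)
  case 0
  have "u p \<in> \<epsilon> ` carrier (set_module C)" if "p \<in> carrier F" for p
    using res'(6)[OF mod_homD(1)[OF 0(2) that]] 0(3)[OF that] by simp
  then obtain \<phi> where \<phi>: "\<phi> \<in> mod_hom S F (set_module C)" "\<And>p. p \<in> carrier F \<Longrightarrow> \<epsilon> (\<phi> p) = u p"
    using free_projective[OF 0(2) res'(4) C_module res'(2)] by blast
  have "\<phi> (diff (Suc k) p) = 0" if p: "p \<in> carrier F" for p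
  proof -
    have "\<epsilon> (\<phi> (diff (Suc k) p)) = \<epsilon> 0"
      using vanish_on_cyc[OF 0(2) 0(4) p] \<phi>(2)[OF diff_closed[OF p]] mod_hom_zero[OF res'(4) C_module res'(2)]
      by simp
    then show ?thesis
      using res'(5) mod_homD(1)[OF \<phi>(1) diff_closed[OF p]] C_closed(2) by (auto dest: inj_onD)
  qed
  then obtain \<psi> where \<psi>: "\<psi> \<in> mod_hom S F (set_module C)" "\<And>p. p \<in> carrier F \<Longrightarrow> s * \<phi> p = \<psi> (diff k p)"
    using kill[of k \<phi>] 0(1) \<phi>(1) by auto
  have "s \<odot>\<^bsub>E 0\<^esub> u p = \<epsilon> (\<psi> (diff k p))" if p: "p \<in> carrier F" for p
    using mod_homD(3)[OF res'(4), of s "\<phi> p"] s mod_homD(1)[OF \<phi>(1) p] \<phi>(2)[OF p] \<psi>(2)[OF p] by simp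
  then show ?case
    using \<psi>(1) by (simp del: free_module_simps(1)) blast
next
  case (Suc l)
  interpret El: Module.module S "E l" by (rule res'(2))
  have "u p \<in> \<delta> l ` carrier (E l)" if "p \<in> carrier F" for p
    using res'(8)[OF mod_homD(1)[OF Suc(3) that]] Suc(4)[OF that] by simp
  then obtain v where v: "v \<in> mod_hom S F (E l)" "\<And>p. p \<in> carrier F \<Longrightarrow> \<delta> l (v p) = u p"
    using free_projective[OF Suc(3) res'(3) res'(2) res'(2)] by blast
  define u1 where "u1 = (\<lambda>p. v (diff (Suc k) p))"
  have u1: "u1 \<in> mod_hom S F (E l)"
    unfolding u1_def by (rule mod_hom_comp[OF diff_hom v(1)])
  have u1_\<delta>: "\<delta> l (u1 p) = \<zero>\<^bsub>E (Suc l)\<^esub>" if p: "p \<in> carrier F" for p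
    unfolding u1_def using v(2)[OF diff_closed[OF p]] vanish_on_cyc[OF Suc(3) Suc(5) p] by simp
  have u1_cyc: "u1 p = \<zero>\<^bsub>E l\<^esub>" if "p \<in> cyc (Suc k)" for p
    unfolding u1_def using that mod_hom_zero[OF v(1) F_module res'(2)] by (simp add: cyc_iff)
  have sv: "(\<lambda>p. s \<odot>\<^bsub>E l\<^esub> v p) \<in> mod_hom S F (E l)"
    using s by (intro mod_hom_smult[OF v(1) res'(2)]) simp
  \<comment> \<open>It suffices to correct \<open>s v\<close> by a cocycle to make it vanish on \<open>cyc k\<close>.\<close>
  have finish: "\<exists>t\<in>mod_hom S F (E l). (\<forall>p\<in>carrier F. \<delta> l (t p) = s \<odot>\<^bsub>E (Suc l)\<^esub> u p) \<and> (\<forall>p\<in>cyc k. t p = \<zero>\<^bsub>E l\<^esub>)"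
    if w: "w \<in> mod_hom S F (E l)" and w\<delta>: "\<And>p. p \<in> carrier F \<Longrightarrow> \<delta> l (w p) = \<zero>\<^bsub>E (Suc l)\<^esub>"
      and wd: "\<And>p. p \<in> carrier F \<Longrightarrow> w (diff (Suc k) p) = s \<odot>\<^bsub>E l\<^esub> u1 p" for w
  proof -
    interpret Es: Module.module S "E (Suc l)" by (rule res'(2))
    let ?t = "\<lambda>p. s \<odot>\<^bsub>E l\<^esub> v p \<ominus>\<^bsub>E l\<^esub> w p"
    have t: "?t \<in> mod_hom S F (E l)"
      by (rule mod_hom_diff[OF sv w res'(2)])
    have "\<delta> l (?t p) = s \<odot>\<^bsub>E (Suc l)\<^esub> u p" if p: "p \<in> carrier F" for p
    proof -
      have "\<delta> l (?t p) = \<delta> l (s \<odot>\<^bsub>E l\<^esub> v p) \<ominus>\<^bsub>E (Suc l)\<^esub> \<delta> l (w p)"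
        by (rule mod_hom_minus[OF res'(3) res'(2) res'(2) mod_homD(1)[OF sv p] mod_homD(1)[OF w p]])
      also have "\<delta> l (s \<odot>\<^bsub>E l\<^esub> v p) = s \<odot>\<^bsub>E (Suc l)\<^esub> u p"
        using mod_homD(3)[OF res'(3), of s "v p"] mod_homD(1)[OF v(1) p] s v(2)[OF p] by simp
      finally show ?thesis
        using w\<delta>[OF p] mod_homD(1)[OF Suc(3) p] s by (simp add: Es.M.minus_eq)
    qed
    moreover have "?t p = \<zero>\<^bsub>E l\<^esub>" if p: "p \<in> cyc k" for p
    proof -
      obtain p' where p': "p' \<in> carrier F" "p = diff (Suc k) p'"
        using p image_diff_Suc[of k] by blast
      have "?t p = s \<odot>\<^bsub>E l\<^esub> u1 p' \<ominus>\<^bsub>E l\<^esub> s \<odot>\<^bsub>E l\<^esub> u1 p'"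
        using wd[OF p'(1)] unfolding u1_def p'(2) by simp
      then show ?thesis
        using mod_homD(1)[OF u1 p'(1)] s by (simp add: El.M.minus_eq El.M.r_neg)
    qed
    ultimately show ?thesis
      by (intro bexI[OF _ t] conjI ballI)
  qed
  have IH: "case l of
      0 \<Rightarrow> \<exists>\<psi>\<in>mod_hom S F (set_module C). \<forall>p\<in>carrier F. s \<odot>\<^bsub>E 0\<^esub> u1 p = \<epsilon> (\<psi> (diff (Suc k) p))
    | Suc l' \<Rightarrow> \<exists>t\<in>mod_hom S F (E l'). (\<forall>p\<in>carrier F. \<delta> l' (t p) = s \<odot>\<^bsub>E l\<^esub> u1 p) \<and>
        (\<forall>p\<in>cyc (Suc k). t p = \<zero>\<^bsub>E l'\<^esub>)"
    using Suc.prems(1) by (intro Suc.IH u1 u1_\<delta> u1_cyc) auto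
  show ?case
  proof (cases l)
    case 0
    then obtain \<psi> where \<psi>: "\<psi> \<in> mod_hom S F (set_module C)"
      "\<And>p. p \<in> carrier F \<Longrightarrow> s \<odot>\<^bsub>E 0\<^esub> u1 p = \<epsilon> (\<psi> (diff (Suc k) p))"
      using IH by (simp del: free_module_simps(1)) blast
    have "(\<lambda>p. \<epsilon> (\<psi> p)) \<in> mod_hom S F (E l)"
      unfolding 0 by (rule mod_hom_comp[OF \<psi>(1) res'(4)])
    moreover have "\<delta> l (\<epsilon> (\<psi> p)) = \<zero>\<^bsub>E (Suc l)\<^esub>" if "p \<in> carrier F" for p
      using res'(7)[OF mod_homD(1)[OF \<psi>(1) that]] 0 by simp
    ultimately show ?thesis
      using finish[of "\<lambda>p. \<epsilon> (\<psi> p)"] \<psi>(2) 0 by simp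
  next
    case (Suc l')
    then obtain t where t: "t \<in> mod_hom S F (E l')" "\<And>p. p \<in> carrier F \<Longrightarrow> \<delta> l' (t p) = s \<odot>\<^bsub>E l\<^esub> u1 p"
      "\<And>p. p \<in> cyc (Suc k) \<Longrightarrow> t p = \<zero>\<^bsub>E l'\<^esub>"
      using IH by (simp del: free_module_simps(1)) blast
    have "\<exists>w\<in>mod_hom S F (E l'). \<forall>p\<in>carrier F. t p = w (diff (Suc k) p)"
      using t(3) by (intro injective_factor[OF res'(1) t(1)]) (simp add: cyc_iff)
    then obtain w where w: "w \<in> mod_hom S F (E l')" "\<And>p. p \<in> carrier F \<Longrightarrow> t p = w (diff (Suc k) p)"
      by blast
    have "(\<lambda>p. \<delta> l' (w p)) \<in> mod_hom S F (E l)"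
      unfolding Suc by (rule mod_hom_comp[OF w(1) res'(3)])
    moreover have "\<delta> l (\<delta> l' (w p)) = \<zero>\<^bsub>E (Suc l)\<^esub>" if "p \<in> carrier F" for p
      using res'(9)[OF mod_homD(1)[OF w(1) that]] Suc by simp
    moreover have "\<delta> l' (w (diff (Suc k) p)) = s \<odot>\<^bsub>E l\<^esub> u1 p" if "p \<in> carrier F" for p
      using t(2)[OF that] w(2)[OF that] by simp
    ultimately show ?thesis
      using finish[of "\<lambda>p. \<delta> l' (w p)"] by simp
  qed
qed

text \<open>An element \<open>x\<close> annihilated by \<open>J\<close> is the value at the generator of a homomorphism from \<open>C / J\<close>, that
  is, of one on the free module that is zero on \<open>cyc 0\<close>; \<open>cocycle_descent\<close> applies to it.\<close>

theorem torsion_cocycle_killed: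
  assumes i: "i < d" and x: "x \<in> carrier (E i)" and Jx: "\<And>r. r \<in> J \<Longrightarrow> r \<odot>\<^bsub>E i\<^esub> x = \<zero>\<^bsub>E i\<^esub>"
    and \<delta>x: "\<delta> i x = \<zero>\<^bsub>E (Suc i)\<^esub>"
  shows "case i of 0 \<Rightarrow> s \<odot>\<^bsub>E i\<^esub> x = \<zero>\<^bsub>E i\<^esub>
    | Suc j \<Rightarrow> \<exists>y\<in>carrier (E j). (\<forall>r\<in>J. r \<odot>\<^bsub>E j\<^esub> y = \<zero>\<^bsub>E j\<^esub>) \<and> \<delta> j y = s \<odot>\<^bsub>E i\<^esub> x"
proof -
  interpret Ei: Module.module S "E i" by (rule res'(2))
  let ?e = "\<lambda>a. Poly_Mapping.single a 1 :: nat \<Rightarrow>\<^sub>0 'a"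
  define u where "u p = Poly_Mapping.lookup p 0 \<odot>\<^bsub>E i\<^esub> x" for p :: "nat \<Rightarrow>\<^sub>0 'a"
  have u: "u \<in> mod_hom S F (E i)"
  proof (rule mod_homI)
    show "u p \<in> carrier (E i)" if "p \<in> carrier F" for p
      unfolding u_def using that x by (intro Ei.smult_closed) auto
    show "u (p \<oplus>\<^bsub>F\<^esub> p') = u p \<oplus>\<^bsub>E i\<^esub> u p'" if "p \<in> carrier F" "p' \<in> carrier F" for p p'
      unfolding u_def using that x Ei.smult_l_distr[of "Poly_Mapping.lookup p 0" "Poly_Mapping.lookup p' 0" x]
      by (simp add: lookup_add)
    show "u (r \<odot>\<^bsub>F\<^esub> p) = r \<odot>\<^bsub>E i\<^esub> u p" if "r \<in> carrier S" "p \<in> carrier F" for r p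
      unfolding u_def using that x Ei.smult_assoc1[of r "Poly_Mapping.lookup p 0" x]
      by (simp add: lookup_scale)
  qed
  have "\<delta> i (u p) = \<zero>\<^bsub>E (Suc i)\<^esub>" if "p \<in> carrier F" for p
  proof -
    interpret Es: Module.module S "E (Suc i)" by (rule res'(2))
    show ?thesis
      unfolding u_def using mod_homD(3)[OF res'(3), of "Poly_Mapping.lookup p 0" x] that x \<delta>x
        Es.smult_r_null[of "Poly_Mapping.lookup p 0"] by simp
  qed
  moreover have "u p = \<zero>\<^bsub>E i\<^esub>" if "p \<in> cyc 0" for p
    unfolding u_def using that Jx by (simp add: cyc_def base_def)
  ultimately have *: "case i of
      0 \<Rightarrow> \<exists>\<psi>\<in>mod_hom S F (set_module C). \<forall>p\<in>carrier F. s \<odot>\<^bsub>E 0\<^esub> u p = \<epsilon> (\<psi> (diff 0 p))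
    | Suc l' \<Rightarrow> \<exists>t\<in>mod_hom S F (E l'). (\<forall>p\<in>carrier F. \<delta> l' (t p) = s \<odot>\<^bsub>E i\<^esub> u p) \<and>
        (\<forall>p\<in>cyc 0. t p = \<zero>\<^bsub>E l'\<^esub>)"
    using i by (intro cocycle_descent[OF _ u]) auto
  have e: "?e 0 \<in> carrier F"
    by (rule F_closed(4)[OF C_closed(1)])
  have ue: "u (?e 0) = x"
    unfolding u_def using Ei.smult_one[OF x] by simp
  show ?thesis
  proof (cases i)
    case 0
    then obtain \<psi> where \<psi>: "\<psi> \<in> mod_hom S F (set_module C)"
      "\<And>p. p \<in> carrier F \<Longrightarrow> s \<odot>\<^bsub>E 0\<^esub> u p = \<epsilon> (\<psi> (diff 0 p))"
      using * by (simp del: free_module_simps(1)) blast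
    have "s \<odot>\<^bsub>E 0\<^esub> x = \<epsilon> (\<psi> 0)"
      using \<psi>(2)[OF e] ue by simp
    also have "\<dots> = \<zero>\<^bsub>E 0\<^esub>"
      using mod_hom_zero[OF \<psi>(1) F_module C_module] mod_hom_zero[OF res'(4) C_module res'(2)] by simp
    finally show ?thesis using 0 by simp
  next
    case (Suc j)
    then obtain t where t: "t \<in> mod_hom S F (E j)" "\<And>p. p \<in> carrier F \<Longrightarrow> \<delta> j (t p) = s \<odot>\<^bsub>E i\<^esub> u p"
      "\<And>p. p \<in> cyc 0 \<Longrightarrow> t p = \<zero>\<^bsub>E j\<^esub>"
      using * by (simp del: free_module_simps(1)) blast
    have "r \<odot>\<^bsub>E j\<^esub> t (?e 0) = \<zero>\<^bsub>E j\<^esub>" if r: "r \<in> J" for r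
    proof -
      have rC: "r \<in> C" using r J_subset by blast
      have "scale r (?e 0) \<in> cyc 0"
        using F_closed(3)[OF rC e] r by (simp add: cyc_def base_def lookup_scale)
      then show ?thesis
        using t(3) mod_homD(3)[OF t(1) _ e, of r] rC by simp
    qed
    then show ?thesis
      using Suc t(2)[OF e] ue mod_homD(1)[OF t(1) e] by auto
  qed
qed

end
end

section \<open>Annihilators of local cohomology\<close>

lemma ideal_power_ideal:
  assumes "cring R" "ideal I R"
  shows "ideal (I [^]\<^bsub>ideals_set R\<^esub> (n::nat)) R"
proof -
  interpret cring R by fact
  interpret sr: semiring "ideals_set R" by (rule ideals_set_is_semiring)
  have "I [^]\<^bsub>ideals_set R\<^esub> n \<in> carrier (ideals_set R)"
    using assms(2) by (intro sr.nat_pow_closed) (simp add: ideals_set_def)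
  then show ?thesis by (simp add: ideals_set_def)
qed

lemma ideal_power_Suc:
  "I [^]\<^bsub>ideals_set R\<^esub> (Suc n) = (I [^]\<^bsub>ideals_set R\<^esub> n) \<cdot>\<^bsub>R\<^esub> I"
  by (simp add: ideals_set_def nat_pow_def)

lemma ideal_power_0: "I [^]\<^bsub>ideals_set R\<^esub> (0::nat) = carrier R"
  by (simp add: ideals_set_def nat_pow_def)

lemma ideal_power_antimono:
  assumes "cring R" "ideal I R" "m \<le> n"
  shows "I [^]\<^bsub>ideals_set R\<^esub> n \<subseteq> I [^]\<^bsub>ideals_set R\<^esub> (m::nat)"
  using \<open>m \<le> n\<close>
proof (induction n rule: dec_induct)
  case (step n)
  interpret cring R by fact
  have "I [^]\<^bsub>ideals_set R\<^esub> (Suc n) \<subseteq> I [^]\<^bsub>ideals_set R\<^esub> n"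
    using ideal_prod_inter[OF ideal_power_ideal[OF assms(1,2), of n] assms(2)] unfolding ideal_power_Suc by blast
  then show ?case using step.IH by blast
qed simp

lemma submodule_torsion:
  assumes R: "cring R" and I: "ideal I R" and M: "Module.module R M"
  shows "submodule (torsion R I M) R M"
proof (rule submodule_criterion[OF M])
  interpret M: Module.module R M by fact
  let ?P = "\<lambda>n. I [^]\<^bsub>ideals_set R\<^esub> (n::nat)"
  have PR: "r \<in> carrier R" if "r \<in> ?P n" for r n
    using ideal.Icarr[OF ideal_power_ideal[OF R I]] that .
  show "torsion R I M \<subseteq> carrier M" by (auto simp: torsion_def)
  show "\<zero>\<^bsub>M\<^esub> \<in> torsion R I M"
    using PR by (auto simp: torsion_def)
  show "x \<oplus>\<^bsub>M\<^esub> y \<in> torsion R I M" if xy: "x \<in> torsion R I M" "y \<in> torsion R I M" for x y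
  proof -
    obtain n m where n: "x \<in> carrier M" "\<And>r. r \<in> ?P n \<Longrightarrow> r \<odot>\<^bsub>M\<^esub> x = \<zero>\<^bsub>M\<^esub>"
      and m: "y \<in> carrier M" "\<And>r. r \<in> ?P m \<Longrightarrow> r \<odot>\<^bsub>M\<^esub> y = \<zero>\<^bsub>M\<^esub>"
      using xy unfolding torsion_def by blast
    have "r \<odot>\<^bsub>M\<^esub> (x \<oplus>\<^bsub>M\<^esub> y) = \<zero>\<^bsub>M\<^esub>" if r: "r \<in> ?P (max n m)" for r
    proof -
      have "r \<in> ?P n" "r \<in> ?P m"
        using r ideal_power_antimono[OF R I] max.cobounded1 max.cobounded2 by blast+
      then show ?thesis
        using M.smult_r_distr[OF PR[OF r] n(1) m(1)] n(2) m(2) by simp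
    qed
    then show ?thesis
      using n(1) m(1) unfolding torsion_def by blast
  qed
  show "s \<odot>\<^bsub>M\<^esub> x \<in> torsion R I M" if s: "s \<in> carrier R" and x: "x \<in> torsion R I M" for s x
  proof -
    obtain n where n: "x \<in> carrier M" "\<And>r. r \<in> ?P n \<Longrightarrow> r \<odot>\<^bsub>M\<^esub> x = \<zero>\<^bsub>M\<^esub>"
      using x unfolding torsion_def by blast
    have "r \<odot>\<^bsub>M\<^esub> (s \<odot>\<^bsub>M\<^esub> x) = \<zero>\<^bsub>M\<^esub>" if r: "r \<in> ?P n" for r
    proof -
      have "r \<odot>\<^bsub>M\<^esub> (s \<odot>\<^bsub>M\<^esub> x) = s \<odot>\<^bsub>M\<^esub> (r \<odot>\<^bsub>M\<^esub> x)"
        using M.smult_assoc1[OF PR[OF r] s n(1)] M.smult_assoc1[OF s PR[OF r] n(1)] M.R.m_comm[OF s PR[OF r]] by simp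
      then show ?thesis using n(2)[OF r] s by simp
    qed
    then show ?thesis
      using n(1) s unfolding torsion_def by blast
  qed
qed

lemma submodule_image:
  assumes h: "h \<in> mod_hom R M N" and M: "Module.module R M" and N: "Module.module R N" and H: "submodule H R M"
  shows "submodule (h ` H) R N"
proof (rule submodule_criterion[OF N])
  interpret M: Module.module R M by fact
  note H' = M.submoduleE[OF H]
  have sub: "x \<in> H \<Longrightarrow> x \<in> carrier M" for x using H'(1) by blast
  show "h ` H \<subseteq> carrier N" using mod_homD(1)[OF h] sub by blast
  show "\<zero>\<^bsub>N\<^esub> \<in> h ` H"
    using mod_hom_zero[OF h M N] subgroup.one_closed[OF submodule.axioms(1)[OF H]] by (metis image_eqI monoid.select_convs(2))
  show "x \<oplus>\<^bsub>N\<^esub> y \<in> h ` H" if xy: "x \<in> h ` H" "y \<in> h ` H" for x y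
  proof -
    obtain a b where "x = h a" "y = h b" "a \<in> H" "b \<in> H" using xy by blast
    then show ?thesis using mod_homD(2)[OF h, of a b] H'(5)[of a b] sub by (intro image_eqI[of _ _ "a \<oplus>\<^bsub>M\<^esub> b"]) auto
  qed
  show "r \<odot>\<^bsub>N\<^esub> x \<in> h ` H" if r: "r \<in> carrier R" and x: "x \<in> h ` H" for r x
  proof -
    obtain a where "x = h a" "a \<in> H" using x by blast
    then show ?thesis using mod_homD(3)[OF h r, of a] H'(4)[OF r, of a] sub by (intro image_eqI[of _ _ "r \<odot>\<^bsub>M\<^esub> a"]) auto
  qed
qed

text \<open>Every torsion element is annihilated by some power of \<open>I\<close>. The representing cosets are unfolded here
  once and for all, so that only elements of the resolution remain.\<close>

lemma annihilator_local_cohomologyI: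
  assumes R: "cring R" and I: "ideal I R" and E: "\<And>i. Module.module R (E i)"
    and \<delta>: "\<And>i. \<delta> i \<in> mod_hom R (E i) (E (Suc i))" and s: "s \<in> carrier R"
    and kill: "\<And>x n. x \<in> carrier (E i) \<Longrightarrow> \<delta> i x = \<zero>\<^bsub>E (Suc i)\<^esub> \<Longrightarrow>
      (\<And>r. r \<in> I [^]\<^bsub>ideals_set R\<^esub> n \<Longrightarrow> r \<odot>\<^bsub>E i\<^esub> x = \<zero>\<^bsub>E i\<^esub>) \<Longrightarrow>
      (case i of 0 \<Rightarrow> s \<odot>\<^bsub>E i\<^esub> x = \<zero>\<^bsub>E i\<^esub>
        | Suc j \<Rightarrow> \<exists>y\<in>carrier (E j). (\<forall>r\<in>I [^]\<^bsub>ideals_set R\<^esub> (n::nat). r \<odot>\<^bsub>E j\<^esub> y = \<zero>\<^bsub>E j\<^esub>) \<and> \<delta> j y = s \<odot>\<^bsub>E i\<^esub> x)"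
  shows "s \<in> annihilator R (local_cohomology R I E \<delta> i)"
proof -
  interpret M: Module.module R "E i" by (rule E)
  let ?N = "torsion_coboundaries R I E \<delta> i"
  have N: "submodule ?N R (E i)"
  proof (cases i)
    case 0
    have "submodule {\<zero>\<^bsub>E i\<^esub>} R (E i)"
      by (intro submodule_criterion[OF E]) auto
    then show ?thesis using 0 by (simp add: torsion_coboundaries_def)
  next
    case (Suc j)
    then show ?thesis
      using submodule_image[OF \<delta>[of j] E E submodule_torsion[OF R I E[of j]]]
      by (simp add: torsion_coboundaries_def)
  qed
  note N' = M.submoduleE[OF N]
  have coset: "(\<Union>n\<in>?N. {n \<oplus>\<^bsub>E i\<^esub> a}) = ?N" if a: "a \<in> ?N" for a
  proof (intro equalityI subsetI)
    fix n assume n: "n \<in> ?N"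
    have "n = (n \<oplus>\<^bsub>E i\<^esub> \<ominus>\<^bsub>E i\<^esub> a) \<oplus>\<^bsub>E i\<^esub> a"
      using n a N'(1) by (simp add: subset_iff M.M.a_assoc M.M.l_neg)
    moreover have "n \<oplus>\<^bsub>E i\<^esub> \<ominus>\<^bsub>E i\<^esub> a \<in> ?N"
      using n a N'(3,5) by blast
    ultimately show "n \<in> (\<Union>n\<in>?N. {n \<oplus>\<^bsub>E i\<^esub> a})" by blast
  qed (use a N'(5) in blast)
  have cob: "s \<odot>\<^bsub>E i\<^esub> x \<in> ?N" if x: "x \<in> torsion_cocycles R I E \<delta> i" for x
  proof -
    obtain n where n: "x \<in> carrier (E i)" "\<And>r. r \<in> I [^]\<^bsub>ideals_set R\<^esub> (n::nat) \<Longrightarrow> r \<odot>\<^bsub>E i\<^esub> x = \<zero>\<^bsub>E i\<^esub>"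
      "\<delta> i x = \<zero>\<^bsub>E (Suc i)\<^esub>"
      using x unfolding torsion_cocycles_def torsion_def by blast
    show ?thesis
    proof (cases i)
      case 0
      then show ?thesis
        using kill[OF n(1,3,2)] by (simp add: torsion_coboundaries_def)
    next
      case (Suc j)
      then obtain y where "y \<in> carrier (E j)" "\<forall>r\<in>I [^]\<^bsub>ideals_set R\<^esub> (n::nat). r \<odot>\<^bsub>E j\<^esub> y = \<zero>\<^bsub>E j\<^esub>" "\<delta> j y = s \<odot>\<^bsub>E i\<^esub> x"
        using kill[OF n(1,3,2)] by auto
      then have "y \<in> torsion R I (E j)" "s \<odot>\<^bsub>E i\<^esub> x = \<delta> j y"
        unfolding torsion_def by auto
      then show ?thesis
        using Suc by (simp add: torsion_coboundaries_def)
    qed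
  qed
  have "s \<odot>\<^bsub>local_cohomology R I E \<delta> i\<^esub> c = \<zero>\<^bsub>local_cohomology R I E \<delta> i\<^esub>"
    if c: "c \<in> carrier (local_cohomology R I E \<delta> i)" for c
  proof -
    obtain x where x: "x \<in> torsion_cocycles R I E \<delta> i" "c = (\<Union>n\<in>?N. {n \<oplus>\<^bsub>E i\<^esub> x})"
      using c by (auto simp: local_cohomology_def quotient_module_def A_RCOSETS_def' a_r_coset_def')
    have xE: "x \<in> carrier (E i)" using x(1) by (simp add: torsion_cocycles_def torsion_def)
    have "s \<odot>\<^bsub>E i\<^esub> y \<in> ?N" if y: "y \<in> c" for y
    proof -
      obtain n where n: "n \<in> ?N" "y = n \<oplus>\<^bsub>E i\<^esub> x" using y x(2) by blast
      then have "s \<odot>\<^bsub>E i\<^esub> y = s \<odot>\<^bsub>E i\<^esub> n \<oplus>\<^bsub>E i\<^esub> s \<odot>\<^bsub>E i\<^esub> x"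
        using M.smult_r_distr[OF s _ xE, of n] N'(1) by blast
      then show ?thesis
        using N'(5)[OF N'(4)[OF s n(1)] cob[OF x(1)]] by simp
    qed
    then have "(\<Union>n\<in>?N. {n \<oplus>\<^bsub>E i\<^esub> s \<odot>\<^bsub>E i\<^esub> y}) = ?N" if "y \<in> c" for y
      using coset that by blast
    moreover have "c \<noteq> {}" using x(2) N'(2) by blast
    ultimately have "(\<Union>y\<in>c. \<Union>n\<in>?N. {n \<oplus>\<^bsub>E i\<^esub> s \<odot>\<^bsub>E i\<^esub> y}) = ?N" by auto
    then show ?thesis
      by (simp add: local_cohomology_def quotient_module_def a_r_coset_def')
  qed
  then show ?thesis
    using s by (simp add: annihilator_def)
qed

section \<open>Regular sequences in rings of invariants\<close>

definition is_ring_hom :: "('a::comm_ring_1 \<Rightarrow> 'b::comm_ring_1) \<Rightarrow> bool" where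
  "is_ring_hom g \<longleftrightarrow> g 1 = 1 \<and> (\<forall>x y. g (x + y) = g x + g y) \<and> (\<forall>x y. g (x * y) = g x * g y)"

lemma is_ring_homD:
  assumes "is_ring_hom g"
  shows "g 1 = 1" "g 0 = 0" "g (x + y) = g x + g y" "g (x * y) = g x * g y" "g (- x) = - g x" "g (x - y) = g x - g y"
    "g (x ^ n) = g x ^ n"
proof -
  show 1: "g 1 = 1" and add: "g (x + y) = g x + g y" and m: "g (x * y) = g x * g y" for x y
    using assms by (auto simp: is_ring_hom_def)
  show 0: "g 0 = 0" using add[of 0 0] by simp
  show "g (- x) = - g x" using add[of x "- x"] 0 by (simp add: eq_neg_iff_add_eq_0 add.commute)
  show "g (x - y) = g x - g y" using add[of "x - y" y] by simp
  show "g (x ^ n) = g x ^ n" by (induction n) (auto simp: 1 m)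
qed

lemma ring_hom_sum: "is_ring_hom g \<Longrightarrow> g (\<Sum>i\<in>A. f i) = (\<Sum>i\<in>A. g (f i))"
  by (induction A rule: infinite_finite_induct) (auto simp: is_ring_homD)

lemma ring_hom_prod: "is_ring_hom g \<Longrightarrow> g (\<Prod>i\<in>A. f i) = (\<Prod>i\<in>A. g (f i))"
  by (induction A rule: infinite_finite_induct) (auto simp: is_ring_homD)

lemma ring_hom_comp: "is_ring_hom g \<Longrightarrow> is_ring_hom h \<Longrightarrow> is_ring_hom (\<lambda>x. g (h x))"
  by (auto simp: is_ring_hom_def)

lemma map_poly_ring_hom:
  assumes g: "is_ring_hom g"
  shows "is_ring_hom (map_poly g)"
proof -
  note [simp] = is_ring_homD[OF g]
  have add: "map_poly g (P + Q) = map_poly g P + map_poly g Q" for P Q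
    by (intro poly_eqI) (simp add: coeff_map_poly)
  have "map_poly g (P * Q) = map_poly g P * map_poly g Q" for P Q
    by (intro poly_eqI) (simp add: coeff_map_poly coeff_mult ring_hom_sum[OF g])
  moreover have "map_poly g 1 = 1"
    by (simp add: map_poly_1)
  ultimately show ?thesis using add by (simp add: is_ring_hom_def)
qed

lemma poly_map_poly_ring_hom: "is_ring_hom g \<Longrightarrow> poly (map_poly g P) (g x) = g (poly P x)"
  by (induction P) (auto simp: is_ring_homD map_poly_pCons)

lemma pcompose_ring_hom: "is_ring_hom (\<lambda>P. pcompose P Q)"
proof -
  have "pcompose 1 Q = 1"
    by (simp add: one_pCons pcompose_pCons)
  then show ?thesis
    by (simp add: is_ring_hom_def pcompose_add pcompose_mult)
qed

lemma monic_division: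
  fixes P Z :: "'a::comm_ring_1 poly"
  assumes "Polynomial.lead_coeff Z = 1" "Polynomial.degree Z > 0"
  shows "\<exists>Q R. P = Z * Q + R \<and> Polynomial.degree R < Polynomial.degree Z"
proof -
  obtain Q R where QR: "pseudo_divmod P Z = (Q, R)" by fastforce
  have "Z \<noteq> 0" using assms by auto
  from pseudo_divmod[OF this QR] assms
  have "P = Z * Q + R" "Polynomial.degree R < Polynomial.degree Z" by auto
  then show ?thesis by blast
qed

lemma monic_division_unique:
  fixes Z :: "'a::comm_ring_1 poly"
  assumes Z: "Polynomial.lead_coeff Z = 1"
    and eq: "Z * Q + R = Z * Q' + R'"
    and deg: "Polynomial.degree R < Polynomial.degree Z" "Polynomial.degree R' < Polynomial.degree Z"
  shows "Q = Q'" "R = R'"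
proof -
  show "Q = Q'"
  proof (rule ccontr)
    assume "Q \<noteq> Q'"
    let ?n = "Polynomial.degree Z + Polynomial.degree (Q - Q')"
    have "Polynomial.lead_coeff (Q - Q') = Polynomial.coeff (Z * (Q - Q')) ?n"
      by (simp only: coeff_mult_degree_sum Z mult_1_left)
    also have "Z * (Q - Q') = R' - R"
      using eq by (simp add: algebra_simps)
    also have "Polynomial.coeff (R' - R) ?n = 0"
      using deg by (simp add: coeff_eq_0)
    finally show False
      using \<open>Q \<noteq> Q'\<close> leading_coeff_neq_0[of "Q - Q'"] by simp
  qed
  then show "R = R'" using eq by simp
qed

text \<open>Over a ring with no further properties, remainders modulo a monic polynomial exist and are unique. The
  uniqueness is what makes them compatible with automorphisms.\<close>

definition monic_rem :: "'a::comm_ring_1 poly \<Rightarrow> 'a poly \<Rightarrow> 'a poly" where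
  "monic_rem P Z = (THE R. \<exists>Q. P = Z * Q + R \<and> Polynomial.degree R < Polynomial.degree Z)"

lemma monic_rem_eqI:
  assumes "Polynomial.lead_coeff Z = 1" "P = Z * Q + R" "Polynomial.degree R < Polynomial.degree Z"
  shows "monic_rem P Z = R"
  unfolding monic_rem_def
proof (rule the_equality)
  show "\<exists>Q. P = Z * Q + R \<and> Polynomial.degree R < Polynomial.degree Z"
    using assms by blast
next
  fix R' assume "\<exists>Q. P = Z * Q + R' \<and> Polynomial.degree R' < Polynomial.degree Z"
  then obtain Q' where "P = Z * Q' + R'" "Polynomial.degree R' < Polynomial.degree Z" by blast
  then show "R' = R" using monic_division_unique(2)[OF assms(1), of Q' R' Q R] assms by simp
qed

text \<open>A ring seen as a polynomial ring in \<open>x\<close> by means of a homomorphism \<open>\<Phi>\<close>, such that the elements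
  of \<open>W\<close> are constants.\<close>

locale polynomial_variable =
  fixes \<Phi> :: "'a::comm_ring_1 \<Rightarrow> 'a poly" and x :: 'a and W :: "'a set"
  assumes hom: "is_ring_hom \<Phi>" and eval: "poly (\<Phi> r) x = r" and var: "\<Phi> x = [:0, 1:]"
    and W: "finite W" "W \<noteq> {}" and const: "w \<in> W \<Longrightarrow> \<Phi> w = [:w:]"
begin

definition z :: 'a where "z = (\<Prod>w\<in>W. x + w)"

definition rest :: "'a \<Rightarrow> 'a" where "rest r = poly (monic_rem (\<Phi> r) (root_poly W)) x"

lemmas hom' = is_ring_homD[OF hom]

lemma monic: "Polynomial.lead_coeff (root_poly W) = 1" "Polynomial.degree (root_poly W) > 0"
  using W by (simp_all add: degree_root_poly coeff_root_poly_card card_gt_0_iff)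

lemma \<Phi>_z: "\<Phi> z = root_poly W"
  unfolding z_def root_poly_def ring_hom_prod[OF hom]
  by (intro prod.cong refl) (simp add: hom' var const)

lemma z_nonzero: "z \<noteq> 0"
  using \<Phi>_z monic(1) hom'(2) by auto

lemma division:
  obtains Q R where "\<Phi> r = root_poly W * Q + R" "Polynomial.degree R < Polynomial.degree (root_poly W)"
    "rest r = poly R x" "r = z * poly Q x + rest r"
proof -
  obtain Q R where QR: "\<Phi> r = root_poly W * Q + R" "Polynomial.degree R < Polynomial.degree (root_poly W)"
    using monic_division[OF monic] by blast
  then have R: "rest r = poly R x"
    unfolding rest_def using monic_rem_eqI[OF monic(1) QR] by simp
  have "r = poly (\<Phi> r) x" by (simp add: eval)
  also have "\<dots> = poly (\<Phi> z) x * poly Q x + rest r"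
    unfolding QR(1) R \<Phi>_z by simp
  finally have "r = z * poly Q x + rest r" by (simp add: eval)
  then show ?thesis using QR R that by blast
qed

lemma rest_eqI:
  assumes "\<Phi> r = root_poly W * Q + R" "Polynomial.degree R < Polynomial.degree (root_poly W)"
  shows "rest r = poly R x"
  unfolding rest_def using monic_rem_eqI[OF monic(1) assms] by simp

lemma rest_add: "rest (r + r') = rest r + rest r'"
proof -
  obtain Q R where 1: "\<Phi> r = root_poly W * Q + R" "Polynomial.degree R < Polynomial.degree (root_poly W)"
    "rest r = poly R x" using division by blast
  obtain Q' R' where 2: "\<Phi> r' = root_poly W * Q' + R'" "Polynomial.degree R' < Polynomial.degree (root_poly W)"
    "rest r' = poly R' x" using division by blast
  have "\<Phi> (r + r') = root_poly W * (Q + Q') + (R + R')"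
    by (simp add: hom' 1 2 algebra_simps)
  from rest_eqI[OF this degree_add_less[OF 1(2) 2(2)]] show ?thesis
    by (simp add: 1 2)
qed

lemma rest_z_mult: "rest (z * r) = 0"
  using rest_eqI[of "z * r" "\<Phi> r" 0] monic by (simp add: hom' \<Phi>_z)

lemma rest_const_mult:
  assumes "\<Phi> c = [:c:]"
  shows "rest (c * r) = c * rest r"
proof -
  obtain Q R where 1: "\<Phi> r = root_poly W * Q + R" "Polynomial.degree R < Polynomial.degree (root_poly W)"
    "rest r = poly R x" using division by blast
  have 2: "\<Phi> (c * r) = root_poly W * (Polynomial.smult c Q) + Polynomial.smult c R"
    by (simp add: hom' 1 assms algebra_simps smult_add_right)
  have 3: "Polynomial.degree (Polynomial.smult c R) < Polynomial.degree (root_poly W)"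
    using 1(2) degree_smult_le le_less_trans by blast
  show ?thesis using rest_eqI[OF 2 3] by (simp add: 1(3))
qed

text \<open>The automorphism \<open>g\<close> acts on polynomials by its action on coefficients followed by the translation
  \<open>X \<mapsto> X + w0\<close>. This preserves \<open>root_poly W\<close> and does not raise degrees, so it maps a division with
  remainder to another one.\<close>

lemma rest_equivariant:
  assumes g: "is_ring_hom g" and gW: "bij_betw g W W" and gx: "g x = x + w0" and w0: "w0 \<in> W"
    and W_add: "\<And>u v. u \<in> W \<Longrightarrow> v \<in> W \<Longrightarrow> u + v \<in> W"
    and \<Phi>g: "\<And>r. \<Phi> (g r) = pcompose (map_poly g (\<Phi> r)) [:w0, 1:]"
  shows "rest (g r) = g (rest r)" and "g z = z"
proof -
  let ?G = "\<lambda>P. pcompose (map_poly g P) [:w0, 1:]"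
  have G: "is_ring_hom ?G"
    by (rule ring_hom_comp[OF pcompose_ring_hom map_poly_ring_hom[OF g]])
  have bij: "bij_betw (\<lambda>w. g w + w0) W W"
  proof -
    have "inj_on (\<lambda>w. g w + w0) W"
      using gW by (auto simp: bij_betw_def inj_on_def)
    moreover have "(\<lambda>w. g w + w0) ` W \<subseteq> W"
      using gW w0 W_add by (auto simp: bij_betw_def)
    ultimately show ?thesis
      using W(1) endo_inj_surj[OF W(1)] by (simp add: bij_betw_def)
  qed
  have "?G (root_poly W) = (\<Prod>w\<in>W. [:g w + w0, 1:])"
    unfolding root_poly_def ring_hom_prod[OF G]
    by (intro prod.cong refl) (simp add: map_poly_pCons is_ring_homD[OF g] pcompose_pCons)
  also have "\<dots> = root_poly W"
    unfolding root_poly_def by (rule prod.reindex_bij_betw[OF bij])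
  finally have GZ: "?G (root_poly W) = root_poly W" .
  have "\<Phi> (g z) = \<Phi> z" unfolding \<Phi>g \<Phi>_z GZ ..
  then show "g z = z" by (metis eval)
  obtain Q R where 1: "\<Phi> r = root_poly W * Q + R" "Polynomial.degree R < Polynomial.degree (root_poly W)"
    "rest r = poly R x" using division by blast
  have "\<Phi> (g r) = root_poly W * ?G Q + ?G R"
    unfolding \<Phi>g 1(1) using is_ring_homD[OF G] GZ by simp
  moreover have "Polynomial.degree (?G R) < Polynomial.degree (root_poly W)"
  proof -
    have "Polynomial.degree (?G R) \<le> Polynomial.degree (map_poly g R) * Polynomial.degree [:w0, 1:]"
      by (rule degree_pcompose_le)
    also have "\<dots> \<le> Polynomial.degree R"
    proof -
      have "Polynomial.degree (map_poly g R) \<le> Polynomial.degree R"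
        by (rule degree_le) (simp add: coeff_map_poly is_ring_homD[OF g] coeff_eq_0)
      then show ?thesis by simp
    qed
    finally show ?thesis using 1(2) by simp
  qed
  ultimately have "rest (g r) = poly (?G R) x"
    by (rule rest_eqI)
  also have "\<dots> = poly (map_poly g R) (g x)"
    by (simp add: poly_pcompose gx add.commute)
  also have "\<dots> = g (rest r)"
    by (simp add: poly_map_poly_ring_hom[OF g] 1(3))
  finally show "rest (g r) = g (rest r)" .
qed

end

definition fixed_ring :: "('a \<Rightarrow> 'a) set \<Rightarrow> 'a::comm_ring_1 set" where
  "fixed_ring H = {r. \<forall>g\<in>H. g r = r}"

lemma fixed_ringD: "r \<in> fixed_ring H \<Longrightarrow> g \<in> H \<Longrightarrow> g r = r"
  unfolding fixed_ring_def by blast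

lemma is_subring_fixed_ring: "(\<And>g. g \<in> H \<Longrightarrow> is_ring_hom g) \<Longrightarrow> is_subring (fixed_ring H)"
proof -
  assume H: "\<And>g. g \<in> H \<Longrightarrow> is_ring_hom g"
  have "g (x - y) = x - y \<and> g (x * y) = x * y \<and> g 1 = 1"
    if "g \<in> H" "g x = x" "g y = y" for g x y
    using is_ring_homD[OF H[OF that(1)]] that by simp
  then show ?thesis
    by (auto simp: is_subring_def fixed_ring_def is_ring_homD(1)[OF H])
qed

text \<open>The elements \<open>x j\<close> are independent variables over a subring that contains \<open>W\<close>, and \<open>H\<close> moves each of
  them by elements of \<open>W\<close>. In the application \<open>W\<close> is a plane in the space of linear forms, the \<open>x j\<close> complete
  it to a system of coordinates, and \<open>u1\<close>, \<open>u2\<close> form a regular sequence in the polynomials on \<open>W\<close>.\<close>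

locale relative_polynomial_ring =
  fixes \<Phi> :: "nat \<Rightarrow> 'a::comm_ring_1 \<Rightarrow> 'a poly" and x :: "nat \<Rightarrow> 'a" and W :: "'a set" and m :: nat
    and H :: "('a \<Rightarrow> 'a) set" and u1 u2 :: 'a
  assumes variable: "j < m \<Longrightarrow> polynomial_variable (\<Phi> j) (x j) W"
    and others: "j < m \<Longrightarrow> k < m \<Longrightarrow> j \<noteq> k \<Longrightarrow> \<Phi> j (x k) = [:x k:]"
    and no_zero_div: "(a :: 'a) * b = 0 \<Longrightarrow> a = 0 \<or> b = 0"
    and H_hom: "g \<in> H \<Longrightarrow> is_ring_hom g" and H_W: "g \<in> H \<Longrightarrow> bij_betw g W W"
    and H_x: "g \<in> H \<Longrightarrow> j < m \<Longrightarrow> g (x j) - x j \<in> W"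
    and W_add: "w \<in> W \<Longrightarrow> w' \<in> W \<Longrightarrow> w + w' \<in> W"
    and \<Phi>_equivariant: "g \<in> H \<Longrightarrow> j < m \<Longrightarrow> \<Phi> j (g r) = pcompose (map_poly g (\<Phi> j r)) [:g (x j) - x j, 1:]"
    and u: "u1 \<in> fixed_ring H" "u2 \<in> fixed_ring H" "u1 \<noteq> 0"
    and u_const: "j < m \<Longrightarrow> \<Phi> j u1 = [:u1:]" "j < m \<Longrightarrow> \<Phi> j u2 = [:u2:]"
    and coprime: "u2 * a = u1 * b \<Longrightarrow> \<exists>c. a = u1 * c"
begin

text \<open>The norms of the variables, then \<open>u1\<close> in position \<open>m\<close> and \<open>u2\<close> in position \<open>m + 1\<close>.\<close>

definition zseq :: "nat \<Rightarrow> 'a" where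
  "zseq j = (if j < m then \<Prod>w\<in>W. x j + w else if j = m then u1 else u2)"

definition rest :: "nat \<Rightarrow> 'a \<Rightarrow> 'a" where
  "rest j = polynomial_variable.rest (\<Phi> j) (x j) W"

primrec rests :: "nat \<Rightarrow> 'a \<Rightarrow> 'a" where
  "rests 0 r = r"
| "rests (Suc j) r = rest j (rests j r)"

lemma zseq_eq: "j < m \<Longrightarrow> zseq j = polynomial_variable.z (x j) W"
  using polynomial_variable.z_def[OF variable] by (simp add: zseq_def)

lemma cancel: "(c :: 'a) \<noteq> 0 \<Longrightarrow> c * a = c * b \<Longrightarrow> a = b"
  using no_zero_div[of c "a - b"] by (simp add: right_diff_distrib)

lemma \<Phi>_zseq: "j < m \<Longrightarrow> k < m \<Longrightarrow> j \<noteq> k \<Longrightarrow> \<Phi> j (zseq k) = [:zseq k:]"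
proof -
  assume jk: "j < m" "k < m" "j \<noteq> k"
  interpret V: polynomial_variable "\<Phi> j" "x j" W by (rule variable[OF jk(1)])
  have const_hom: "is_ring_hom (\<lambda>a :: 'a. [:a:])"
    by (simp add: is_ring_hom_def pCons_one)
  have "\<Phi> j (zseq k) = (\<Prod>w\<in>W. [:x k + w:])"
    using jk by (simp add: zseq_def ring_hom_prod[OF V.hom] V.hom' others V.const cong: prod.cong)
  then show ?thesis
    using jk by (simp add: zseq_def ring_hom_prod[OF const_hom])
qed

lemma rests_add: "j \<le> m \<Longrightarrow> rests j (a + b) = rests j a + rests j b"
  by (induction j) (simp_all add: rest_def polynomial_variable.rest_add[OF variable])

lemma rests_const: "j \<le> m \<Longrightarrow> (\<And>i. i < j \<Longrightarrow> \<Phi> i c = [:c:]) \<Longrightarrow> rests j (c * a) = c * rests j a"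
  by (induction j) (simp_all add: rest_def polynomial_variable.rest_const_mult[OF variable])

text \<open>The remainder modulo \<open>zseq j\<close> is linear over the previous norms, as these do not involve the variable
  \<open>x j\<close>.\<close>

lemma rests_seq_ideal: "j \<le> m \<Longrightarrow> a \<in> seq_ideal (fixed_ring H) zseq j \<Longrightarrow> rests j a = 0"
proof (induction j arbitrary: a)
  case (Suc j)
  then obtain a' b where a: "a = a' + zseq j * b" "a' \<in> seq_ideal (fixed_ring H) zseq j" by auto
  interpret V: polynomial_variable "\<Phi> j" "x j" W using variable Suc.prems by simp
  have "rests j a = zseq j * rests j b"
    using Suc.prems Suc.IH[of a'] a \<Phi>_zseq by (simp add: rests_add rests_const)
  then show ?case
    using V.rest_z_mult Suc.prems by (simp add: rest_def zseq_eq)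
qed simp

lemma fixed_subring: "is_subring (fixed_ring H)"
  by (rule is_subring_fixed_ring[OF H_hom])

lemma zseq_fixed: "zseq j \<in> fixed_ring H"
proof (cases "j < m")
  case True
  interpret V: polynomial_variable "\<Phi> j" "x j" W using variable True by simp
  have "g (zseq j) = zseq j" if g: "g \<in> H" for g
    unfolding zseq_eq[OF True]
    by (rule V.rest_equivariant(2)[OF H_hom[OF g] H_W[OF g] _ H_x[OF g True] W_add \<Phi>_equivariant[OF g True]]) auto
  then show ?thesis by (simp add: fixed_ring_def)
qed (use u in \<open>auto simp: zseq_def\<close>)

text \<open>Divisibility of invariants by an invariant holds in the fixed ring as soon as it holds in the whole ring.\<close>

lemma fixed_cancel:
  assumes "c \<in> fixed_ring H" "c \<noteq> 0" "c * a \<in> fixed_ring H"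
  shows "a \<in> fixed_ring H"
proof -
  have "g a = a" if g: "g \<in> H" for g
  proof (rule cancel[OF assms(2)])
    have "c * g a = g (c * a)"
      by (simp add: is_ring_homD(4)[OF H_hom[OF g]] fixed_ringD[OF assms(1) g])
    then show "c * g a = c * a"
      by (simp add: fixed_ringD[OF assms(3) g])
  qed
  then show ?thesis by (simp add: fixed_ring_def)
qed

lemma rest_fixed:
  assumes j: "j < m" and a: "a \<in> fixed_ring H"
  shows "rest j a \<in> fixed_ring H" and "\<exists>b\<in>fixed_ring H. a - rest j a = zseq j * b"
proof -
  interpret V: polynomial_variable "\<Phi> j" "x j" W using variable j by simp
  have "g (rest j a) = rest j a" if g: "g \<in> H" for g
  proof -
    have "V.rest (g a) = g (V.rest a)"
      by (rule V.rest_equivariant(1)[OF H_hom[OF g] H_W[OF g] _ H_x[OF g j] W_add \<Phi>_equivariant[OF g j]]) auto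
    moreover have "g a = a" by (rule fixed_ringD[OF a g])
    ultimately show ?thesis unfolding rest_def by metis
  qed
  then show 1: "rest j a \<in> fixed_ring H" by (simp add: fixed_ring_def)
  obtain b where b: "a = zseq j * b + rest j a"
    using V.division[of a] zseq_eq[OF j] unfolding rest_def by metis
  then have eq: "a - rest j a = zseq j * b" by (metis add_diff_cancel_right')
  have "zseq j * b \<in> fixed_ring H"
    unfolding eq[symmetric] using fixed_subring a 1 by (simp add: is_subringD)
  then have "b \<in> fixed_ring H"
    by (rule fixed_cancel[OF zseq_fixed[of j], rotated]) (simp add: V.z_nonzero zseq_eq[OF j])
  then show "\<exists>b\<in>fixed_ring H. a - rest j a = zseq j * b" using eq by blast
qed

lemma rests_fixed:
  "j \<le> m \<Longrightarrow> a \<in> fixed_ring H \<Longrightarrow> rests j a \<in> fixed_ring H \<and> a - rests j a \<in> seq_ideal (fixed_ring H) zseq j"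
proof (induction j)
  case 0
  then show ?case by simp
next
  case (Suc j)
  then have IH: "rests j a \<in> fixed_ring H" "a - rests j a \<in> seq_ideal (fixed_ring H) zseq j" and j: "j < m" by auto
  obtain b where b: "b \<in> fixed_ring H" "rests j a - rest j (rests j a) = zseq j * b"
    using rest_fixed(2)[OF j IH(1)] by blast
  have "a - rests (Suc j) a = (a - rests j a) + zseq j * b"
    unfolding b(2)[symmetric] by simp
  then have "a - rests (Suc j) a \<in> seq_ideal (fixed_ring H) zseq (Suc j)"
    unfolding seq_ideal.simps mem_Collect_eq using IH(2) b(1) by blast
  then show ?case
    using rest_fixed(1)[OF j IH(1)] by simp
qed

lemma in_seq_ideal: "j \<le> m \<Longrightarrow> a \<in> fixed_ring H \<Longrightarrow> rests j a = 0 \<Longrightarrow> a \<in> seq_ideal (fixed_ring H) zseq j"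
  using rests_fixed[of j a] by simp

text \<open>By the preceding lemmas an invariant lies in the ideal of the first \<open>j \<le> m\<close> norms exactly when its
  iterated remainder is zero, and taking remainders commutes with multiplication by the next element of the
  sequence. So the norms and \<open>u1\<close> are regular because there are no zero divisors, and \<open>u2\<close> because
  it is coprime to \<open>u1\<close>; the cofactors are invariant by \<open>fixed_cancel\<close>.\<close>

theorem regular: "regular_seq (fixed_ring H) (m + 2) zseq"
  unfolding regular_seq_def
proof (intro allI impI conjI ballI)
  fix j a assume j: "j < m + 2" and a: "a \<in> fixed_ring H" and za: "zseq j * a \<in> seq_ideal (fixed_ring H) zseq j"
  consider "j < m" | "j = m" | "j = m + 1" using j by linarith
  then show "a \<in> seq_ideal (fixed_ring H) zseq j"
  proof cases
    case 1
    interpret V: polynomial_variable "\<Phi> j" "x j" W using variable 1 by simp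
    have "zseq j * rests j a = 0"
      using rests_seq_ideal[OF _ za] 1 \<Phi>_zseq by (simp add: rests_const)
    then have "rests j a = 0"
      using no_zero_div V.z_nonzero zseq_eq[OF 1] by auto
    then show ?thesis using in_seq_ideal a 1 by simp
  next
    case 2
    have "u1 * rests m a = 0"
      using rests_seq_ideal[OF _ za] 2 u_const by (simp add: rests_const zseq_def)
    then have "rests m a = 0"
      using no_zero_div u by auto
    then show ?thesis using in_seq_ideal a 2 by simp
  next
    case 3
    then obtain a' b where ab: "u2 * a = a' + u1 * b" "a' \<in> seq_ideal (fixed_ring H) zseq m" "b \<in> fixed_ring H"
      using za by (auto simp: zseq_def)
    have "rests m (u2 * a) = rests m a' + rests m (u1 * b)"
      unfolding ab(1) by (simp add: rests_add)
    then have "u2 * rests m a = u1 * rests m b"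
      using rests_seq_ideal[OF _ ab(2)] u_const by (simp add: rests_const)
    then obtain c where c: "rests m a = u1 * c" using coprime by blast
    have "c \<in> fixed_ring H"
      by (rule fixed_cancel[OF u(1,3)]) (use rests_fixed[of m a] a c in auto)
    moreover have "a = (a - rests m a) + zseq m * c"
      using c by (simp add: zseq_def)
    moreover have "a - rests m a \<in> seq_ideal (fixed_ring H) zseq m"
      using rests_fixed[of m a] a by simp
    ultimately have "a \<in> seq_ideal (fixed_ring H) zseq (Suc m)"
      unfolding seq_ideal.simps mem_Collect_eq by blast
    then show ?thesis using 3 by simp
  qed
qed (rule zseq_fixed)

end

section \<open>Transfer over orbits\<close>

text \<open>A set of functions rather than an abstract group with an action: fixed rings, stabilizers and
  orbit polynomials refer to the maps only.\<close>

definition automorphism_group :: "('a::comm_ring_1 \<Rightarrow> 'a) set \<Rightarrow> bool" where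
  "automorphism_group A \<longleftrightarrow> id \<in> A \<and> (\<forall>g\<in>A. is_ring_hom g) \<and> (\<forall>g\<in>A. \<forall>h\<in>A. g \<circ> h \<in> A) \<and>
    (\<forall>g\<in>A. \<exists>h\<in>A. g \<circ> h = id \<and> h \<circ> g = id)"

context free_resolution
begin

text \<open>A splitting is chosen at one representative of each orbit and moved along the orbit. That this
  depends only on the point, and not on the group element used, holds because the splitting at the
  representative is fixed by its stabilizer. The weighted sum of all the splittings is then invariant, that is, it
  takes values in \<open>C\<close>.\<close>

lemma orbit_transfer:
  fixes act :: "('a \<Rightarrow> 'a) \<Rightarrow> 'x \<Rightarrow> 'x" and c :: "'x \<Rightarrow> 'a"
  assumes A: "automorphism_group A" and CA: "C = fixed_ring A"
    and act_comp: "\<And>g h x. act (g \<circ> h) x = act g (act h x)" and act_id: "\<And>x. act id x = x"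
    and act_X: "\<And>g x. g \<in> A \<Longrightarrow> x \<in> Xs \<Longrightarrow> act g x \<in> Xs" and X: "finite Xs"
    and c_act: "\<And>g x. g \<in> A \<Longrightarrow> x \<in> Xs \<Longrightarrow> c (act g x) = g (c x)"
    and \<phi>: "\<phi> \<in> mod_hom S F (set_module C)"
    and split: "\<And>x. x \<in> Xs \<Longrightarrow> c x \<noteq> 0 \<Longrightarrow>
      \<exists>\<psi>\<in>mod_hom S F (set_module (fixed_ring {g \<in> A. act g x = x})). \<forall>p\<in>carrier F. \<phi> p = \<psi> (diff k p)"
  shows "\<exists>\<psi>\<in>mod_hom S F (set_module C). \<forall>p\<in>carrier F. (\<Sum>x\<in>Xs. c x) * \<phi> p = \<psi> (diff k p)"
proof -
  have hom: "is_ring_hom g" if "g \<in> A" for g using A that by (simp add: automorphism_group_def)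
  have comp: "g \<circ> h \<in> A" if "g \<in> A" "h \<in> A" for g h using A that by (simp add: automorphism_group_def)
  have idA: "id \<in> A" using A by (simp add: automorphism_group_def)
  have inverse: "\<exists>h\<in>A. g \<circ> h = id \<and> h \<circ> g = id" if "g \<in> A" for g
    using A that unfolding automorphism_group_def by blast
  have act_inv: "act h (act g x) = x" if "h \<circ> g = id" for g h x
    using act_comp[of h g x] act_id[of x] that by simp
  let ?X = "{x \<in> Xs. c x \<noteq> 0}"
  have act_X': "act g x \<in> ?X" if g: "g \<in> A" and x: "x \<in> ?X" for g x
  proof -
    obtain h where h: "h \<in> A" "h \<circ> g = id" using inverse[OF g] by blast
    have "h (g (c x)) = c x" using h(2) by (metis comp_apply id_apply)
    then have "g (c x) \<noteq> 0" using x is_ring_homD(2)[OF hom[OF h(1)]] by auto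
    then show ?thesis using act_X[OF g] c_act[OF g] x by simp
  qed
  define orb where "orb x = {y. \<exists>g\<in>A. y = act g x}" for x
  have orb_act: "orb (act h x) = orb x" if h: "h \<in> A" for h x
  proof -
    obtain h' where h': "h' \<in> A" "h' \<circ> h = id" using inverse[OF h] by blast
    show ?thesis
    proof (intro equalityI subsetI)
      fix y assume "y \<in> orb (act h x)"
      then obtain g where "g \<in> A" "y = act g (act h x)" by (auto simp: orb_def)
      then show "y \<in> orb x"
        unfolding orb_def using comp[OF _ h] by (auto simp flip: act_comp)
    next
      fix y assume "y \<in> orb x"
      then obtain g where g: "g \<in> A" "y = act g x" by (auto simp: orb_def)
      then have "y = act (g \<circ> h') (act h x)"
        by (simp add: act_comp act_inv[OF h'(2)])
      then show "y \<in> orb (act h x)"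
        unfolding orb_def using comp[OF g(1) h'(1)] by blast
    qed
  qed
  define rep where "rep x = (SOME y. y \<in> orb x)" for x
  have rep_act: "rep (act h x) = rep x" if "h \<in> A" for h x
    unfolding rep_def orb_act[OF that] ..
  have rep: "rep x \<in> orb x" for x
  proof -
    have "x \<in> orb x" unfolding orb_def using idA act_id[of x] by (metis (mono_tags, lifting) mem_Collect_eq)
    then show ?thesis unfolding rep_def by (rule someI)
  qed
  have "\<exists>g\<in>A. act g (rep x) = x" for x
  proof -
    obtain g where g: "g \<in> A" "rep x = act g x" using rep[of x] by (auto simp: orb_def)
    obtain h where "h \<in> A" "h \<circ> g = id" using inverse[OF g(1)] by blast
    then show ?thesis using act_inv g(2) by metis
  qed
  then obtain tr where tr: "\<And>x. tr x \<in> A" "\<And>x. act (tr x) (rep x) = x" by metis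
  have rep_X: "rep x \<in> ?X" if x: "x \<in> ?X" for x
    using rep[of x] act_X'[OF _ x] by (auto simp: orb_def)
  have "\<forall>x\<in>?X. \<exists>\<psi>. \<psi> \<in> mod_hom S F (set_module (fixed_ring {g \<in> A. act g x = x})) \<and>
      (\<forall>p\<in>carrier F. \<phi> p = \<psi> (diff k p))"
    using split by blast
  from bchoice[OF this] obtain \<psi> where
    *: "\<forall>x\<in>?X. \<psi> x \<in> mod_hom S F (set_module (fixed_ring {g \<in> A. act g x = x})) \<and>
      (\<forall>p\<in>carrier F. \<phi> p = \<psi> x (diff k p))" ..
  have \<psi>: "\<psi> x \<in> mod_hom S F (set_module (fixed_ring {g \<in> A. act g x = x}))"
    "p \<in> carrier F \<Longrightarrow> \<phi> p = \<psi> x (diff k p)" if "x \<in> ?X" for x p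
  proof -
    show "\<psi> x \<in> mod_hom S F (set_module (fixed_ring {g \<in> A. act g x = x}))"
      by (rule conjunct1[OF bspec[OF * that]])
    show "p \<in> carrier F \<Longrightarrow> \<phi> p = \<psi> x (diff k p)"
      by (rule bspec[OF conjunct2[OF bspec[OF * that]]])
  qed
  \<comment> \<open>\<open>\<phi>\<close> takes values in \<open>C\<close>, which is fixed by \<open>tr x\<close>; so \<open>\<theta> x\<close> still splits \<open>\<phi>\<close>.\<close>
  define \<theta> where "\<theta> x p = tr x (\<psi> (rep x) p)" for x p
  have equiv: "g (\<theta> x p) = \<theta> (act g x) p" if g: "g \<in> A" and x: "x \<in> ?X" and p: "p \<in> carrier F" for g x p
  proof -
    let ?y = "act g x" and ?v = "\<psi> (rep x) p"
    obtain h where h: "h \<in> A" "tr ?y \<circ> h = id" "h \<circ> tr ?y = id" using inverse[OF tr(1)] by blast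
    have stab: "act (h \<circ> (g \<circ> tr x)) (rep x) = rep x"
    proof -
      have "act (h \<circ> (g \<circ> tr x)) (rep x) = act h (act (tr ?y) (rep ?y))"
        by (simp add: act_comp tr(2))
      also have "\<dots> = rep ?y" by (rule act_inv[OF h(3)])
      finally show ?thesis by (simp add: rep_act[OF g])
    qed
    have "?v \<in> fixed_ring {g \<in> A. act g (rep x) = rep x}"
      using mod_homD(1)[OF \<psi>(1)[OF rep_X[OF x]] p] by simp
    then have "(h \<circ> (g \<circ> tr x)) ?v = ?v"
      by (rule fixed_ringD) (use stab comp[OF h(1) comp[OF g tr(1)[of x]]] in blast)
    then have "(tr ?y \<circ> h) (g (tr x ?v)) = tr ?y ?v" by simp
    then show ?thesis
      unfolding h(2) by (simp add: \<theta>_def rep_act[OF g])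
  qed
  have trC: "tr x a = a" if "a \<in> C" for x a
    using fixed_ringD[of a A "tr x"] that tr(1) CA by simp
  have \<theta>_diff: "\<theta> x (diff k p) = \<phi> p" if x: "x \<in> ?X" and p: "p \<in> carrier F" for x p
  proof -
    have "\<phi> p \<in> C" using mod_homD(1)[OF \<phi> p] by simp
    then show ?thesis
      unfolding \<theta>_def \<psi>(2)[OF rep_X[OF x] p, symmetric] by (rule trC)
  qed
  have \<theta>_add: "\<theta> x (p + p') = \<theta> x p + \<theta> x p'" if "x \<in> ?X" "p \<in> carrier F" "p' \<in> carrier F" for x p p'
    using mod_homD(2)[OF \<psi>(1)[OF rep_X[OF that(1)]] that(2,3)]
    by (simp add: \<theta>_def is_ring_homD[OF hom[OF tr(1)]])
  have \<theta>_scale: "\<theta> x (scale r p) = r * \<theta> x p" if "x \<in> ?X" "p \<in> carrier F" "r \<in> C" for x p r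
    using mod_homD(3)[OF \<psi>(1)[OF rep_X[OF that(1)]] _ that(2), of r] that(3) trC[OF that(3)]
    by (simp add: \<theta>_def is_ring_homD[OF hom[OF tr(1)]])
  define \<chi>' where "\<chi>' p = (\<Sum>x\<in>?X. c x * \<theta> x p)" for p
  have "\<chi>' \<in> mod_hom S F (set_module C)"
  proof (rule mod_homI)
    fix p assume p: "p \<in> carrier F"
    have "g (\<chi>' p) = \<chi>' p" if g: "g \<in> A" for g
    proof -
      obtain h where h: "h \<in> A" "g \<circ> h = id" "h \<circ> g = id" using inverse[OF g] by blast
      have bij: "bij_betw (act g) ?X ?X"
        by (rule bij_betwI[where g = "act h"]) (use act_X' g h act_inv in auto)
      have "g (\<chi>' p) = (\<Sum>x\<in>?X. g (c x) * g (\<theta> x p))"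
        by (simp add: \<chi>'_def ring_hom_sum[OF hom[OF g]] is_ring_homD[OF hom[OF g]])
      also have "\<dots> = (\<Sum>x\<in>?X. c (act g x) * \<theta> (act g x) p)"
        using c_act[OF g] equiv[OF g _ p] by (intro sum.cong refl) auto
      also have "\<dots> = \<chi>' p"
        unfolding \<chi>'_def by (rule sum.reindex_bij_betw[OF bij])
      finally show ?thesis .
    qed
    then show "\<chi>' p \<in> carrier (set_module C)"
      unfolding CA by (simp add: fixed_ring_def)
    show "\<chi>' (p \<oplus>\<^bsub>F\<^esub> p') = \<chi>' p \<oplus>\<^bsub>set_module C\<^esub> \<chi>' p'" if p': "p' \<in> carrier F" for p'
      unfolding \<chi>'_def using \<theta>_add[OF _ p p'] by (simp add: distrib_left sum.distrib)
    show "\<chi>' (r \<odot>\<^bsub>F\<^esub> p) = r \<odot>\<^bsub>set_module C\<^esub> \<chi>' p" if r: "r \<in> carrier S" for r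
      unfolding \<chi>'_def using \<theta>_scale[OF _ p, of _ r] r by (simp add: sum_distrib_left mult.left_commute)
  qed
  moreover have "(\<Sum>x\<in>Xs. c x) * \<phi> p = \<chi>' (diff k p)" if p: "p \<in> carrier F" for p
  proof -
    have "(\<Sum>x\<in>Xs. c x) = (\<Sum>x\<in>?X. c x)"
      using X by (intro sum.mono_neutral_right) auto
    then show ?thesis
      unfolding \<chi>'_def using \<theta>_diff[OF _ p] by (simp add: sum_distrib_right)
  qed
  ultimately show ?thesis by (intro bexI[where x = \<chi>'] ballI)
qed

end

section \<open>Polynomial rings and the action of the linear group\<close>

definition eval_mpoly :: "('k \<Rightarrow> 'b) \<Rightarrow> ('n \<Rightarrow> 'b) \<Rightarrow> ('k::field, 'n::finite) mpoly \<Rightarrow> 'b::comm_ring_1" where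
  "eval_mpoly h \<sigma> f = (\<Sum>u\<in>Poly_Mapping.keys f. h (Poly_Mapping.lookup f u) * (\<Prod>i\<in>UNIV. \<sigma> i ^ Poly_Mapping.lookup u i))"

lemma poly_mapping_eq_sum: "f = (\<Sum>u\<in>Poly_Mapping.keys f. Poly_Mapping.single u (Poly_Mapping.lookup f u))"
  by (rule poly_mapping_eqI) (auto simp: lookup_sum lookup_single when_def in_keys_iff)

lemma mpoly_induct [case_names zero add_single]:
  assumes "P 0" "\<And>f u c. P f \<Longrightarrow> P (f + Poly_Mapping.single u c)"
  shows "P f"
  by (induction f rule: update_induct) (auto simp: assms update_eq_add_single)

context
  fixes h :: "'k::field \<Rightarrow> 'b::comm_ring_1" and \<sigma> :: "'n::finite \<Rightarrow> 'b"
  assumes h: "is_ring_hom h"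
begin

lemma eval_add: "eval_mpoly h \<sigma> (f + g) = eval_mpoly h \<sigma> f + eval_mpoly h \<sigma> g"
  unfolding eval_mpoly_def
  by (rule setsum_keys_plus_distrib) (auto simp: is_ring_homD[OF h] distrib_right)

lemma eval_single: "eval_mpoly h \<sigma> (Poly_Mapping.single u c) = h c * (\<Prod>i\<in>UNIV. \<sigma> i ^ Poly_Mapping.lookup u i)"
  by (cases "c = 0") (auto simp: eval_mpoly_def is_ring_homD[OF h])

lemma eval_zero: "eval_mpoly h \<sigma> 0 = 0"
  by (simp add: eval_mpoly_def)

lemma eval_mult_single: "eval_mpoly h \<sigma> (f * Poly_Mapping.single v c) = eval_mpoly h \<sigma> f * eval_mpoly h \<sigma> (Poly_Mapping.single v c)"
proof (induction f rule: mpoly_induct)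
  case zero
  show ?case by (simp add: eval_zero)
next
  case (add_single f u a)
  have "eval_mpoly h \<sigma> (Poly_Mapping.single u a * Poly_Mapping.single v c) =
      eval_mpoly h \<sigma> (Poly_Mapping.single u a) * eval_mpoly h \<sigma> (Poly_Mapping.single v c)"
    by (simp add: mult_single eval_single lookup_add power_add prod.distrib is_ring_homD[OF h] mult_ac)
  then show ?case
    using add_single by (simp add: distrib_right eval_add)
qed

lemma is_ring_hom_eval: "is_ring_hom (eval_mpoly h \<sigma>)"
proof -
  have "eval_mpoly h \<sigma> (f * g) = eval_mpoly h \<sigma> f * eval_mpoly h \<sigma> g" for f g
  proof (induction g rule: mpoly_induct)
    case zero
    show ?case by (simp add: eval_zero)
  next
    case (add_single g u a)
    then show ?case by (simp add: distrib_left eval_add eval_mult_single)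
  qed
  moreover have "eval_mpoly h \<sigma> 1 = 1"
    using eval_single[of 0 1] by (simp add: is_ring_homD[OF h] single_one)
  ultimately show ?thesis
    by (simp add: is_ring_hom_def eval_add)
qed

lemma eval_const: "eval_mpoly h \<sigma> (const_poly c) = h c"
  by (simp add: const_poly_def eval_single)

lemma eval_var: "eval_mpoly h \<sigma> (var i) = \<sigma> i"
proof -
  have "(\<Prod>j\<in>UNIV. \<sigma> j ^ Poly_Mapping.lookup (Poly_Mapping.single i 1) j) = (\<Prod>j\<in>UNIV. if j = i then \<sigma> i else 1)"
    by (intro prod.cong refl) (auto simp: lookup_single when_def)
  then show ?thesis
    by (simp add: var_def eval_single is_ring_homD[OF h] prod.delta)
qed

end

lemma const_poly_hom: "is_ring_hom (const_poly :: 'k::field \<Rightarrow> ('k, 'n) mpoly)"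
  by (simp add: is_ring_hom_def const_poly_def single_add mult_single single_one)

lemma var_power: "var i ^ n = Poly_Mapping.single (Poly_Mapping.single i n) (1 :: 'k::field)"
  by (induction n) (auto simp: var_def mult_single single_one simp flip: single_add)

lemma prod_single: "finite A \<Longrightarrow>
  (\<Prod>i\<in>A. Poly_Mapping.single (v i) (1 :: 'k::field)) = Poly_Mapping.single (\<Sum>i\<in>A. v i) 1"
  by (induction A rule: finite_induct) (auto simp: mult_single single_one)

lemma single_eq_monomial:
  fixes u :: "'n::finite \<Rightarrow>\<^sub>0 nat"
  shows "Poly_Mapping.single u c = const_poly c * (\<Prod>i\<in>UNIV. var i ^ Poly_Mapping.lookup u i)"
proof -
  have "(\<Sum>i\<in>UNIV. Poly_Mapping.single i (Poly_Mapping.lookup u i)) = u"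
    by (rule poly_mapping_eqI) (simp add: lookup_sum lookup_single when_def)
  then show ?thesis
    by (simp add: var_power prod_single const_poly_def mult_single)
qed

lemma ring_hom_eq_eval:
  fixes g :: "('k::field, 'n::finite) mpoly \<Rightarrow> 'b::comm_ring_1"
  assumes g: "is_ring_hom g"
  shows "g f = eval_mpoly (\<lambda>c. g (const_poly c)) (\<lambda>i. g (var i)) f"
proof -
  have "g f = (\<Sum>u\<in>Poly_Mapping.keys f. g (Poly_Mapping.single u (Poly_Mapping.lookup f u)))"
    by (subst poly_mapping_eq_sum[of f]) (rule ring_hom_sum[OF g])
  also have "\<dots> = eval_mpoly (\<lambda>c. g (const_poly c)) (\<lambda>i. g (var i)) f"
    unfolding eval_mpoly_def single_eq_monomial by (simp add: is_ring_homD[OF g] ring_hom_prod[OF g])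
  finally show ?thesis .
qed

lemma mpoly_hom_ext:
  fixes g g' :: "('k::field, 'n::finite) mpoly \<Rightarrow> 'b::comm_ring_1"
  assumes "is_ring_hom g" "is_ring_hom g'"
    and "\<And>c. g (const_poly c) = g' (const_poly c)" "\<And>i. g (var i) = g' (var i)"
  shows "g f = g' f"
  using ring_hom_eq_eval[OF assms(1), of f] ring_hom_eq_eval[OF assms(2), of f] assms(3,4) by simp

text \<open>Number the variables. Polynomials in variables indexed by natural numbers have no zero divisors, because
  their monomials can be ordered.\<close>

lemma mpoly_no_zero_divisors:
  fixes f g :: "('k::field, 'n::finite) mpoly"
  assumes "f * g = 0"
  shows "f = 0 \<or> g = 0"
proof -
  define h :: "'k \<Rightarrow> (nat \<Rightarrow>\<^sub>0 nat) \<Rightarrow>\<^sub>0 'k" where "h = Poly_Mapping.single 0"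
  define \<sigma> :: "'n \<Rightarrow> (nat \<Rightarrow>\<^sub>0 nat) \<Rightarrow>\<^sub>0 'k" where "\<sigma> i = Poly_Mapping.single (Poly_Mapping.single (to_nat i) 1) 1" for i
  have h: "is_ring_hom h"
    by (simp add: is_ring_hom_def h_def single_add mult_single single_one)
  have pow: "\<sigma> i ^ n = Poly_Mapping.single (Poly_Mapping.single (to_nat i) n) 1" for i n
    by (induction n) (auto simp: \<sigma>_def mult_single single_one simp flip: single_add)
  define emb :: "('n \<Rightarrow>\<^sub>0 nat) \<Rightarrow> nat \<Rightarrow>\<^sub>0 nat" where
    "emb u = (\<Sum>i\<in>UNIV. Poly_Mapping.single (to_nat i) (Poly_Mapping.lookup u i))" for u
  have "Poly_Mapping.lookup (emb u) (to_nat i) = Poly_Mapping.lookup u i" for u i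
    by (simp add: emb_def lookup_sum lookup_single when_def)
  then have emb_inj: "emb u = emb v \<longleftrightarrow> u = v" for u v
    by (metis poly_mapping_eqI)
  have lookup: "Poly_Mapping.lookup (eval_mpoly h \<sigma> f) (emb u) = Poly_Mapping.lookup f u" for f u
  proof (induction f rule: mpoly_induct)
    case zero
    show ?case by (simp add: eval_mpoly_def)
  next
    case (add_single f v c)
    have "eval_mpoly h \<sigma> (Poly_Mapping.single v c) = Poly_Mapping.single (emb v) c"
      by (simp add: eval_single[OF h] pow prod_single emb_def) (simp add: h_def mult_single)
    then show ?case
      using add_single by (simp add: eval_add[OF h] lookup_add lookup_single when_def emb_inj)
  qed
  have zero: "p = 0" if "eval_mpoly h \<sigma> p = 0" for p
    by (rule poly_mapping_eqI) (metis lookup lookup_zero that)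
  have "eval_mpoly h \<sigma> f * eval_mpoly h \<sigma> g = 0"
    using assms is_ring_homD(2,4)[OF is_ring_hom_eval[OF h]] by metis
  then show ?thesis using zero by auto
qed

lemma countable_mpoly: "countable (UNIV :: ('k::{field,finite}, 'n::finite) mpoly set)"
  by (intro countable_poly_mapping) (auto intro: countable_finite)

lemma infinite_mpoly: "infinite (UNIV :: ('k::field, 'n::finite) mpoly set)"
proof -
  have "inj (\<lambda>n. Poly_Mapping.single (Poly_Mapping.single (undefined :: 'n) n) (1 :: 'k))"
  proof (rule injI)
    fix m n
    assume "Poly_Mapping.single (Poly_Mapping.single (undefined :: 'n) m) (1 :: 'k) =
      Poly_Mapping.single (Poly_Mapping.single (undefined :: 'n) n) 1"
    then have "Poly_Mapping.keys (Poly_Mapping.single (Poly_Mapping.single (undefined :: 'n) m) (1 :: 'k)) =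
      Poly_Mapping.keys (Poly_Mapping.single (Poly_Mapping.single (undefined :: 'n) n) (1 :: 'k))"
      by (rule arg_cong)
    then have "Poly_Mapping.single (undefined :: 'n) m = Poly_Mapping.single undefined n"
      by simp
    then show "m = n"
      by (metis lookup_single_eq)
  qed
  then show ?thesis
    using finite_imageD[of _ UNIV] infinite_UNIV_nat finite_subset[OF subset_UNIV] by blast
qed

lemma linear_form_add: "linear_form (a + b) = linear_form a + linear_form b"
  by (simp add: linear_form_def is_ring_homD[OF const_poly_hom] distrib_right sum.distrib)

lemma linear_form_scale: "linear_form (c *s a) = const_poly c * linear_form a"
  by (simp add: linear_form_def is_ring_homD[OF const_poly_hom] sum_distrib_left mult.assoc)

lemma linear_form_zero: "linear_form 0 = 0"
  using linear_form_add[of 0 0] by simp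

lemma linear_form_sum: "linear_form (\<Sum>i\<in>A. f i) = (\<Sum>i\<in>A. linear_form (f i))"
  by (induction A rule: infinite_finite_induct) (auto simp: linear_form_zero linear_form_add)

lemma lookup_linear_form: "Poly_Mapping.lookup (linear_form a) (Poly_Mapping.single i 1) = a $ i"
proof -
  have "const_poly (a $ j) * var j = Poly_Mapping.single (Poly_Mapping.single j 1) (a $ j)" for j
    by (simp add: const_poly_def var_def mult_single)
  moreover have "Poly_Mapping.single j (1::nat) = Poly_Mapping.single i 1 \<longleftrightarrow> j = i" for j
    by (metis lookup_single_eq lookup_single_not_eq zero_neq_one)
  ultimately show ?thesis
    by (simp add: linear_form_def lookup_sum lookup_single when_def)
qed

lemma inj_linear_form: "inj linear_form"
  by (rule injI) (metis lookup_linear_form vec_eq_iff)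

lemma linear_form_axis: "linear_form (axis i 1 :: 'k::field ^ 'n::finite) = var i"
proof -
  have "linear_form (axis i 1 :: 'k ^ 'n) = (\<Sum>j\<in>UNIV. if j = i then var i else 0)"
    unfolding linear_form_def
    by (intro sum.cong refl) (auto simp: axis_def is_ring_homD[OF const_poly_hom])
  then show ?thesis by simp
qed

lemma hom_linear_form:
  assumes "is_ring_hom g"
  shows "g (linear_form a) = (\<Sum>i\<in>UNIV. g (const_poly (a $ i)) * g (var i))"
  by (simp add: linear_form_def ring_hom_sum[OF assms] is_ring_homD[OF assms])

lemma substitute_eq_eval: "substitute \<sigma> = eval_mpoly const_poly \<sigma>"
  by (rule ext) (simp add: substitute_def eval_mpoly_def)

lemma gl_action_hom: "is_ring_hom (gl_action g)"
  unfolding gl_action_def substitute_eq_eval by (rule is_ring_hom_eval[OF const_poly_hom])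

lemma gl_action_const: "gl_action g (const_poly c) = const_poly c"
  unfolding gl_action_def substitute_eq_eval by (rule eval_const[OF const_poly_hom])

lemma gl_action_var: "gl_action g (var i) = linear_form (matrix_inv g $ i)"
  unfolding gl_action_def substitute_eq_eval by (rule eval_var[OF const_poly_hom])

lemma gl_action_linear_form: "gl_action g (linear_form a) = linear_form (\<Sum>i\<in>UNIV. a $ i *s (matrix_inv g $ i))"
  by (simp add: hom_linear_form[OF gl_action_hom] gl_action_const gl_action_var linear_form_sum linear_form_scale)

lemma matrix_inv_both:
  fixes g :: "'k::field ^ 'n::finite ^ 'n"
  assumes "invertible g"
  shows "g ** matrix_inv g = mat 1" "matrix_inv g ** g = mat 1"
  using someI_ex[OF assms[unfolded invertible_def]] unfolding matrix_inv_def by blast+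

lemma matrix_inv_eqI:
  fixes g :: "'k::field ^ 'n::finite ^ 'n"
  assumes "g ** h = mat 1"
  shows "matrix_inv g = h" "invertible g"
proof -
  have "h ** g = mat 1" using assms matrix_left_right_inverse by blast
  with assms show g: "invertible g" unfolding invertible_def by blast
  have "matrix_inv g = matrix_inv g ** (g ** h)" using assms by (simp add: matrix_mul_rid)
  also have "\<dots> = h" by (simp add: matrix_mul_assoc matrix_inv_both(2)[OF g] matrix_mul_lid)
  finally show "matrix_inv g = h" .
qed

lemma matrix_inv_mult_both:
  fixes g h :: "'k::field ^ 'n::finite ^ 'n"
  assumes "invertible g" "invertible h"
  shows "matrix_inv (g ** h) = matrix_inv h ** matrix_inv g"
proof (rule matrix_inv_eqI(1))
  have "(g ** h) ** (matrix_inv h ** matrix_inv g) = g ** ((h ** matrix_inv h) ** matrix_inv g)"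
    by (simp add: matrix_mul_assoc)
  then show "(g ** h) ** (matrix_inv h ** matrix_inv g) = mat 1"
    by (simp add: matrix_inv_both assms matrix_mul_lid)
qed

lemma gl_action_comp:
  assumes "invertible g" "invertible h"
  shows "gl_action g (gl_action h f) = gl_action (g ** h) f"
proof (rule mpoly_hom_ext[of "\<lambda>f. gl_action g (gl_action h f)"])
  show "is_ring_hom (\<lambda>f. gl_action g (gl_action h f))"
    by (rule ring_hom_comp[OF gl_action_hom gl_action_hom])
  show "gl_action g (gl_action h (var i)) = gl_action (g ** h) (var i)" for i
  proof -
    have "(\<Sum>j\<in>UNIV. matrix_inv h $ i $ j *s (matrix_inv g $ j)) = (matrix_inv h ** matrix_inv g) $ i"
      by (simp add: vec_eq_iff matrix_matrix_mult_def)
    then show ?thesis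
      by (simp add: gl_action_var gl_action_linear_form matrix_inv_mult_both assms)
  qed
qed (simp_all add: gl_action_hom gl_action_const)

lemma gl_action_one: "gl_action (mat 1 :: 'k::field ^ 'n::finite ^ 'n) f = f"
proof (rule mpoly_hom_ext)
  have "matrix_inv (mat 1) = (mat 1 :: 'k ^ 'n ^ 'n)"
    by (rule matrix_inv_eqI(1)) (simp add: matrix_mul_lid)
  moreover have "(mat 1 :: 'k ^ 'n ^ 'n) $ i = axis i 1" for i
    by (auto simp: vec_eq_iff mat_def axis_def)
  ultimately show "gl_action (mat 1 :: 'k ^ 'n ^ 'n) (var i) = var i" for i
    by (simp add: gl_action_var linear_form_axis)
  show "is_ring_hom (\<lambda>f :: ('k, 'n) mpoly. f)" by (simp add: is_ring_hom_def)
qed (simp_all add: gl_action_hom gl_action_const)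

section \<open>Homogeneity and integrality\<close>

lemma homogeneous_zero: "homogeneous m 0"
  by (simp add: homogeneous_def)

lemma homogeneous_add:
  assumes "homogeneous m f" "homogeneous m g"
  shows "homogeneous m (f + g)"
proof -
  have "Poly_Mapping.keys (f + g) \<subseteq> Poly_Mapping.keys f \<union> Poly_Mapping.keys g"
    by (rule Poly_Mapping.keys_add)
  then show ?thesis using assms unfolding homogeneous_def by blast
qed

lemma homogeneous_uminus: "homogeneous m f \<Longrightarrow> homogeneous m (- f)"
  by (simp add: homogeneous_def in_keys_iff)

lemma homogeneous_sum: "(\<And>i. i \<in> A \<Longrightarrow> homogeneous m (f i)) \<Longrightarrow> homogeneous m (\<Sum>i\<in>A. f i)"
  by (induction A rule: infinite_finite_induct) (auto intro: homogeneous_add homogeneous_zero)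

lemma homogeneous_mult:
  assumes "homogeneous m f" "homogeneous n g"
  shows "homogeneous (m + n) (f * g)"
  unfolding homogeneous_def
proof
  fix u assume "u \<in> Poly_Mapping.keys (f * g)"
  then obtain a b where ab: "u = a + b" "a \<in> Poly_Mapping.keys f" "b \<in> Poly_Mapping.keys g"
    using keys_mult[of f g] by blast
  then show "(\<Sum>i\<in>UNIV. Poly_Mapping.lookup u i) = m + n"
    using assms by (simp add: homogeneous_def lookup_add sum.distrib)
qed

lemma homogeneous_const: "homogeneous 0 (const_poly c)"
  by (auto simp: homogeneous_def const_poly_def)

lemma homogeneous_one: "homogeneous 0 1"
  using homogeneous_const[of 1] by (simp add: is_ring_homD(1)[OF const_poly_hom])

lemma homogeneous_prod:
  "(\<And>i. i \<in> A \<Longrightarrow> homogeneous (e i) (f i)) \<Longrightarrow> homogeneous (\<Sum>i\<in>A. e i) (\<Prod>i\<in>A. f i)"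
  by (induction A rule: infinite_finite_induct) (auto intro: homogeneous_mult homogeneous_one)

lemma homogeneous_power: "homogeneous m f \<Longrightarrow> homogeneous (n * m) (f ^ n)"
  by (induction n) (auto intro: homogeneous_mult homogeneous_one)

lemma homogeneous_var: "homogeneous 1 (var i)"
  by (auto simp: homogeneous_def var_def lookup_single when_def)

lemma homogeneous_linear_form: "homogeneous 1 (linear_form a)"
proof -
  have "homogeneous (0 + 1) (const_poly (a $ i) * var i)" for i
    by (rule homogeneous_mult[OF homogeneous_const homogeneous_var])
  then show ?thesis
    unfolding linear_form_def by (intro homogeneous_sum) simp
qed

lemma homogeneous_gl_action:
  assumes "homogeneous m f"
  shows "homogeneous m (gl_action g f)"
proof -
  have "homogeneous m (const_poly (Poly_Mapping.lookup f u) * (\<Prod>i\<in>UNIV. linear_form (matrix_inv g $ i) ^ Poly_Mapping.lookup u i))"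
    if "u \<in> Poly_Mapping.keys f" for u
  proof -
    have "homogeneous (\<Sum>i\<in>UNIV. Poly_Mapping.lookup u i * 1) (\<Prod>i\<in>UNIV. linear_form (matrix_inv g $ i) ^ Poly_Mapping.lookup u i)"
      by (intro homogeneous_prod homogeneous_power homogeneous_linear_form)
    moreover have "(\<Sum>i\<in>UNIV. Poly_Mapping.lookup u i * 1) = m"
      using assms that by (simp add: homogeneous_def)
    ultimately show ?thesis
      using homogeneous_mult[OF homogeneous_const] by fastforce
  qed
  then show ?thesis
    unfolding gl_action_def substitute_def by (intro homogeneous_sum) auto
qed

lemma prod_linear_monic:
  fixes f :: "'i \<Rightarrow> 'a::comm_ring_1"
  assumes "finite A"
  shows "Polynomial.coeff (\<Prod>a\<in>A. [:f a, 1:]) (card A) = 1"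
    and "Polynomial.degree (\<Prod>a\<in>A. [:f a, 1:]) = card A"
proof -
  have *: "Polynomial.coeff (\<Prod>a\<in>A. [:f a, 1:]) (card A) = 1 \<and>
      Polynomial.degree (\<Prod>a\<in>A. [:f a, 1:]) \<le> card A"
    using assms
  proof (induction A rule: finite_induct)
    case (insert b B)
    then have "Polynomial.coeff (\<Prod>a\<in>B. [:f a, 1:]) (Suc (card B)) = 0"
      by (intro coeff_eq_0) simp
    moreover have "Polynomial.degree ([:f b, 1:] * (\<Prod>a\<in>B. [:f a, 1:])) \<le> Suc (card B)"
      using degree_mult_le[of "[:f b, 1:]" "\<Prod>a\<in>B. [:f a, 1:]"] insert.IH by (simp del: mult_pCons_left)
    ultimately show ?case
      using insert by (simp add: coeff_linear_mult del: mult_pCons_left)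
  qed simp
  then show "Polynomial.coeff (\<Prod>a\<in>A. [:f a, 1:]) (card A) = 1" by simp
  with * show "Polynomial.degree (\<Prod>a\<in>A. [:f a, 1:]) = card A"
    using le_degree[of "\<Prod>a\<in>A. [:f a, 1:]" "card A"] by (simp add: order_antisym)
qed

lemma homogeneous_coeff_prod_linear:
  assumes "finite A" "\<And>a. a \<in> A \<Longrightarrow> homogeneous e (f a)" "k \<le> card A"
  shows "homogeneous (e * (card A - k)) (Polynomial.coeff (\<Prod>a\<in>A. [:f a, 1:]) k)"
  using assms
proof (induction A arbitrary: k rule: finite_induct)
  case empty
  then show ?case by (simp add: homogeneous_one)
next
  case (insert a A)
  let ?P = "\<Prod>a\<in>A. [:f a, 1:]"
  have eq: "Polynomial.coeff (\<Prod>a\<in>insert a A. [:f a, 1:]) k =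
      f a * Polynomial.coeff ?P k + (case k of 0 \<Rightarrow> 0 | Suc j \<Rightarrow> Polynomial.coeff ?P j)"
    using insert.hyps coeff_linear_mult[of "f a" ?P k] by (simp del: mult_pCons_left)
  have "homogeneous (e * (card (insert a A) - k)) (f a * Polynomial.coeff ?P k)"
  proof (cases "k \<le> card A")
    case True
    then have "homogeneous (e + e * (card A - k)) (f a * Polynomial.coeff ?P k)"
      using insert by (intro homogeneous_mult) auto
    moreover have "e + e * (card A - k) = e * (card (insert a A) - k)"
      using True insert.hyps by (simp add: Suc_diff_le)
    ultimately show ?thesis by metis
  next
    case False
    then have "Polynomial.coeff ?P k = 0"
      by (intro coeff_eq_0) (simp add: prod_linear_monic(2)[OF insert.hyps(1)])
    then show ?thesis by (simp add: homogeneous_zero)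
  qed
  moreover have "homogeneous (e * (card (insert a A) - k)) (case k of 0 \<Rightarrow> 0 | Suc j \<Rightarrow> Polynomial.coeff ?P j)"
    using insert by (cases k) (auto simp: homogeneous_zero)
  ultimately show ?case
    unfolding eq by (rule homogeneous_add)
qed

lemma ideal_elements_subring:
  assumes I: "ideal I (subring_of C)" and C: "is_subring C"
  shows "I \<subseteq> C" "0 \<in> I" "x \<in> I \<Longrightarrow> y \<in> I \<Longrightarrow> x + y \<in> I" "s \<in> C \<Longrightarrow> x \<in> I \<Longrightarrow> s * x \<in> I"
proof -
  show "I \<subseteq> C" using additive_subgroup.a_subset[OF ideal.axioms(1)[OF I]] by simp
  show "0 \<in> I" using additive_subgroup.zero_closed[OF ideal.axioms(1)[OF I]] by simp
  show "x \<in> I \<Longrightarrow> y \<in> I \<Longrightarrow> x + y \<in> I" using additive_subgroup.a_closed[OF ideal.axioms(1)[OF I], of x y] by simp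
  show "s \<in> C \<Longrightarrow> x \<in> I \<Longrightarrow> s * x \<in> I" using ideal.I_l_closed[OF I, of x s] by simp
qed

lemma add_span_mult:
  assumes M: "is_subring M" and x: "x \<in> add_span J M" and y: "y \<in> add_span I M"
    and JI: "\<And>s t. s \<in> J \<Longrightarrow> t \<in> I \<Longrightarrow> s * t \<in> K"
  shows "x * y \<in> add_span K M"
  using x
proof (induction x rule: add_span.induct)
  case (prod s t)
  note st = prod
  show ?case
    using y
  proof (induction y rule: add_span.induct)
    case (prod s' t')
    have "(s * s') * (t * t') \<in> add_span K M"
      by (rule add_span.prod[OF JI[OF st(1) prod(1)] is_subringD(5)[OF M st(2) prod(2)]])
    then show ?case by (simp add: mult_ac)
  next
    case (sum x y)
    show ?case unfolding distrib_left by (rule add_span.sum[OF sum.IH])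
  qed
next
  case (sum x x')
  show ?case unfolding distrib_right by (rule add_span.sum[OF sum.IH])
qed

lemma add_span_ideal_power:
  assumes M: "is_subring M" and C: "is_subring C" "C \<subseteq> M" and z: "z \<in> add_span I M"
  shows "z ^ n \<in> add_span (I [^]\<^bsub>ideals_set (subring_of C)\<^esub> n) M"
proof (induction n)
  case 0
  have "(1 :: 'a) * 1 \<in> add_span (I [^]\<^bsub>ideals_set (subring_of C)\<^esub> (0::nat)) M"
    unfolding ideal_power_0 using is_subringD(1)[OF C(1)] is_subringD(1)[OF M] by (intro add_span.prod) simp_all
  then show ?case by simp
next
  case (Suc n)
  have "z ^ n * z \<in> add_span (I [^]\<^bsub>ideals_set (subring_of C)\<^esub> (Suc n)) M"
  proof (rule add_span_mult[OF M Suc z])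
    fix s t assume st: "s \<in> I [^]\<^bsub>ideals_set (subring_of C)\<^esub> n" "t \<in> I"
    show "s * t \<in> I [^]\<^bsub>ideals_set (subring_of C)\<^esub> (Suc n)"
      unfolding ideal_power_Suc using ideal_prod.prod[OF st, of "subring_of C"] by simp
  qed
  then show ?case by (simp only: power_Suc2)
qed

text \<open>A homogeneous element of positive degree is a root of its orbit polynomial, which is monic and whose lower
  coefficients are invariants of positive degree.\<close>

lemma homogeneous_power_in_span:
  fixes A :: "(('k::field, 'n::finite) mpoly \<Rightarrow> ('k, 'n) mpoly) set"
  assumes A: "automorphism_group A" and fin: "finite A"
    and A_hom: "\<And>g m f. g \<in> A \<Longrightarrow> homogeneous m f \<Longrightarrow> homogeneous m (g f)"
    and M: "is_subring M" and h: "h \<in> M" and deg: "homogeneous e h" "e > 0"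
    and I: "\<And>f m. f \<in> fixed_ring A \<Longrightarrow> m > 0 \<Longrightarrow> homogeneous m f \<Longrightarrow> f \<in> I"
    and I_zero: "0 \<in> I"
  shows "h ^ card A \<in> add_span I M"
proof -
  let ?P = "\<Prod>g\<in>A. [:- g h, 1:]" and ?N = "card A"
  have hom: "is_ring_hom g" if "g \<in> A" for g using A that by (simp add: automorphism_group_def)
  have idA: "id \<in> A" using A by (simp add: automorphism_group_def)
  have coeff_N: "Polynomial.coeff ?P ?N = 1" and deg_P: "Polynomial.degree ?P = ?N"
    by (rule prod_linear_monic[OF fin])+
  have coeff_I: "Polynomial.coeff ?P l \<in> I" if l: "l < ?N" for l
  proof (rule I)
    show "homogeneous (e * (?N - l)) (Polynomial.coeff ?P l)"
    proof (rule homogeneous_coeff_prod_linear[OF fin])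
      show "homogeneous e (- g h)" if "g \<in> A" for g
        by (rule homogeneous_uminus[OF A_hom[OF that deg(1)]])
    qed (use l in simp)
    show "e * (?N - l) > 0" using l deg by simp
    have "g (Polynomial.coeff ?P l) = Polynomial.coeff ?P l" if g: "g \<in> A" for g
    proof -
      note [simp] = is_ring_homD[OF hom[OF g]]
      obtain g' where g': "g' \<in> A" "g \<circ> g' = id" "g' \<circ> g = id"
        using A g unfolding automorphism_group_def by blast
      have comp: "f \<circ> f' \<in> A" if "f \<in> A" "f' \<in> A" for f f' using A that by (simp add: automorphism_group_def)
      have bij: "bij_betw (\<lambda>f. g \<circ> f) A A"
      proof (rule bij_betwI[where g = "\<lambda>f. g' \<circ> f"])
        show "(\<lambda>f. g \<circ> f) \<in> A \<rightarrow> A" "(\<lambda>f. g' \<circ> f) \<in> A \<rightarrow> A"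
          using comp g g'(1) by auto
        show "g' \<circ> (g \<circ> f) = f" for f by (simp add: comp_assoc[symmetric] g'(3))
        show "g \<circ> (g' \<circ> f) = f" for f by (simp add: comp_assoc[symmetric] g'(2))
      qed
      have "map_poly g ?P = (\<Prod>f\<in>A. map_poly g [:- f h, 1:])"
        by (rule ring_hom_prod[OF map_poly_ring_hom[OF hom[OF g]]])
      also have "\<dots> = (\<Prod>f\<in>A. [:- (g \<circ> f) h, 1:])"
        by (simp add: map_poly_pCons)
      also have "\<dots> = ?P"
        by (rule prod.reindex_bij_betw[OF bij, of "\<lambda>f. [:- f h, 1:]"])
      finally have gP: "map_poly g ?P = ?P" .
      have "Polynomial.coeff (map_poly g ?P) l = g (Polynomial.coeff ?P l)"
        by (rule coeff_map_poly[of g, OF is_ring_homD(2)[OF hom[OF g]]])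
      then show ?thesis unfolding gP by (rule sym)
    qed
    then show "Polynomial.coeff ?P l \<in> fixed_ring A" by (simp add: fixed_ring_def)
  qed
  have "poly ?P h = 0"
    unfolding poly_prod using fin idA by (intro prod_zero) (auto intro!: bexI[of _ id])
  moreover have "poly ?P h = (\<Sum>l\<le>?N. Polynomial.coeff ?P l * h ^ l)"
    by (simp only: poly_altdef deg_P)
  moreover have "(\<Sum>l\<le>?N. Polynomial.coeff ?P l * h ^ l) = (\<Sum>l<?N. Polynomial.coeff ?P l * h ^ l) + h ^ ?N"
    by (simp add: coeff_N flip: lessThan_Suc_atMost)
  ultimately have eq: "h ^ ?N = (\<Sum>l<?N. Polynomial.coeff ?P l * (- (h ^ l)))"
    by (simp add: sum_negf eq_neg_iff_add_eq_0 add.commute)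
  have "(\<Sum>l\<in>B. Polynomial.coeff ?P l * (- (h ^ l))) \<in> add_span I M" if "finite B" "B \<subseteq> {..<?N}" for B
    using that
  proof (induction B rule: finite_induct)
    case empty
    have "(0 :: ('k, 'n) mpoly) * 1 \<in> add_span I M"
      using I_zero is_subringD(1)[OF M] by (rule add_span.prod)
    then show ?case by simp
  next
    case (insert l B)
    have l: "Polynomial.coeff ?P l * (- (h ^ l)) \<in> add_span I M"
      using insert.prems coeff_I is_subring_power[OF M h, of l] is_subringD(6)[OF M] by (intro add_span.prod) auto
    have "(\<Sum>l\<in>B. Polynomial.coeff ?P l * (- (h ^ l))) \<in> add_span I M"
      using insert by blast
    then show ?case
      unfolding sum.insert[OF insert.hyps] by (rule add_span.sum[OF l])
  qed
  then show ?thesis unfolding eq by blast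
qed

section \<open>Restriction to lines\<close>

lemma field_domain_mpoly: "field_domain (const_poly :: 'k::{field,finite} \<Rightarrow> ('k, 'n::finite) mpoly) CARD('k)"
  by standard (auto simp: is_ring_homD[OF const_poly_hom] dest: mpoly_no_zero_divisors)

definition pairing :: "'k::field ^ 'n::finite \<Rightarrow> 'k ^ 'n \<Rightarrow> 'k" where
  "pairing a v = (\<Sum>i\<in>UNIV. a $ i * v $ i)"

text \<open>Restriction to the lines in direction \<open>v\<close>: the polynomial \<open>f\<close> at the point moved by
  \<open>(X - x) v\<close>. If \<open>x\<close> is a linear form with value \<open>1\<close> at \<open>v\<close>, this presents the ring as a polynomial
  ring in \<open>x\<close> over the polynomials in the linear forms vanishing at \<open>v\<close>.\<close>

definition line_expand :: "'k::field ^ 'n::finite \<Rightarrow> ('k, 'n) mpoly \<Rightarrow> ('k, 'n) mpoly \<Rightarrow> ('k, 'n) mpoly poly" where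
  "line_expand v x = eval_mpoly (\<lambda>c. [:const_poly c:]) (\<lambda>i. [:var i - const_poly (v $ i) * x, const_poly (v $ i):])"

lemma const_const_hom: "is_ring_hom (\<lambda>c. [:const_poly c:])"
  by (auto simp: is_ring_hom_def is_ring_homD[OF const_poly_hom] pCons_one)

lemma line_expand_hom: "is_ring_hom (line_expand v x)"
  unfolding line_expand_def by (rule is_ring_hom_eval[OF const_const_hom])

lemma line_expand_const: "line_expand v x (const_poly c) = [:const_poly c:]"
  unfolding line_expand_def by (rule eval_const[OF const_const_hom])

lemma line_expand_var: "line_expand v x (var i) = [:var i - const_poly (v $ i) * x, const_poly (v $ i):]"
  unfolding line_expand_def by (rule eval_var[OF const_const_hom])

lemma sum_pCons: "(\<Sum>i\<in>A. [:f i, g i:]) = [:\<Sum>i\<in>A. f i, \<Sum>i\<in>A. g i:]"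
  by (induction A rule: infinite_finite_induct) auto

lemma const_pairing: "const_poly (pairing a v) = (\<Sum>i\<in>UNIV. const_poly (a $ i) * const_poly (v $ i))"
  by (simp add: pairing_def ring_hom_sum[OF const_poly_hom] is_ring_homD[OF const_poly_hom])

lemma line_expand_linear_form:
  "line_expand v x (linear_form a) = [:linear_form a - const_poly (pairing a v) * x, const_poly (pairing a v):]"
proof -
  have "line_expand v x (linear_form a) =
      (\<Sum>i\<in>UNIV. [:const_poly (a $ i) * (var i - const_poly (v $ i) * x), const_poly (a $ i) * const_poly (v $ i):])"
    by (simp add: hom_linear_form[OF line_expand_hom] line_expand_const line_expand_var mult.commute)
  then show ?thesis
    by (simp add: sum_pCons const_pairing linear_form_def right_diff_distrib sum_subtractf sum_distrib_right mult.assoc)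
qed

lemma poly_eval_hom: "is_ring_hom (\<lambda>P. poly P y)"
  by (simp add: is_ring_hom_def)

lemma poly_line_expand:
  fixes f :: "('k::field, 'n::finite) mpoly"
  shows "poly (line_expand v x f) x = f"
proof (rule mpoly_hom_ext[where f = f and g = "\<lambda>f. poly (line_expand v x f) x" and g' = "\<lambda>f. f"])
  show "is_ring_hom (\<lambda>f. poly (line_expand v x f) x)"
    by (rule ring_hom_comp[OF poly_eval_hom line_expand_hom])
  show "is_ring_hom (\<lambda>f :: ('k, 'n) mpoly. f)" by (simp add: is_ring_hom_def)
qed (simp_all add: line_expand_const line_expand_var algebra_simps)

text \<open>Both sides are ring homomorphisms in \<open>f\<close>, so it is enough to compare them on constants and on variables.\<close>

lemma line_expand_equivariant:
  assumes g: "is_ring_hom g" and gc: "\<And>c. g (const_poly c) = const_poly c"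
    and gx: "g x = x + w0"
    and gl: "\<And>a. \<exists>b. g (linear_form a) = linear_form (a + b) \<and> pairing b v = 0"
  shows "line_expand v x (g f) = pcompose (map_poly g (line_expand v x f)) [:w0, 1:]"
proof (rule mpoly_hom_ext[where f = f and g = "\<lambda>f. line_expand v x (g f)"
      and g' = "\<lambda>f. pcompose (map_poly g (line_expand v x f)) [:w0, 1:]"])
  show "is_ring_hom (\<lambda>f. line_expand v x (g f))"
    by (rule ring_hom_comp[OF line_expand_hom g])
  show "is_ring_hom (\<lambda>f. pcompose (map_poly g (line_expand v x f)) [:w0, 1:])"
    by (rule ring_hom_comp[OF pcompose_ring_hom ring_hom_comp[OF map_poly_ring_hom[OF g] line_expand_hom]])
  show "line_expand v x (g (const_poly c)) = pcompose (map_poly g (line_expand v x (const_poly c))) [:w0, 1:]" for c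
    by (simp add: gc line_expand_const map_poly_pCons is_ring_homD[OF g])
  show "line_expand v x (g (var i)) = pcompose (map_poly g (line_expand v x (var i))) [:w0, 1:]" for i
  proof -
    let ?a = "axis i 1"
    obtain b where b: "g (linear_form ?a) = linear_form (?a + b)" "pairing b v = 0"
      using gl by blast
    have p: "pairing (?a + b) v = pairing ?a v"
      using b(2) by (simp add: pairing_def distrib_right sum.distrib)
    show ?thesis
      unfolding linear_form_axis[symmetric] b(1) line_expand_linear_form p
      by (simp add: map_poly_pCons is_ring_homD[OF g] b(1) gc gx pcompose_pCons algebra_simps)
  qed
qed

lemma matrix_inv_pairing:
  assumes "invertible (B :: 'k::field ^ 'n::finite ^ 'n)"
  shows "pairing (B $ i) (column j (matrix_inv B)) = (if i = j then 1 else 0)"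
proof -
  have "(B ** matrix_inv B) $ i $ j = (if i = j then 1 else 0)"
    unfolding matrix_inv_both(1)[OF assms] by (simp add: mat_def)
  then show ?thesis
    by (simp add: pairing_def column_def matrix_matrix_mult_def)
qed

context field_domain
begin

lemma extend_list:
  assumes K: "kspace K" "card K = q ^ m"
  shows "set bs \<subseteq> K \<Longrightarrow> card (span_list bs) = q ^ length bs \<Longrightarrow> n + length bs = m \<Longrightarrow>
    \<exists>cs. set cs \<subseteq> K \<and> length cs = n \<and> card (span_list (cs @ bs)) = q ^ m"
proof (induction n arbitrary: bs)
  case 0
  then show ?case by (intro exI[of _ "[]"]) simp
next
  case (Suc n)
  have "span_list bs \<noteq> K"
    using Suc.prems K(2) q_power_inject[of "length bs" m] by auto
  then obtain b where b: "b \<in> K" "b \<notin> span_list bs"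
    using span_list_subset[OF K(1) Suc.prems(1)] by blast
  have c: "card (span_list (b # bs)) = q ^ length (b # bs)"
    unfolding card_span_list_Cons[OF b(2)] using Suc.prems(2) by simp
  obtain cs where "set cs \<subseteq> K" "length cs = n" "card (span_list (cs @ b # bs)) = q ^ m"
    using Suc.IH[of "b # bs"] Suc.prems b c by (auto simp del: span_list.simps)
  then show ?case
    using b by (intro exI[of _ "cs @ [b]"]) auto
qed

lemma span_list_append: "span_list bs \<subseteq> span_list (cs @ bs)"
proof (induction cs)
  case (Cons c cs)
  have "s \<in> span_list (c # cs @ bs)" if "s \<in> span_list (cs @ bs)" for s
    using that by (auto intro!: image_eqI[of _ _ "(0, s)"] simp: hom_zero)
  then show ?case using Cons by auto
qed simp

end

section \<open>Invariants of a finite space of linear forms\<close>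

context field_domain
begin

definition line :: "'a \<Rightarrow> 'a set" where
  "line w = range (\<lambda>c. \<kappa> c * w)"

text \<open>For a plane \<open>W\<close> of linear forms, these are up to sign its two Dickson coefficients, of degrees \<open>q^2 - 1\<close> and \<open>q^2 - q\<close>. The
  description of the second one by lines shows its residue modulo each element of \<open>W\<close>.\<close>

definition top_invariant :: "'a set \<Rightarrow> 'a" where
  "top_invariant W = \<Prod>(W - {0})"

definition line_invariant :: "'a set \<Rightarrow> 'a" where
  "line_invariant W = (\<Sum>w\<in>W - {0}. \<Prod>(W - line w))"

lemma line_self: "w \<in> line w"
  by (auto simp: line_def hom_one intro!: image_eqI[of _ _ 1])

lemma zero_in_line: "0 \<in> line w"
  by (auto simp: line_def hom_zero intro!: image_eqI[of _ _ 0])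

lemma line_subset: "kspace W \<Longrightarrow> w \<in> W \<Longrightarrow> line w \<subseteq> W"
  by (auto simp: line_def kspaceD)

lemma card_line: "w \<noteq> 0 \<Longrightarrow> card (line w) = q"
  unfolding line_def using inj_line[of w 0] by (simp add: card_image q_eq)

lemma line_eq:
  assumes "w \<in> line w1" "w \<noteq> 0"
  shows "line w1 = line w"
proof -
  obtain c where c: "w = \<kappa> c * w1" using assms(1) by (auto simp: line_def)
  then have "c \<noteq> 0" using assms(2) by (auto simp: hom_zero)
  then have "w1 = \<kappa> (inverse c) * w"
    by (simp add: c hom_one flip: mult.assoc hom_mult)
  then have "\<kappa> a * w1 = \<kappa> (a * inverse c) * w" for a
    by (simp add: hom_mult mult.assoc)
  moreover have "\<kappa> a * w = \<kappa> (a * c) * w1" for a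
    by (simp add: c hom_mult mult.assoc)
  ultimately have "range (\<lambda>c. \<kappa> c * w1) \<subseteq> range (\<lambda>c. \<kappa> c * w)" "range (\<lambda>c. \<kappa> c * w) \<subseteq> range (\<lambda>c. \<kappa> c * w1)"
    by blast+
  then show ?thesis
    unfolding line_def by (rule subset_antisym)
qed

lemma image_line:
  assumes "is_ring_hom g" "\<And>c. g (\<kappa> c) = \<kappa> c"
  shows "g ` line w = line (g w)"
  by (simp add: line_def image_image is_ring_homD[OF assms(1)] assms(2))

lemma invariants_fixed:
  assumes g: "is_ring_hom g" "\<And>c. g (\<kappa> c) = \<kappa> c" and W: "bij_betw g W W" "\<And>w. w \<in> W \<Longrightarrow> line w \<subseteq> W" "0 \<in> W"
  shows "g (top_invariant W) = top_invariant W" "g (line_invariant W) = line_invariant W"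
proof -
  have inj: "inj_on g W" and img: "g ` W = W" using W(1) by (auto simp: bij_betw_def)
  have prod: "g (\<Prod>(W - A)) = \<Prod>(W - g ` A)" if "A \<subseteq> W" for A
  proof -
    have "g (\<Prod>(W - A)) = \<Prod>(g ` (W - A))"
      using inj by (subst prod.reindex) (auto intro: inj_on_subset simp: ring_hom_prod[OF g(1)])
    also have "g ` (W - A) = W - g ` A"
      using inj_on_image_set_diff[OF inj _ that, of W] img by simp
    finally show ?thesis .
  qed
  show "g (top_invariant W) = top_invariant W"
    unfolding top_invariant_def using prod[of "{0}"] W(3) by (simp add: is_ring_homD[OF g(1)])
  have bij0: "bij_betw g (W - {0}) (W - {0})"
    using inj inj_on_image_set_diff[OF inj, of W "{0}"] W(3) img
    by (auto simp: bij_betw_def is_ring_homD[OF g(1)] intro: inj_on_subset)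
  have "g (line_invariant W) = (\<Sum>w\<in>W - {0}. \<Prod>(W - line (g w)))"
    unfolding line_invariant_def ring_hom_sum[OF g(1)]
    by (intro sum.cong refl) (use prod W(2) image_line[OF g] in auto)
  also have "\<dots> = line_invariant W"
    unfolding line_invariant_def by (rule sum.reindex_bij_betw[OF bij0, of "\<lambda>w. \<Prod>(W - line w)"])
  finally show "g (line_invariant W) = line_invariant W" .
qed

lemma top_invariant_nonzero: "kspace W \<Longrightarrow> top_invariant W \<noteq> 0"
  unfolding top_invariant_def using prod_nonzero[of "W - {0}" "\<lambda>w. w"] by (auto simp: kspaceD)

text \<open>Modulo \<open>w\<close>, the summands of \<open>line_invariant W\<close> that belong to lines other than that of \<open>w\<close> vanish, and the
  \<open>q - 1\<close> remaining ones are equal to a product of elements not divisible by \<open>w\<close>. Hence no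
  \<open>w\<close> divides \<open>line_invariant W\<close>, and the factors of \<open>top_invariant W\<close>, which are primes, can be split off from \<open>a\<close>
  one at a time. The maps \<open>\<pi> w\<close> stand for reduction modulo \<open>w\<close>, with values in the ring itself.\<close>

lemma line_invariant_coprime:
  fixes \<pi> :: "'a \<Rightarrow> 'a \<Rightarrow> 'a"
  assumes W: "kspace W"
    and \<pi>: "\<And>w. w \<in> W - {0} \<Longrightarrow> is_ring_hom (\<pi> w) \<and> \<pi> w w = 0 \<and> (\<forall>r. \<pi> w r = 0 \<longrightarrow> (\<exists>c. r = w * c)) \<and>
      (\<forall>w'\<in>W. \<pi> w w' = 0 \<longrightarrow> w' \<in> line w)"
    and eq: "line_invariant W * a = top_invariant W * b"
  shows "\<exists>c. a = top_invariant W * c"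
proof -
  have fin: "finite W" using W by (simp add: kspaceD)
  have nonzero: "\<pi> w (line_invariant W) \<noteq> 0" if w: "w \<in> W - {0}" for w
  proof -
    have hom: "is_ring_hom (\<pi> w)" and ww: "\<pi> w w = 0" and ker: "\<And>w'. w' \<in> W \<Longrightarrow> \<pi> w w' = 0 \<Longrightarrow> w' \<in> line w"
      using \<pi>[OF w] by auto
    let ?T = "\<Prod>w'\<in>W - line w. \<pi> w w'"
    have summand: "\<pi> w (\<Prod>(W - line w1)) = (if w1 \<in> line w then ?T else 0)" if w1: "w1 \<in> W - {0}" for w1
    proof (cases "w1 \<in> line w")
      case True
      then have "line w = line w1" using line_eq w1 by auto
      then show ?thesis using True by (simp add: ring_hom_prod[OF hom])
    next
      case False
      then have "w \<in> W - line w1" using line_eq[of w w1] line_self[of w1] w by auto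
      then have "(\<Prod>w'\<in>W - line w1. \<pi> w w') = 0"
        using fin ww by (intro prod_zero) auto
      then show ?thesis using False by (simp add: ring_hom_prod[OF hom])
    qed
    have "\<pi> w (line_invariant W) = (\<Sum>w1\<in>W - {0}. if w1 \<in> line w then ?T else 0)"
      unfolding line_invariant_def ring_hom_sum[OF hom] by (intro sum.cong refl summand)
    also have "\<dots> = (\<Sum>w1\<in>line w - {0}. ?T)"
    proof -
      have "{w1 \<in> W - {0}. w1 \<in> line w} = line w - {0}"
        using line_subset[OF W, of w] w by auto
      then show ?thesis using fin by (simp flip: sum.inter_filter)
    qed
    also have "\<dots> = of_nat (q - 1) * ?T"
      using card_line[of w] w zero_in_line[of w] by simp
    also have "\<dots> = - ?T"
    proof -
      obtain c where "q = Suc c" using q_ge_2 by (cases q) auto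
      then have "of_nat (q - 1) = (- 1 :: 'a)"
        using of_nat_card_power_eq_0[of 1] by (simp add: eq_neg_iff_add_eq_0 add.commute)
      then show ?thesis by (simp only: mult_minus_left mult_1_left)
    qed
    finally have "\<pi> w (line_invariant W) = - ?T" .
    moreover have "?T \<noteq> 0"
      using prod_nonzero[of "W - line w" "\<pi> w"] fin ker by auto
    ultimately show ?thesis by simp
  qed
  have "\<exists>c. a = \<Prod>A * c" if "finite A" "A \<subseteq> W - {0}" "line_invariant W * a = \<Prod>A * b" for A a b
    using that
  proof (induction A arbitrary: a b rule: finite_induct)
    case empty
    then show ?case by simp
  next
    case (insert w A)
    then have w: "w \<in> W - {0}" by auto
    have hom: "is_ring_hom (\<pi> w)" and ww: "\<pi> w w = 0" and div: "\<And>r. \<pi> w r = 0 \<Longrightarrow> \<exists>c. r = w * c"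
      using \<pi>[OF w] by auto
    have "\<pi> w (line_invariant W) * \<pi> w a = \<pi> w (w * (\<Prod>A * b))"
      using insert.prems(2) insert.hyps by (simp add: mult.assoc flip: is_ring_homD(4)[OF hom])
    then have "\<pi> w a = 0"
      using no_zero_div nonzero[OF w] by (auto simp: is_ring_homD[OF hom] ww)
    then obtain a' where a': "a = w * a'" using div by blast
    have "w * (line_invariant W * a') = w * (\<Prod>A * b)"
      using insert.prems(2) insert.hyps by (simp add: a' mult_ac)
    then have "line_invariant W * a' = \<Prod>A * b"
      using cancel_left w by blast
    then obtain c where "a' = \<Prod>A * c" using insert.IH insert.prems(1) by blast
    then show ?case
      using insert.hyps by (intro exI[of _ c]) (simp add: a' mult.assoc)
  qed
  from this[of "W - {0}"] show ?thesis
    using fin eq unfolding top_invariant_def by blast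
qed

lemma card_span_list_append_le: "card (span_list (xs @ ws)) \<le> q ^ length xs * card (span_list ws)"
proof (induction xs)
  case (Cons b xs)
  have "card (span_list (b # xs @ ws)) \<le> card ((UNIV :: 'k set) \<times> span_list (xs @ ws))"
    unfolding span_list.simps by (rule card_image_le) (simp add: finite_span_list)
  also have "\<dots> \<le> q * (q ^ length xs * card (span_list ws))"
    using Cons by (simp add: card_cartesian_product q_eq)
  finally show ?case by (simp add: mult.assoc del: span_list.simps)
qed simp

end

lemma pairing_add: "pairing (a + b) v = pairing a v + pairing b v"
  by (simp add: pairing_def distrib_right sum.distrib)

lemma pairing_scale: "pairing (c *s a) v = c * pairing a v"
  by (simp add: pairing_def sum_distrib_left mult.assoc)

definition linear_forms :: "('k::field, 'n::finite) mpoly set" where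
  "linear_forms = range linear_form"

text \<open>The variable fixes the types \<open>'k\<close> and \<open>'n\<close> at which the interpretation below is made.\<close>

context
  fixes dummy :: "('k::{field,finite}, 'n::finite) mpoly"
begin

interpretation field_domain "const_poly :: 'k \<Rightarrow> ('k, 'n) mpoly" "CARD('k)"
  by (rule field_domain_mpoly)

lemma kspace_linear_forms: "kspace (linear_forms :: ('k, 'n) mpoly set)"
  unfolding kspace_def linear_forms_def
  by (auto simp: image_iff simp flip: linear_form_add linear_form_scale) (metis linear_form_zero)

lemma card_linear_forms: "card (linear_forms :: ('k, 'n) mpoly set) = CARD('k) ^ CARD('n)"
  by (simp add: linear_forms_def card_image[OF inj_linear_form] CARD_vec)

lemma kspace_hyperplane: "kspace {linear_form a :: ('k, 'n) mpoly |a. pairing a v = 0}"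
  unfolding kspace_def
proof (intro conjI ballI allI)
  show "finite {linear_form a :: ('k, 'n) mpoly |a. pairing a v = 0}"
    by (rule finite_subset[of _ "linear_forms"])
      (auto simp: linear_forms_def)
  show "0 \<in> {linear_form a :: ('k, 'n) mpoly |a. pairing a v = 0}"
    by (auto intro!: exI[of _ 0] simp: linear_form_zero pairing_def)
next
  fix x y assume "x \<in> {linear_form a :: ('k, 'n) mpoly |a. pairing a v = 0}" "y \<in> {linear_form a :: ('k, 'n) mpoly |a. pairing a v = 0}"
  then obtain a b where "x = linear_form a" "y = linear_form b" "pairing a v = 0" "pairing b v = 0" by blast
  then have "x + y = linear_form (a + b)" "pairing (a + b) v = 0"
    by (simp_all add: linear_form_add pairing_add)
  then show "x + y \<in> {linear_form a :: ('k, 'n) mpoly |a. pairing a v = 0}" by blast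
next
  fix c x assume "x \<in> {linear_form a :: ('k, 'n) mpoly |a. pairing a v = 0}"
  then obtain a where "x = linear_form a" "pairing a v = 0" by blast
  then have "const_poly c * x = linear_form (c *s a)" "pairing (c *s a) v = 0"
    by (simp_all add: linear_form_scale pairing_scale)
  then show "const_poly c * x \<in> {linear_form a :: ('k, 'n) mpoly |a. pairing a v = 0}" by blast
qed

text \<open>The coefficient vectors of the basis are the rows of a matrix, whose inverse has the dual
  vectors as its columns.\<close>

lemma dual_functionals:
  fixes bs :: "('k, 'n) mpoly list"
  assumes "set bs \<subseteq> linear_forms" "length bs = CARD('n)" "span_list bs = linear_forms"
  shows "\<exists>a v. (\<forall>j<CARD('n). bs ! j = linear_form (a j)) \<and>
    (\<forall>j<CARD('n). \<forall>l<CARD('n). pairing (a j) (v l :: 'k ^ 'n) = (if j = l then 1 else 0))"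
proof -
  have "\<exists>a. bs ! j = linear_form a" if j: "j < CARD('n)" for j
  proof -
    have "bs ! j \<in> linear_forms"
      using assms(1,2) j by (metis nth_mem subsetD)
    then show ?thesis by (auto simp: linear_forms_def)
  qed
  then have "\<forall>j. \<exists>a. j < CARD('n) \<longrightarrow> bs ! j = linear_form a" by blast
  from choice[OF this] obtain a where a: "\<And>j. j < CARD('n) \<Longrightarrow> bs ! j = linear_form (a j)" by blast
  obtain e :: "nat \<Rightarrow> 'n" where e: "bij_betw e {0..<CARD('n)} UNIV"
    using ex_bij_betw_nat_finite[of "UNIV :: 'n set"] by auto
  define B :: "'k ^ 'n ^ 'n" where "B = vec_lambda (\<lambda>r. a (inv_into {0..<CARD('n)} e r))"
  have B: "B $ e j = a j" if "j < CARD('n)" for j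
    using inv_into_f_f[of e "{0..<CARD('n)}" j] e that by (simp add: B_def bij_betw_def)
  have row: "a j \<in> rows B" if "j < CARD('n)" for j
    using B[OF that] by (auto simp: rows_def row_def vec_nth_inverse intro!: exI[of _ "e j"])
  have "span_list cs \<subseteq> linear_form ` vec.span (rows B)" if "set cs \<subseteq> linear_form ` vec.span (rows B)" for cs
    using that
  proof (induction cs)
    case Nil
    then show ?case
      using vec.span_zero by (auto simp: linear_form_zero intro!: image_eqI[of _ _ 0])
  next
    case (Cons b cs)
    then obtain b' where b': "b = linear_form b'" "b' \<in> vec.span (rows B)" by auto
    have "const_poly c * b + s \<in> linear_form ` vec.span (rows B)" if s: "s \<in> span_list cs" for c s
    proof -
      obtain s' where s': "s = linear_form s'" "s' \<in> vec.span (rows B)" using Cons s by auto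
      have "const_poly c * b + s = linear_form (c *s b' + s')"
        by (simp add: b' s' linear_form_add linear_form_scale)
      moreover have "c *s b' + s' \<in> vec.span (rows B)"
        using b' s' by (intro vec.span_add vec.span_scale)
      ultimately show ?thesis by blast
    qed
    then show ?case by auto
  qed
  moreover have "set bs \<subseteq> linear_form ` vec.span (rows B)"
  proof
    fix b assume "b \<in> set bs"
    then obtain j where "j < CARD('n)" "b = linear_form (a j)"
      using assms(2) a by (metis in_set_conv_nth)
    then show "b \<in> linear_form ` vec.span (rows B)"
      using row vec.span_base by blast
  qed
  ultimately have sub: "linear_forms \<subseteq> linear_form ` vec.span (rows B)"
    using assms(3) by blast
  have "b \<in> vec.span (rows B)" for b
  proof -
    have "linear_form b \<in> linear_form ` vec.span (rows B)"
      using sub by (auto simp: linear_forms_def)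
    then show ?thesis by (simp only: inj_image_mem_iff[OF inj_linear_form])
  qed
  then have "vec.span (rows B) = UNIV" by blast
  then have inv: "invertible B"
    using matrix_left_invertible_span_rows_gen[of B] invertible_left_inverse[of B] by blast
  have e_inj: "e j = e l \<longleftrightarrow> j = l" if "j < CARD('n)" "l < CARD('n)" for j l
    using e that by (auto simp: bij_betw_def inj_on_def)
  have dual: "pairing (a j) (column (e l) (matrix_inv B)) = (if j = l then 1 else 0)" if "j < CARD('n)" "l < CARD('n)" for j l
    using matrix_inv_pairing[OF inv, of "e j" "e l"] B[OF that(1)] e_inj[OF that] by simp
  show ?thesis
    by (rule exI[of _ a], rule exI[of _ "\<lambda>l. column (e l) (matrix_inv B)"], intro conjI allI impI a dual)
qed

end

section \<open>A regular sequence for a group acting trivially modulo a plane\<close>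

text \<open>The variable fixes the types \<open>'k\<close> and \<open>'n\<close> at which the interpretation below is made.\<close>

context
  fixes dummy :: "('k::{field,finite}, 'n::finite) mpoly"
begin

interpretation field_domain "const_poly :: 'k \<Rightarrow> ('k, 'n) mpoly" "CARD('k)"
  by (rule field_domain_mpoly)

lemma line_expand_zero_dvd: "poly (line_expand v x f) 0 = 0 \<Longrightarrow> \<exists>c. f = x * c"
  for f :: "('k, 'n) mpoly"
proof -
  assume *: "poly (line_expand v x f) 0 = 0"
  obtain c P where P: "line_expand v x f = pCons c P" by (cases "line_expand v x f") auto
  have "f = c + x * poly P x"
    using poly_line_expand[of v x f] P by simp
  then show ?thesis using * P by auto
qed

text \<open>Restriction to the hyperplane \<open>w = 0\<close> along a vector \<open>v\<close> on which \<open>w\<close> takes the value \<open>1\<close>; the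
  restriction is again a polynomial in the original variables.\<close>

lemma linear_prime:
  fixes w :: "('k, 'n) mpoly"
  assumes "w \<in> linear_forms" "w \<noteq> 0"
  shows "\<exists>\<pi>. is_ring_hom \<pi> \<and> \<pi> w = (0 :: ('k, 'n) mpoly) \<and> (\<forall>r. \<pi> r = 0 \<longrightarrow> (\<exists>c. r = w * c)) \<and>
    (\<forall>w'\<in>linear_forms. \<pi> w' = 0 \<longrightarrow> w' \<in> line w)"
proof -
  obtain a where a: "w = linear_form a" using assms(1) by (auto simp: linear_forms_def)
  then have "a \<noteq> 0" using assms(2) linear_form_zero by auto
  then obtain i where i: "a $ i \<noteq> 0" by (auto simp: vec_eq_iff)
  define v :: "'k ^ 'n" where "v = axis i (inverse (a $ i))"
  have pv: "pairing a v = 1"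
  proof -
    have "pairing a v = (\<Sum>j\<in>UNIV. if j = i then 1 else 0)"
      unfolding pairing_def by (intro sum.cong refl) (auto simp: v_def axis_def i)
    then show ?thesis by simp
  qed
  let ?\<pi> = "\<lambda>f. poly (line_expand v w f) 0"
  have lin: "?\<pi> (linear_form b) = linear_form b - const_poly (pairing b v) * w" for b
    by (simp add: line_expand_linear_form)
  have "is_ring_hom ?\<pi>"
    by (rule ring_hom_comp[OF poly_eval_hom line_expand_hom])
  moreover have "?\<pi> w = 0"
    unfolding a lin[unfolded a] pv by (simp add: is_ring_homD(1)[OF const_poly_hom])
  moreover have "w' \<in> line w" if "w' \<in> linear_forms" "?\<pi> w' = 0" for w'
    using that lin by (auto simp: linear_forms_def line_def)
  ultimately show ?thesis
    using line_expand_zero_dvd[of v w] by (intro exI[of _ ?\<pi>]) blast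
qed

text \<open>Extend a basis of \<open>W0\<close> to one of the whole space by elements placed in front of it; the last two elements
  of the resulting list then span a plane containing \<open>W0\<close>.\<close>

lemma two_dimensional_complement:
  fixes W0 :: "('k, 'n) mpoly set"
  assumes W0: "kspace W0" "W0 \<subseteq> linear_forms" "card W0 = CARD('k) ^ i" and i: "i \<le> 2" and d: "CARD('n) \<ge> 2"
  shows "\<exists>bs. set bs \<subseteq> linear_forms \<and> length bs = CARD('n) \<and> span_list bs = linear_forms \<and>
    W0 \<subseteq> span_list (drop (CARD('n) - 2) bs) \<and> card (span_list (drop (CARD('n) - 2) bs)) = CARD('k) ^ 2"
proof -
  let ?d = "CARD('n)" and ?q = "CARD('k)"
  have q2: "?q \<ge> 2" by (rule finite_field_card_ge_2)
  obtain bs0 where bs0: "set bs0 \<subseteq> W0" "length bs0 = i" "card (span_list bs0) = ?q ^ i"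
    using extend_list[OF W0(1,3), of "[]" i] by auto
  have span0: "span_list bs0 = W0"
    using span_list_subset[OF W0(1) bs0(1)] bs0(3) W0(3) kspaceD(1)[OF W0(1)] by (intro card_subset_eq) auto
  have "set bs0 \<subseteq> linear_forms" "card (span_list bs0) = ?q ^ length bs0" "?d - i + length bs0 = ?d"
    using bs0 W0(2) i d by auto
  then obtain cs where cs: "set cs \<subseteq> linear_forms" "length cs = ?d - i" "card (span_list (cs @ bs0)) = ?q ^ ?d"
    using extend_list[OF kspace_linear_forms card_linear_forms, of bs0 "?d - i"] by blast
  let ?bs = "cs @ bs0"
  let ?ws = "drop (?d - 2) ?bs"
  have set: "set ?bs \<subseteq> linear_forms" using cs bs0 W0(2) by auto
  have len: "length ?bs = ?d" using cs bs0 i d by simp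
  have full: "span_list ?bs = linear_forms"
    using span_list_subset[OF kspace_linear_forms set] cs(3) kspaceD(1)[OF kspace_linear_forms]
    by (intro card_subset_eq) (simp_all only: card_linear_forms)
  have "?ws = drop (?d - 2) cs @ bs0" using cs(2) i by simp
  then have W0_sub: "W0 \<subseteq> span_list ?ws"
    using span_list_append[of bs0 "drop (?d - 2) cs"] span0 by simp
  have "length ?ws = 2"
    unfolding length_drop len using d by simp
  then have "card (span_list ?ws) \<le> ?q ^ 2"
    using card_span_list_le[of ?ws] by metis
  moreover have "?q ^ 2 \<le> card (span_list ?ws)"
  proof -
    have lt: "length (take (?d - 2) ?bs) = ?d - 2"
      unfolding length_take len by simp
    have "?q ^ (?d - 2) * ?q ^ 2 = ?q ^ ?d"
      using d le_add_diff_inverse2[of 2 ?d] power_add[of ?q "?d - 2" 2] by metis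
    also have "\<dots> = card (span_list (take (?d - 2) ?bs @ ?ws))"
      using cs(3) by (simp only: append_take_drop_id)
    also have "\<dots> \<le> ?q ^ (?d - 2) * card (span_list ?ws)"
      using card_span_list_append_le[of "take (?d - 2) ?bs" ?ws] unfolding lt .
    finally show ?thesis using q2 by simp
  qed
  ultimately show ?thesis
    using set len full W0_sub by (intro exI[of _ ?bs]) auto
qed

text \<open>Choose coordinates \<open>x 0, \<dots>, x (d - 3)\<close> and a plane \<open>W\<close> that contains \<open>W0\<close>. A basis of
  the linear forms and the dual vectors present the polynomial ring as a polynomial ring in each \<open>x j\<close>
  over a subring that contains \<open>W\<close> and the other coordinates, which is the situation of
  \<open>relative_polynomial_ring\<close>.\<close>

theorem stabilizer_regular_sequence:
  fixes H :: "(('k, 'n) mpoly \<Rightarrow> ('k, 'n) mpoly) set"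
  assumes H_hom: "\<And>g. g \<in> H \<Longrightarrow> is_ring_hom g" and H_const: "\<And>g c. g \<in> H \<Longrightarrow> g (const_poly c) = const_poly c"
    and H_inj: "\<And>g. g \<in> H \<Longrightarrow> inj g"
    and H_W0: "\<And>g v. g \<in> H \<Longrightarrow> v \<in> linear_forms \<Longrightarrow> g v - v \<in> W0"
    and W0: "kspace W0" "W0 \<subseteq> linear_forms" "card W0 = CARD('k) ^ i" and i: "i \<le> 2" and d: "CARD('n) \<ge> 2"
  shows "\<exists>z. regular_seq (fixed_ring H) (CARD('n)) z \<and>
    (\<forall>j<CARD('n). z j \<in> fixed_ring H \<and> (\<exists>e>0. homogeneous e (z j)))"
proof -
  let ?d = "CARD('n)" and ?q = "CARD('k)"
  define m where "m = ?d - 2"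
  obtain bs where bs: "set bs \<subseteq> linear_forms" "length bs = ?d" "span_list bs = linear_forms"
    "W0 \<subseteq> span_list (drop m bs)" and cardW: "card (span_list (drop m bs)) = ?q ^ 2"
    using two_dimensional_complement[OF W0 i d] unfolding m_def by blast
  define W where "W = span_list (drop m bs)"
  have W: "kspace W" unfolding W_def by (rule kspace_span_list)
  have W_lin: "W \<subseteq> linear_forms"
    unfolding W_def using bs(1) set_drop_subset[of m bs] by (intro span_list_subset[OF kspace_linear_forms]) blast
  note W' = kspaceD[OF W]
  obtain a v where a: "\<And>j. j < ?d \<Longrightarrow> bs ! j = linear_form (a j)"
    and v: "\<And>j l. j < ?d \<Longrightarrow> l < ?d \<Longrightarrow> pairing (a j) (v l :: 'k ^ 'n) = (if j = l then 1 else 0)"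
    using dual_functionals[OF bs(1-3)] by blast
  have md: "j < ?d" if "j < m" for j using that by (simp add: m_def)
  define x where "x j = bs ! j" for j
  define \<Phi> where "\<Phi> j = line_expand (v j) (x j)" for j
  have W_v: "\<exists>b. w = linear_form b \<and> pairing b (v j) = 0" if j: "j < m" and w: "w \<in> W" for j w
  proof -
    have "set (drop m bs) \<subseteq> {linear_form b |b. pairing b (v j) = 0}"
    proof
      fix y assume "y \<in> set (drop m bs)"
      then obtain l where l: "l < length (drop m bs)" "y = drop m bs ! l" by (metis in_set_conv_nth)
      then have l': "m + l < ?d" "y = bs ! (m + l)" using bs(2) by auto
      then have "y = linear_form (a (m + l))" "pairing (a (m + l)) (v j) = 0"
        using a v[of "m + l" j] j md by auto
      then show "y \<in> {linear_form b |b. pairing b (v j) = 0}" by blast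
    qed
    then have "W \<subseteq> {linear_form b |b. pairing b (v j) = 0}"
      unfolding W_def by (rule span_list_subset[OF kspace_hyperplane])
    then show ?thesis using w by blast
  qed
  have \<Phi>_W: "\<Phi> j w = [:w:]" if "j < m" "w \<in> W" for j w
    using W_v[OF that] by (auto simp: \<Phi>_def line_expand_linear_form is_ring_homD(2)[OF const_poly_hom])
  have \<Phi>_x: "\<Phi> j (x l) = (if l = j then [:0, 1:] else [:x l:])" if "j < m" "l < m" for j l
    using a[OF md[OF that(2)]] v[OF md[OF that(2)] md[OF that(1)]]
    by (auto simp: \<Phi>_def x_def line_expand_linear_form is_ring_homD(1,2)[OF const_poly_hom])
  have x_lin: "x j \<in> linear_forms" if "j < m" for j
    unfolding x_def using bs(1,2) md[OF that] by (metis nth_mem subsetD)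
  have H_W: "g w - w \<in> W" if "g \<in> H" "w \<in> linear_forms" for g w
    using H_W0[OF that] bs(4) by (auto simp: W_def)
  have bij: "bij_betw g W W" if g: "g \<in> H" for g
  proof -
    have "g w \<in> W" if w: "w \<in> W" for w
    proof -
      have "w \<in> linear_forms" using w W_lin by blast
      from W'(3)[OF H_W[OF g this] w] show ?thesis by simp
    qed
    then have "g ` W \<subseteq> W" by blast
    moreover have "inj_on g W" using H_inj[OF g] by (rule inj_on_subset) simp
    ultimately show ?thesis using endo_inj_surj[OF W'(1)] by (simp add: bij_betw_def)
  qed
  have line_W: "line w \<subseteq> W" if "w \<in> W" for w using line_subset[OF W that] .
  have const_hom: "is_ring_hom (\<lambda>a :: ('k, 'n) mpoly. [:a:])"
    by (simp add: is_ring_hom_def pCons_one)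
  have \<Phi>_hom: "is_ring_hom (\<Phi> j)" for j unfolding \<Phi>_def by (rule line_expand_hom)
  have \<Phi>_prod: "\<Phi> j (\<Prod>B) = [:\<Prod>B:]" if "j < m" "B \<subseteq> W" for j B
  proof -
    have "\<Phi> j (\<Prod>B) = (\<Prod>w\<in>B. [:w:])"
      unfolding ring_hom_prod[OF \<Phi>_hom] using \<Phi>_W that by (intro prod.cong) auto
    then show ?thesis by (simp add: ring_hom_prod[OF const_hom])
  qed
  have coprime: "\<exists>c. r = top_invariant W * c" if "line_invariant W * r = top_invariant W * r'" for r r'
  proof -
    have "\<forall>w\<in>W - {0}. \<exists>\<pi>. is_ring_hom \<pi> \<and> \<pi> w = (0 :: ('k, 'n) mpoly) \<and> (\<forall>r. \<pi> r = 0 \<longrightarrow> (\<exists>c. r = w * c)) \<and>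
        (\<forall>w'\<in>linear_forms. \<pi> w' = 0 \<longrightarrow> w' \<in> line w)"
      using linear_prime W_lin by blast
    from bchoice[OF this] obtain \<pi> where \<pi>: "\<forall>w\<in>W - {0}. is_ring_hom (\<pi> w) \<and> \<pi> w w = (0 :: ('k, 'n) mpoly) \<and>
        (\<forall>r. \<pi> w r = 0 \<longrightarrow> (\<exists>c. r = w * c)) \<and> (\<forall>w'\<in>linear_forms. \<pi> w w' = 0 \<longrightarrow> w' \<in> line w)" ..
    show ?thesis
      by (rule line_invariant_coprime[OF W _ that, of \<pi>]) (use \<pi> W_lin in blast)
  qed
  have inv: "g (top_invariant W) = top_invariant W" "g (line_invariant W) = line_invariant W" if g: "g \<in> H" for g
    by (rule invariants_fixed[OF H_hom[OF g] H_const[OF g] bij[OF g] _ W'(2)], erule line_W)+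
  interpret P: relative_polynomial_ring \<Phi> x W m H "top_invariant W" "line_invariant W"
  proof (rule relative_polynomial_ring.intro)
    fix j assume j: "j < m"
    show "polynomial_variable (\<Phi> j) (x j) W"
    proof
      show "is_ring_hom (\<Phi> j)" by (rule \<Phi>_hom)
      show "poly (\<Phi> j r) (x j) = r" for r unfolding \<Phi>_def by (rule poly_line_expand)
      show "\<Phi> j (x j) = [:0, 1:]" using \<Phi>_x[OF j j] by simp
      show "finite W" "W \<noteq> {}" using W'(1,2) by auto
      show "\<Phi> j w = [:w:]" if "w \<in> W" for w by (rule \<Phi>_W[OF j that])
    qed
    show "\<Phi> j (x l) = [:x l:]" if "l < m" "j \<noteq> l" for l
      using \<Phi>_x[OF j that(1)] that(2) by simp
    show "g (x j) - x j \<in> W" if "g \<in> H" for g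
      by (rule H_W[OF that x_lin[OF j]])
    show "\<Phi> j (g r) = pcompose (map_poly g (\<Phi> j r)) [:g (x j) - x j, 1:]" if g: "g \<in> H" for g r
      unfolding \<Phi>_def
    proof (rule line_expand_equivariant[OF H_hom[OF g] H_const[OF g]])
      show "g (x j) = x j + (g (x j) - x j)" by simp
      show "\<exists>b. g (linear_form c) = linear_form (c + b) \<and> pairing b (v j) = 0" for c
      proof -
        have "g (linear_form c) - linear_form c \<in> W" by (rule H_W[OF g]) (simp add: linear_forms_def)
        then obtain b where "g (linear_form c) - linear_form c = linear_form b" "pairing b (v j) = 0"
          using W_v[OF j] by blast
        then show ?thesis
          by (intro exI[of _ b]) (simp add: linear_form_add algebra_simps)
      qed
    qed
    show "\<Phi> j (top_invariant W) = [:top_invariant W:]"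
      unfolding top_invariant_def by (rule \<Phi>_prod[OF j]) auto
    show "\<Phi> j (line_invariant W) = [:line_invariant W:]"
      unfolding line_invariant_def ring_hom_sum[OF \<Phi>_hom] ring_hom_sum[OF const_hom]
      by (intro sum.cong refl \<Phi>_prod[OF j]) auto
  next
    show "top_invariant W \<in> fixed_ring H" "line_invariant W \<in> fixed_ring H"
      unfolding fixed_ring_def using inv by auto
  qed (use no_zero_div H_hom bij W'(3) top_invariant_nonzero[OF W] coprime in auto)
  have d2: "m + 2 = ?d" using d by (simp add: m_def)
  have hom_W: "homogeneous 1 w" if "w \<in> linear_forms" for w :: "('k, 'n) mpoly"
    using that homogeneous_linear_form by (auto simp: linear_forms_def)
  have hom_prod: "homogeneous (card B) (\<Prod>B)" if "B \<subseteq> W" for B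
    using homogeneous_prod[of B "\<lambda>_. 1" "\<lambda>w. w"] hom_W W_lin that by (simp add: subset_iff)
  have "\<exists>e>0. homogeneous e (P.zseq j)" for j
  proof -
    have q2: "?q \<ge> 2" by (rule finite_field_card_ge_2)
    then have q3: "?q < ?q ^ 2" by (simp add: power2_eq_square)
    have cW: "card W = ?q ^ 2" using cardW by (simp add: W_def)
    consider "j < m" | "j = m" | "j > m" by linarith
    then show ?thesis
    proof cases
      case 1
      have "homogeneous (\<Sum>w\<in>W. 1) (\<Prod>w\<in>W. x j + w)"
        using hom_W x_lin[OF 1] W_lin by (intro homogeneous_prod homogeneous_add) auto
      then show ?thesis using 1 cW q2 by (intro exI[of _ "card W"]) (simp add: P.zseq_def)
    next
      case 2
      then have z: "P.zseq j = top_invariant W" by (simp add: P.zseq_def)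
      have "homogeneous (card (W - {0})) (P.zseq j)"
        unfolding z unfolding top_invariant_def by (rule hom_prod) blast
      moreover have "card (W - {0}) > 0" using cW q2 q3 W'(1,2) by simp
      ultimately show ?thesis by blast
    next
      case 3
      have "homogeneous (?q ^ 2 - ?q) (\<Prod>(W - line w))" if "w \<in> W - {0}" for w
      proof -
        have "card (W - line w) = ?q ^ 2 - ?q"
          using that line_W[of w] card_line[of w] cW W'(1) by (subst card_Diff_subset) (auto intro: finite_subset)
        then show ?thesis using hom_prod[of "W - line w"] by auto
      qed
      moreover have z: "P.zseq j = line_invariant W" using 3 by (simp add: P.zseq_def)
      ultimately have "homogeneous (?q ^ 2 - ?q) (P.zseq j)"
        unfolding z unfolding line_invariant_def by (intro homogeneous_sum) auto
      then show ?thesis using q3 by (intro exI[of _ "?q ^ 2 - ?q"]) simp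
    qed
  qed
  then show ?thesis
    using P.regular P.zseq_fixed unfolding d2 by blast
qed

end

section \<open>Equivariance of flags, weights and Dickson coefficients\<close>

context field_domain
begin

context
  fixes g :: "'a \<Rightarrow> 'a"
  assumes g: "is_ring_hom g" and g\<kappa>: "g (\<kappa> c) = \<kappa> c"
begin

text \<open>The constructions use only the ring operations and the constants \<open>\<kappa> c\<close>, so homomorphisms that fix the
  constants commute with them.\<close>

lemma hom_quot: "g (quot l x) = quot (g l) (g x)"
  by (simp add: quot_eq is_ring_homD[OF g])

lemma hom_quots: "g (quots ys x) = quots (map g ys) (g x)"
  by (induction ys arbitrary: x) (auto simp: hom_quot)

lemma image_quots: "quots (map g ys) ` g ` K = g ` quots ys ` K"
  by (simp add: image_image hom_quots)

lemma hom_span_list: "span_list (map g bs) = g ` span_list bs"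
proof (induction bs)
  case (Cons b bs)
  have "span_list (map g (b # bs)) = (\<lambda>(c, s). \<kappa> c * g b + g s) ` (UNIV \<times> span_list bs)"
    using Cons by (simp add: image_image case_prod_unfold image_paired_Times[of id g, simplified] flip: image_image) force
  then show ?case
    by (simp add: image_image case_prod_unfold is_ring_homD[OF g] g\<kappa>)
qed (simp add: is_ring_homD[OF g])

lemma span_list_fixed: "(\<And>b. b \<in> set bs \<Longrightarrow> g b = b) \<Longrightarrow> s \<in> span_list bs \<Longrightarrow> g s = s"
  by (induction bs arbitrary: s) (auto simp: is_ring_homD[OF g] g\<kappa>)

lemma hom_root_poly: "finite K \<Longrightarrow> inj g \<Longrightarrow> root_poly (g ` K) = map_poly g (root_poly K)"
proof -
  assume K: "finite K" "inj g"
  have "root_poly (g ` K) = (\<Prod>a\<in>K. [:g a, 1:])"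
    unfolding root_poly_def using inj_on_subset[OF K(2)] by (subst prod.reindex) auto
  also have "\<dots> = map_poly g (root_poly K)"
    unfolding root_poly_def ring_hom_prod[OF map_poly_ring_hom[OF g]]
    by (intro prod.cong refl) (simp add: map_poly_pCons is_ring_homD[OF g])
  finally show ?thesis .
qed

lemma hom_dickson_coeff: "finite K \<Longrightarrow> inj g \<Longrightarrow> dickson_coeff (g ` K) n = g (dickson_coeff K n)"
  unfolding dickson_coeff_def by (simp add: hom_root_poly coeff_map_poly is_ring_homD[OF g])

lemma hom_weight: "inj g \<Longrightarrow> weight N (map g bs) = g (weight N bs)"
proof (induction bs)
  case (Cons b bs)
  have inj: "inj_on g (span_list bs)" using Cons.prems by (rule inj_on_subset) simp
  have "(\<Prod>s\<in>g ` span_list bs. g b + s) = g (\<Prod>s\<in>span_list bs. b + s)"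
    using inj by (subst prod.reindex) (auto simp: ring_hom_prod[OF g] is_ring_homD[OF g])
  then show ?case
    using Cons by (simp add: hom_span_list card_image[OF inj] is_ring_homD[OF g])
qed (simp add: is_ring_homD[OF g])

lemma hom_flags: "inj g \<Longrightarrow> ys \<in> flags i K \<Longrightarrow> map g ys \<in> flags i (g ` K)"
proof (induction i arbitrary: K ys)
  case (Suc i)
  then obtain l zs where ys: "ys = l # zs" "l \<in> K" "l \<noteq> 0" "zs \<in> flags i (quot l ` K)" by auto
  have "map g zs \<in> flags i (g ` quot l ` K)" using Suc ys by blast
  moreover have "g ` quot l ` K = quot (g l) ` g ` K" by (simp add: image_image hom_quot)
  moreover have "g l \<noteq> 0" using Suc.prems(1) ys(3) is_ring_homD(2)[OF g] by (metis injD)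
  ultimately show ?case using ys(1,2) by auto
qed simp

end

end

lemma group_general_linear_group: "group (general_linear_group :: ('k::field ^ 'n::finite ^ 'n) monoid)"
proof (rule groupI)
  fix x y z :: "'k ^ 'n ^ 'n"
  show "x \<otimes>\<^bsub>general_linear_group\<^esub> y \<in> carrier general_linear_group"
    if "x \<in> carrier general_linear_group" "y \<in> carrier general_linear_group"
    using that by (simp add: general_linear_group_def invertible_mult)
  show "\<one>\<^bsub>general_linear_group\<^esub> \<in> carrier (general_linear_group :: ('k ^ 'n ^ 'n) monoid)"
    using matrix_inv_eqI(2)[of "mat 1" "mat 1 :: 'k ^ 'n ^ 'n"] by (simp add: general_linear_group_def matrix_mul_lid)
  show "x \<otimes>\<^bsub>general_linear_group\<^esub> y \<otimes>\<^bsub>general_linear_group\<^esub> z = x \<otimes>\<^bsub>general_linear_group\<^esub> (y \<otimes>\<^bsub>general_linear_group\<^esub> z)"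
    by (simp add: general_linear_group_def matrix_mul_assoc)
  show "\<one>\<^bsub>general_linear_group\<^esub> \<otimes>\<^bsub>general_linear_group\<^esub> x = x"
    by (simp add: general_linear_group_def matrix_mul_lid)
  show "\<exists>y\<in>carrier general_linear_group. y \<otimes>\<^bsub>general_linear_group\<^esub> x = \<one>\<^bsub>general_linear_group\<^esub>"
    if "x \<in> carrier general_linear_group"
  proof -
    have inv: "invertible x" using that by (simp add: general_linear_group_def)
    show ?thesis
      using matrix_inv_both[OF inv] matrix_inv_eqI(2)[of "matrix_inv x" x]
      by (intro bexI[of _ "matrix_inv x"]) (simp_all add: general_linear_group_def)
  qed
qed

lemma automorphism_group_gl_action:
  fixes G :: "('k::field ^ 'n::finite ^ 'n) set"
  assumes "subgroup G general_linear_group"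
  shows "automorphism_group (gl_action ` G)"
proof -
  interpret GL: group "general_linear_group :: ('k ^ 'n ^ 'n) monoid" by (rule group_general_linear_group)
  interpret subgroup G general_linear_group by (rule assms)
  have inv: "invertible x" if "x \<in> G" for x
    using mem_carrier[OF that] by (simp add: general_linear_group_def)
  have one: "mat 1 \<in> G" using one_closed by (simp add: general_linear_group_def)
  have mult: "x ** y \<in> G" if "x \<in> G" "y \<in> G" for x y
    using m_closed[OF that] by (simp add: general_linear_group_def)
  have inverse: "\<exists>y\<in>G. x ** y = mat 1 \<and> y ** x = mat 1" if "x \<in> G" for x
    using m_inv_closed[OF that] GL.r_inv[OF mem_carrier[OF that]] GL.l_inv[OF mem_carrier[OF that]]
    by (intro bexI[of _ "inv\<^bsub>general_linear_group\<^esub> x"]) (simp_all add: general_linear_group_def)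
  have comp: "gl_action x \<circ> gl_action y = gl_action (x ** y)" if "x \<in> G" "y \<in> G" for x y
    using gl_action_comp[OF inv[OF that(1)] inv[OF that(2)]] by (simp add: fun_eq_iff)
  have id: "gl_action (mat 1 :: 'k ^ 'n ^ 'n) = id"
    by (simp add: fun_eq_iff gl_action_one)
  show ?thesis
    unfolding automorphism_group_def
  proof (intro conjI ballI)
    show "id \<in> gl_action ` G" using id one by (metis image_eqI)
    show "is_ring_hom g" if "g \<in> gl_action ` G" for g using that gl_action_hom by auto
    show "g \<circ> h \<in> gl_action ` G" if "g \<in> gl_action ` G" "h \<in> gl_action ` G" for g h
      using that comp mult by auto
    show "\<exists>h\<in>gl_action ` G. g \<circ> h = id \<and> h \<circ> g = id" if g: "g \<in> gl_action ` G" for g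
    proof -
      obtain x where x: "x \<in> G" "g = gl_action x" using g by (elim imageE)
      obtain y where y: "y \<in> G" "x ** y = mat 1" "y ** x = mat 1" using inverse[OF x(1)] by blast
      show ?thesis
        using x y comp id by (intro bexI[of _ "gl_action y"]) auto
    qed
  qed
qed

lemma automorphism_group_inj: "automorphism_group A \<Longrightarrow> g \<in> A \<Longrightarrow> inj g"
  unfolding automorphism_group_def by (metis inj_on_id inj_on_imageI2 inj_on_inverseI comp_apply id_apply)

lemma gl_action_linear_forms:
  assumes "automorphism_group A" "A \<subseteq> range gl_action" "g \<in> A"
  shows "g ` linear_forms = linear_forms"
proof -
  have sub: "f ` linear_forms \<subseteq> linear_forms" if "f \<in> A" for f
    using assms(2) that by (auto simp: linear_forms_def gl_action_linear_form)
  obtain h where h: "h \<in> A" "g \<circ> h = id"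
    using assms(1,3) unfolding automorphism_group_def by blast
  have "w \<in> g ` linear_forms" if "w \<in> linear_forms" for w
  proof -
    have "w = g (h w)" using h(2) by (metis comp_apply id_apply)
    then show ?thesis using sub[OF h(1)] that by blast
  qed
  then show ?thesis using sub[OF assms(3)] by blast
qed

lemma root_poly_linear_forms: "root_poly linear_forms = (dickson_product :: ('k::{field,finite}, 'n::finite) mpoly poly)"
  unfolding root_poly_def dickson_product_def linear_forms_def
  by (subst prod.reindex[OF inj_linear_form]) simp

section \<open>Dickson polynomials annihilate local cohomology\<close>

text \<open>Multiplication by \<open>s\<close> is zero on \<open>Ext^k(C / J, C)\<close> for all \<open>J\<close> in \<open>\<J>\<close> and \<open>k < d\<close>.\<close>

definition kills_cocycles :: "'a::comm_ring_1 set \<Rightarrow> 'a set set \<Rightarrow> nat \<Rightarrow> 'a \<Rightarrow> bool" where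
  "kills_cocycles C \<J> d s \<longleftrightarrow> s \<in> C \<and> (\<forall>J\<in>\<J>. \<forall>k<d. \<forall>\<phi>\<in>mod_hom (subring_of C) (free_module C) (set_module C).
    (\<forall>p\<in>carrier (free_module C). \<phi> (free_resolution.diff C J (Suc k) p) = 0) \<longrightarrow>
    (\<exists>\<psi>\<in>mod_hom (subring_of C) (free_module C) (set_module C).
      \<forall>p\<in>carrier (free_module C). s * \<phi> p = \<psi> (free_resolution.diff C J k p)))"

lemma set_module_hom_mult:
  assumes C: "is_subring C" and t: "t \<in> C" and \<phi>: "\<phi> \<in> mod_hom (subring_of C) (free_module C) (set_module C)"
  shows "(\<lambda>p. t * \<phi> p) \<in> mod_hom (subring_of C) (free_module C) (set_module C)"
  using mod_homD[OF \<phi>] t is_subringD[OF C]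
  by (intro mod_homI) (simp_all add: algebra_simps)

lemma set_module_hom_add:
  assumes C: "is_subring C" and \<phi>: "\<phi> \<in> mod_hom (subring_of C) (free_module C) (set_module C)"
    and \<psi>: "\<psi> \<in> mod_hom (subring_of C) (free_module C) (set_module C)"
  shows "(\<lambda>p. \<phi> p + \<psi> p) \<in> mod_hom (subring_of C) (free_module C) (set_module C)"
  using mod_homD[OF \<phi>] mod_homD[OF \<psi>] is_subringD[OF C]
  by (intro mod_homI) (simp_all add: algebra_simps)

lemma kills_cocycles_mult:
  assumes C: "is_subring C" and s: "kills_cocycles C \<J> d s" and t: "t \<in> C"
  shows "kills_cocycles C \<J> d (t * s)"
  unfolding kills_cocycles_def
proof (intro conjI ballI allI impI)
  show "t * s \<in> C" using s t is_subringD[OF C] by (simp add: kills_cocycles_def)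
next
  fix J k \<phi> assume *: "J \<in> \<J>" "k < d" "\<phi> \<in> mod_hom (subring_of C) (free_module C) (set_module C)"
    "\<forall>p\<in>carrier (free_module C). \<phi> (free_resolution.diff C J (Suc k) p) = 0"
  then obtain \<psi> where \<psi>: "\<psi> \<in> mod_hom (subring_of C) (free_module C) (set_module C)"
      "\<forall>p\<in>carrier (free_module C). s * \<phi> p = \<psi> (free_resolution.diff C J k p)"
    using s unfolding kills_cocycles_def by blast
  show "\<exists>\<psi>\<in>mod_hom (subring_of C) (free_module C) (set_module C).
      \<forall>p\<in>carrier (free_module C). t * s * \<phi> p = \<psi> (free_resolution.diff C J k p)"
    by (rule bexI[OF _ set_module_hom_mult[OF C t \<psi>(1)]])
      (use \<psi>(2) in \<open>simp add: mult.assoc del: free_module_simps(1)\<close>)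
qed

lemma kills_cocycles_add:
  assumes C: "is_subring C" and s: "kills_cocycles C \<J> d s" and t: "kills_cocycles C \<J> d t"
  shows "kills_cocycles C \<J> d (s + t)"
  unfolding kills_cocycles_def
proof (intro conjI ballI allI impI)
  show "s + t \<in> C" using s t is_subringD[OF C] by (simp add: kills_cocycles_def)
next
  fix J k \<phi> assume *: "J \<in> \<J>" "k < d" "\<phi> \<in> mod_hom (subring_of C) (free_module C) (set_module C)"
    "\<forall>p\<in>carrier (free_module C). \<phi> (free_resolution.diff C J (Suc k) p) = 0"
  obtain \<psi> where \<psi>: "\<psi> \<in> mod_hom (subring_of C) (free_module C) (set_module C)"
      "\<forall>p\<in>carrier (free_module C). s * \<phi> p = \<psi> (free_resolution.diff C J k p)"
    using s * unfolding kills_cocycles_def by blast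
  obtain \<psi>' where \<psi>': "\<psi>' \<in> mod_hom (subring_of C) (free_module C) (set_module C)"
      "\<forall>p\<in>carrier (free_module C). t * \<phi> p = \<psi>' (free_resolution.diff C J k p)"
    using t * unfolding kills_cocycles_def by blast
  show "\<exists>\<psi>\<in>mod_hom (subring_of C) (free_module C) (set_module C).
      \<forall>p\<in>carrier (free_module C). (s + t) * \<phi> p = \<psi> (free_resolution.diff C J k p)"
    by (rule bexI[OF _ set_module_hom_add[OF C \<psi>(1) \<psi>'(1)]])
      (use \<psi>(2) \<psi>'(2) in \<open>simp add: distrib_right del: free_module_simps(1)\<close>)
qed

context
  fixes A :: "(('k::{field,finite}, 'n::finite) mpoly \<Rightarrow> ('k, 'n) mpoly) set" and I :: "('k, 'n) mpoly set"
  assumes A: "automorphism_group A" and A_gl: "A \<subseteq> range gl_action"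
    and I: "ideal I (subring_of (fixed_ring A))"
    and I_pos: "\<And>f m. f \<in> fixed_ring A \<Longrightarrow> m > 0 \<Longrightarrow> homogeneous m f \<Longrightarrow> f \<in> I"
    and d2: "CARD('n) \<ge> 2"
begin

interpretation field_domain "const_poly :: 'k \<Rightarrow> ('k, 'n) mpoly" "CARD('k)"
  by (rule field_domain_mpoly)

lemma A_hom: "g \<in> A \<Longrightarrow> is_ring_hom g"
  using A by (simp add: automorphism_group_def)

lemma A_const: "g \<in> A \<Longrightarrow> g (const_poly c) = const_poly c"
  using A_gl by (auto simp: gl_action_const)

lemma A_inj: "g \<in> A \<Longrightarrow> inj g"
  by (rule automorphism_group_inj[OF A])

lemma A_homogeneous: "g \<in> A \<Longrightarrow> homogeneous m f \<Longrightarrow> homogeneous m (g f)"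
  using A_gl by (auto simp: homogeneous_gl_action)

lemma A_linear_forms: "g \<in> A \<Longrightarrow> g ` linear_forms = linear_forms"
  by (rule gl_action_linear_forms[OF A A_gl])

lemma finite_A: "finite A"
  by (rule finite_subset[OF A_gl]) simp

lemma subring_C: "is_subring (fixed_ring A)"
  by (rule is_subring_fixed_ring[OF A_hom])

lemma free_resolution_power: "free_resolution (fixed_ring A) (I [^]\<^bsub>ideals_set (subring_of (fixed_ring A))\<^esub> (n::nat))"
proof -
  have "ideal (I [^]\<^bsub>ideals_set (subring_of (fixed_ring A))\<^esub> n) (subring_of (fixed_ring A))"
    by (rule ideal_power_ideal[OF cring_subring_of[OF subring_C] I])
  from ideal_elements_subring[OF this subring_C] show ?thesis
    by unfold_locales (auto simp: subring_C countable_mpoly infinite_mpoly)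
qed

text \<open>A cocycle with values in the invariants of \<open>A\<close> is one with values in the larger ring of
  invariants of \<open>H\<close>, and powers of the elements of its regular sequence lie in the ideal generated by \<open>J\<close>.\<close>

lemma stabilizer_coboundary:
  assumes HA: "H \<subseteq> A" and H_W0: "\<And>g v. g \<in> H \<Longrightarrow> v \<in> linear_forms \<Longrightarrow> g v - v \<in> W0"
    and W0: "kspace W0" "W0 \<subseteq> linear_forms" "card W0 = CARD('k) ^ i" and i: "i \<le> 2"
    and J: "J = I [^]\<^bsub>ideals_set (subring_of (fixed_ring A))\<^esub> (n::nat)" and k: "k < CARD('n)"
    and \<phi>: "\<phi> \<in> mod_hom (subring_of (fixed_ring A)) (free_module (fixed_ring A)) (set_module (fixed_ring A))"
    and cocycle: "\<And>p. p \<in> carrier (free_module (fixed_ring A)) \<Longrightarrow> \<phi> (free_resolution.diff (fixed_ring A) J (Suc k) p) = 0"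
  shows "\<exists>\<psi>\<in>mod_hom (subring_of (fixed_ring A)) (free_module (fixed_ring A)) (set_module (fixed_ring H)).
    \<forall>p\<in>carrier (free_module (fixed_ring A)). \<phi> p = \<psi> (free_resolution.diff (fixed_ring A) J k p)"
proof -
  let ?C = "fixed_ring A" and ?M = "fixed_ring H"
  have H: "is_ring_hom g" "inj g" "g (const_poly c) = const_poly c" if "g \<in> H" for g c
    using that HA A_hom A_inj A_const by auto
  have CM: "?C \<subseteq> ?M" using HA by (auto simp: fixed_ring_def)
  have M: "is_subring ?M" by (rule is_subring_fixed_ring[OF H(1)])
  have "\<exists>z. regular_seq ?M (CARD('n)) z \<and> (\<forall>j<CARD('n). z j \<in> ?M \<and> (\<exists>e>0. homogeneous e (z j)))"
    by (rule stabilizer_regular_sequence[OF _ _ _ _ W0 i d2]) (erule H(1) H(3) H(2) H_W0)+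
  then obtain z where z: "regular_seq ?M (CARD('n)) z"
    "\<forall>j<CARD('n). z j \<in> ?M \<and> (\<exists>e>0. homogeneous e (z j))"
    by (elim exE conjE)
  have nilp: "\<exists>e. z j ^ e \<in> add_span J ?M" if j: "j < CARD('n)" for j
  proof -
    obtain e where e: "z j \<in> ?M" "e > 0" "homogeneous e (z j)" using z(2) j by blast
    have "z j ^ card A \<in> add_span I ?M"
      by (rule homogeneous_power_in_span[OF A finite_A _ M e(1) e(3) e(2) _
          ideal_elements_subring(2)[OF I subring_C]]) (erule A_homogeneous I_pos, assumption+)+
    from add_span_ideal_power[OF M subring_C CM this, of n] show ?thesis
      unfolding J power_mult[symmetric] by (rule exI)
  qed
  interpret free_resolution ?C J unfolding J by (rule free_resolution_power)
  interpret free_resolution_over ?C J ?M by unfold_locales (rule M, rule CM)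
  have \<phi>': "\<phi> \<in> mod_hom S F (set_module ?M)"
    using mod_homD[OF \<phi>] CM by (intro mod_homI) auto
  show ?thesis
    by (rule cocycle_eq_coboundary[OF z(1) nilp k \<phi>' cocycle])
qed

lemma dickson_coeff_fixed: "dickson_coeff linear_forms j \<in> fixed_ring A"
proof -
  have "g (dickson_coeff linear_forms j) = dickson_coeff linear_forms j" if g: "g \<in> A" for g
    using hom_dickson_coeff[of g linear_forms j] g A_hom A_const A_inj A_linear_forms kspaceD(1)[OF kspace_linear_forms]
    by metis
  then show ?thesis by (simp add: fixed_ring_def)
qed

text \<open>A pair of a flag \<open>ys\<close> and a list \<open>bs\<close> with nonzero weight is fixed only by automorphisms that fix \<open>bs\<close>
  elementwise, hence fix the quotient of the linear forms by the flag, which \<open>bs\<close> spans. So they move linear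
  forms only by elements of the kernel \<open>?W0\<close> of that quotient map, a space of dimension \<open>i\<close>.\<close>

theorem dickson_power_kills_cocycles:
  assumes i: "i \<le> 2" and t: "CARD('n) \<le> CARD('k) ^ t"
  shows "kills_cocycles (fixed_ring A) (range (\<lambda>n::nat. I [^]\<^bsub>ideals_set (subring_of (fixed_ring A))\<^esub> n)) CARD('n)
    (((- 1) ^ i * dickson_coeff linear_forms i) ^ (CARD('k) ^ t))"
  unfolding kills_cocycles_def
proof (intro conjI ballI allI impI)
  let ?C = "fixed_ring A"
  let ?s = "((- 1) ^ i * dickson_coeff linear_forms i) ^ (CARD('k) ^ t) :: ('k, 'n) mpoly"
  note C' = is_subringD[OF subring_C]
  have "g ?s = ?s" if "g \<in> A" for g
    using that by (simp add: is_ring_homD[OF A_hom[OF that]] fixed_ringD[OF dickson_coeff_fixed that])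
  then show "?s \<in> ?C" by (simp add: fixed_ring_def)
next
  let ?C = "fixed_ring A" and ?d = "CARD('n)" and ?q = "CARD('k)" and ?L = "linear_forms :: ('k, 'n) mpoly set"
  fix J k \<phi>
  assume J: "J \<in> range (\<lambda>n::nat. I [^]\<^bsub>ideals_set (subring_of ?C)\<^esub> n)" and k: "k < ?d"
    and \<phi>: "\<phi> \<in> mod_hom (subring_of ?C) (free_module ?C) (set_module ?C)"
    and cocycle: "\<forall>p\<in>carrier (free_module ?C). \<phi> (free_resolution.diff ?C J (Suc k) p) = 0"
  obtain n :: nat where n: "J = I [^]\<^bsub>ideals_set (subring_of ?C)\<^esub> n" using J by blast
  interpret free_resolution ?C J unfolding n by (rule free_resolution_power)
  note L = kspace_linear_forms[where 'k = 'k and 'n = 'n]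
  define Bs where "Bs ys = {bs. set bs \<subseteq> quots ys ` ?L \<and> length bs = ?d - i}" for ys
  define Xs where "Xs = (SIGMA ys:flags i ?L. Bs ys)"
  define c where "c = (\<lambda>(ys, bs). dickson_coeff (quots ys ` ?L) 0 ^ (?q ^ t - (?d - i)) * weight (?q ^ (?d - i)) bs)"
  define act where "act g = (\<lambda>(ys, bs). (map g ys, map g bs))" for g :: "('k, 'n) mpoly \<Rightarrow> ('k, 'n) mpoly"
  have id: "i \<le> ?d" and mt: "?d - i \<le> ?q ^ t" using i d2 t by auto
  have fin_Bs: "finite (Bs ys)" for ys
    unfolding Bs_def using kspaceD(1)[OF kspace_quots[OF L]] by (rule finite_lists_length_eq)
  have sum_c: "(\<Sum>x\<in>Xs. c x) = ((- 1) ^ i * dickson_coeff ?L i) ^ (?q ^ t)"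
    using dickson_coeff_power_eq_sum[OF L card_linear_forms id mt] finite_flags[OF L] fin_Bs
    unfolding Xs_def c_def Bs_def[symmetric] by (simp add: sum.Sigma)
  have fin: "finite Xs"
    unfolding Xs_def by (intro finite_SigmaI finite_flags[OF L] fin_Bs)
  have im: "quots (map g ys) ` ?L = g ` quots ys ` ?L" if "g \<in> A" for g ys
    using image_quots[OF A_hom[OF that], of ys ?L] A_linear_forms[OF that] A_const[OF that] by simp
  have act_Xs: "act g x \<in> Xs" if g: "g \<in> A" and x: "x \<in> Xs" for g x
  proof -
    obtain ys bs where x': "x = (ys, bs)" "ys \<in> flags i ?L" "bs \<in> Bs ys" using x unfolding Xs_def by blast
    have "map g ys \<in> flags i ?L"
      using hom_flags[OF A_hom[OF g] A_const[OF g] A_inj[OF g] x'(2)] A_linear_forms[OF g] by simp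
    moreover have "map g bs \<in> Bs (map g ys)"
      using x'(3) unfolding Bs_def im[OF g] by auto
    ultimately show ?thesis unfolding Xs_def act_def x'(1) by simp
  qed
  have c_act: "c (act g x) = g (c x)" if g: "g \<in> A" and x: "x \<in> Xs" for g x
  proof -
    obtain ys bs where x': "x = (ys, bs)" by (cases x)
    have "dickson_coeff (g ` quots ys ` ?L) 0 = g (dickson_coeff (quots ys ` ?L) 0)"
      by (rule hom_dickson_coeff[OF A_hom[OF g] A_const[OF g] kspaceD(1)[OF kspace_quots[OF L]] A_inj[OF g]])
    moreover have "weight N (map g bs) = g (weight N bs)" for N
      by (rule hom_weight[OF A_hom[OF g] A_const[OF g] A_inj[OF g]])
    ultimately show ?thesis
      unfolding x' c_def act_def by (simp add: im[OF g] is_ring_homD[OF A_hom[OF g]])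
  qed
  have split: "\<exists>\<psi>\<in>mod_hom S F (set_module (fixed_ring {g \<in> A. act g x = x})). \<forall>p\<in>carrier F. \<phi> p = \<psi> (diff k p)"
    if x: "x \<in> Xs" and cx: "c x \<noteq> 0" for x
  proof -
    obtain ys bs where x': "x = (ys, bs)" "ys \<in> flags i ?L" "bs \<in> Bs ys" using x unfolding Xs_def by blast
    let ?H = "{g \<in> A. act g x = x}" and ?W0 = "{v \<in> ?L. quots ys v = 0}"
    have "weight (?q ^ (?d - i)) bs \<noteq> 0" using cx unfolding c_def x'(1) by auto
    then have span: "span_list bs = quots ys ` ?L"
      using x'(3) card_quots[OF L card_linear_forms id x'(2)] kspace_quots[OF L, of ys] unfolding Bs_def
      by (intro weight_nonzero_span[where m = "?d - i" and N = "?q ^ (?d - i)"]) auto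
    have "quots ys (a + b) = quots ys a + quots ys b" for a b
      using quots_diff[of ys "a + b" b] by simp
    then have W0: "kspace ?W0"
      using kspaceD[OF L] unfolding kspace_def by (simp add: quots_zero quots_scale)
    have act_W0: "g v - v \<in> ?W0" if g: "g \<in> ?H" and v: "v \<in> ?L" for g v
    proof -
      have gA: "g \<in> A" and gy: "map g ys = ys" and gb: "map g bs = bs"
        using g unfolding x'(1) act_def by auto
      have "g (quots ys v) = quots ys v"
      proof (rule span_list_fixed[OF A_hom[OF gA] A_const[OF gA], of bs])
        show "g b = b" if "b \<in> set bs" for b using gb that by (metis map_eq_conv list.map_id id_apply)
        show "quots ys v \<in> span_list bs" unfolding span using v by blast
      qed
      then have "quots ys (g v) = quots ys v"
        using hom_quots[OF A_hom[OF gA] A_const[OF gA], of ys v] gy by simp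
      moreover have "g v \<in> ?L" using A_linear_forms[OF gA] v by blast
      moreover have "g v - v \<in> ?L"
        using kspaceD(3)[OF L \<open>g v \<in> ?L\<close> kspace_uminus[OF L v]] by simp
      ultimately show ?thesis by (simp add: quots_diff)
    qed
    show ?thesis
      by (rule stabilizer_coboundary[OF _ _ W0 _ card_kernel_quots[OF L card_linear_forms id x'(2)] i n k \<phi>])
        (use act_W0 cocycle in \<open>auto simp del: free_module_simps(1)\<close>)
  qed
  show "\<exists>\<psi>\<in>mod_hom S F (set_module ?C). \<forall>p\<in>carrier F.
      ((- 1) ^ i * dickson_coeff ?L i) ^ (?q ^ t) * \<phi> p = \<psi> (diff k p)"
    unfolding sum_c[symmetric]
    by (rule orbit_transfer[OF A refl, where act = act])
      (use act_Xs fin c_act \<phi> split in \<open>auto simp: act_def simp del: free_module_simps(1)\<close>)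
qed

end

theorem corollary1p10:
  fixes G :: "('k::{field,finite} ^ 'n::finite ^ 'n) set"
    and E :: "nat \<Rightarrow> (('k, 'n) mpoly, 'e) module"
    and \<delta> :: "nat \<Rightarrow> 'e \<Rightarrow> 'e"
    and \<epsilon> :: "('k, 'n) mpoly \<Rightarrow> 'e"
  assumes "CARD('n) \<ge> 4"
    and "subgroup G general_linear_group"
    and "injective_resolution (invariant_ring G) (regular_module (invariant_ring G)) E \<delta> \<epsilon>"
  shows "\<forall>i \<le> CARD('n) - 1.
    Idl\<^bsub>invariant_ring G\<^esub> {dickson 0, dickson 1, dickson 2} \<subseteq>
    radical (invariant_ring G)
      (annihilator (invariant_ring G)
        (local_cohomology (invariant_ring G) (positive_ideal (invariant_ring G)) E \<delta> i))"
proof (intro allI impI subsetI)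
  fix i r
  assume i: "i \<le> CARD('n) - 1" and r: "r \<in> Idl\<^bsub>invariant_ring G\<^esub> {dickson 0, dickson 1, dickson 2}"
  interpret field_domain "const_poly :: 'k \<Rightarrow> ('k, 'n) mpoly" "CARD('k)"
    by (rule field_domain_mpoly)
  define A where "A = (gl_action :: 'k ^ 'n ^ 'n \<Rightarrow> _) ` G"
  define C where "C = fixed_ring A"
  define I where "I = positive_ideal (subring_of C)"
  have A: "automorphism_group A" unfolding A_def by (rule automorphism_group_gl_action[OF assms(2)])
  have A_gl: "A \<subseteq> range gl_action" unfolding A_def by blast
  have S: "invariant_ring G = subring_of C"
    unfolding invariant_ring_def subring_of_def C_def A_def fixed_ring_def by simp
  have C: "is_subring C"
    unfolding C_def using A by (intro is_subring_fixed_ring) (simp add: automorphism_group_def)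
  interpret S: cring "subring_of C" by (rule cring_subring_of[OF C])
  have pos: "{f \<in> carrier (subring_of C). \<exists>m>0. homogeneous m f} \<subseteq> carrier (subring_of C)" by blast
  have I: "ideal I (subring_of C)"
    unfolding I_def positive_ideal_def by (rule S.genideal_ideal[OF pos])
  have I_pos: "f \<in> I" if "f \<in> C" "m > 0" "homogeneous m f" for f m
    unfolding I_def positive_ideal_def using S.genideal_self[OF pos] that by auto
  have d: "CARD('n) \<ge> 2" using assms(1) by simp
  \<comment> \<open>A power of \<open>q\<close> that is at least \<open>d\<close>, as the lists of vectors require.\<close>
  define Q where "Q = CARD('k) ^ CARD('n)"
  have dQ: "CARD('n) \<le> Q"
    unfolding Q_def using q_ge_2 by (meson less_exp less_imp_le order_trans power_mono zero_le)
  let ?kills = "kills_cocycles C (range (\<lambda>n::nat. I [^]\<^bsub>ideals_set (subring_of C)\<^esub> n)) (CARD('n))"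
  have dickson: "(dickson j :: ('k, 'n) mpoly) = (- 1) ^ (CARD('n) - j) * dickson_coeff linear_forms j" for j
    unfolding dickson_def dickson_coeff_def root_poly_linear_forms by simp
  have minus1: "(- 1) ^ n \<in> C" for n
    using is_subringD[OF C] by (induction n) auto
  have dickson_C: "dickson j \<in> C" for j
  proof -
    have "dickson_coeff linear_forms j \<in> C"
      unfolding C_def by (rule dickson_coeff_fixed[OF A A_gl I[unfolded C_def] I_pos[unfolded C_def] d])
    then show ?thesis
      unfolding dickson using minus1 is_subringD[OF C] by simp
  qed
  have kills_dickson: "?kills (dickson j ^ Q)" if "j \<le> 2" for j
  proof -
    have "?kills (((- 1) ^ j * dickson_coeff linear_forms j) ^ Q)"
      unfolding Q_def C_def
      by (rule dickson_power_kills_cocycles[OF A A_gl I[unfolded C_def] I_pos[unfolded C_def] d that dQ[unfolded Q_def]])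
    from kills_cocycles_mult[OF C this minus1[of "CARD('n) * Q"]]
    have "?kills (((- 1) ^ CARD('n) * ((- 1) ^ j * dickson_coeff linear_forms j)) ^ Q)"
      by (simp add: power_mult_distrib power_mult)
    moreover have "(- 1) ^ CARD('n) * (- 1) ^ j = ((- 1) ^ (CARD('n) - j) :: ('k, 'n) mpoly)"
      using that d by (simp add: neg_one_power_add_eq_neg_one_power_diff flip: power_add)
    ultimately show ?thesis unfolding dickson by (simp flip: mult.assoc)
  qed
  \<comment> \<open>Closed under addition because the \<open>Q\<close>-th power is additive.\<close>
  define T where "T = {r \<in> C. ?kills (r ^ Q)}"
  have T_mult: "a * x \<in> T" if "a \<in> C" "x \<in> T" for a x
  proof -
    have "a ^ Q \<in> C" using that(1) is_subringD[OF C] by (induction Q) auto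
    then show ?thesis
      using that kills_cocycles_mult[OF C, of _ _ "x ^ Q" "a ^ Q"] is_subringD[OF C]
      unfolding T_def by (simp add: power_mult_distrib)
  qed
  have T_add: "x + y \<in> T" if "x \<in> T" "y \<in> T" for x y
    using that kills_cocycles_add[OF C, of _ _ "x ^ Q" "y ^ Q"] is_subringD[OF C]
    unfolding T_def Q_def by (simp add: frobenius_power_add)
  have "ideal T (subring_of C)"
  proof (rule idealI[OF S.ring_axioms])
    show "subgroup T (add_monoid (subring_of C))"
    proof (rule group.subgroupI[OF S.add.is_group])
      show "T \<subseteq> carrier (add_monoid (subring_of C))" unfolding T_def by auto
      show "T \<noteq> {}" using dickson_C[of 0] kills_dickson[of 0] unfolding T_def by auto
      show "inv\<^bsub>add_monoid (subring_of C)\<^esub> x \<in> T" if x: "x \<in> T" for x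
      proof -
        have xC: "x \<in> carrier (subring_of C)" using x unfolding T_def by simp
        have "\<ominus>\<^bsub>subring_of C\<^esub> x = (\<ominus>\<^bsub>subring_of C\<^esub> \<one>\<^bsub>subring_of C\<^esub>) * x"
          using S.l_minus[OF S.one_closed xC] xC by simp
        then show ?thesis
          using T_mult[OF _ x, of "\<ominus>\<^bsub>subring_of C\<^esub> \<one>\<^bsub>subring_of C\<^esub>"] S.a_inv_closed[OF S.one_closed]
          unfolding a_inv_def by simp
      qed
    qed (use T_add in auto)
    show "x \<otimes>\<^bsub>subring_of C\<^esub> a \<in> T" "a \<otimes>\<^bsub>subring_of C\<^esub> x \<in> T"
      if "a \<in> T" "x \<in> carrier (subring_of C)" for a x
      using T_mult[of x a] that by (simp_all add: mult.commute)
  qed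
  moreover have "{dickson 0, dickson 1, dickson 2} \<subseteq> T"
    unfolding T_def using dickson_C kills_dickson by auto
  ultimately have "r \<in> T"
    using r S.genideal_minimal[of T] unfolding S by blast
  then have rC: "r \<in> C" and kills: "?kills (r ^ Q)" unfolding T_def by auto
  note res = assms(3)[unfolded S regular_module_subring_of]
  have "r ^ Q \<in> annihilator (subring_of C) (local_cohomology (subring_of C) I E \<delta> i)"
  proof (rule annihilator_local_cohomologyI[OF S.cring_axioms I])
    show "Module.module (subring_of C) (E j)" for j
      using res by (simp add: injective_resolution_def injective_module_def)
    show "\<delta> j \<in> mod_hom (subring_of C) (E j) (E (Suc j))" for j
      using res by (simp add: injective_resolution_def)
    show rQ: "r ^ Q \<in> carrier (subring_of C)" using kills by (simp add: kills_cocycles_def)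
  next
    fix x and n :: nat
    let ?J = "I [^]\<^bsub>ideals_set (subring_of C)\<^esub> n"
    assume x: "x \<in> carrier (E i)" "\<delta> i x = \<zero>\<^bsub>E (Suc i)\<^esub>" "\<And>r. r \<in> ?J \<Longrightarrow> r \<odot>\<^bsub>E i\<^esub> x = \<zero>\<^bsub>E i\<^esub>"
    interpret free_resolution C ?J
      unfolding C_def by (rule free_resolution_power[OF A A_gl I[unfolded C_def] I_pos[unfolded C_def] d])
    show "case i of 0 \<Rightarrow> r ^ Q \<odot>\<^bsub>E i\<^esub> x = \<zero>\<^bsub>E i\<^esub>
      | Suc j \<Rightarrow> \<exists>y\<in>carrier (E j). (\<forall>r\<in>?J. r \<odot>\<^bsub>E j\<^esub> y = \<zero>\<^bsub>E j\<^esub>) \<and> \<delta> j y = r ^ Q \<odot>\<^bsub>E i\<^esub> x"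
    proof (rule torsion_cocycle_killed[OF res])
      show "r ^ Q \<in> C" using kills by (simp add: kills_cocycles_def)
      show "\<exists>\<psi>\<in>mod_hom S F (set_module C). \<forall>p\<in>carrier F. r ^ Q * \<phi> p = \<psi> (diff k p)"
        if "k < CARD('n)" "\<phi> \<in> mod_hom S F (set_module C)" "\<And>p. p \<in> carrier F \<Longrightarrow> \<phi> (diff (Suc k) p) = 0" for k \<phi>
        using kills that unfolding kills_cocycles_def by blast
      show "i < CARD('n)" using i assms(1) by simp
    qed (erule x(3) | rule x)+
  qed
  moreover have "r [^]\<^bsub>subring_of C\<^esub> Q = r ^ Q"
    by (induction Q) (simp_all add: mult.commute)
  ultimately show "r \<in> radical (invariant_ring G)
      (annihilator (invariant_ring G)
        (local_cohomology (invariant_ring G) (positive_ideal (invariant_ring G)) E \<delta> i))"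
    unfolding S radical_def I_def[symmetric] using rC by (auto intro!: exI[of _ Q])
qed

end
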